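(* Let $\tau=\frac{\sqrt5-1}{2}$ and let $G=\overline{T_\tau}$ be the total lift to the real line of the golden ratio Thompson group $T_\tau$. For every $x\in\frac12\mathbf{Z}[\tau]$ with $x\ge0$, there exists $g\in G$ such that $\mathrm{scl}(g)=x$, where $\mathrm{scl}$ denotes stable commutator length in $G$. Moreover, if $x\in\mathbf{Z}[\tau]$, we may choose $g\in G'$.
   Context: $T_\tau$ is the group of orientation-preserving piecewise linear homeomorphisms $g$ of $\mathbf{R}/\mathbf{Z}$ such that: $g$ has finitely many breakpoints, all in $\mathbf{Z}[\tau]/\mathbf{Z}$; the derivatives, whenever they exist, are integer powers of $\tau$; $g$ preserves $\mathbf{Z}[\tau]/\mathbf{Z}$. The total lift $\overline{T_\tau}$ is the group of all homeomorphisms of $\mathbf{R}$ that commute with integer translations and induce an element of $T_\tau$ on $\mathbf{R}/\mathbf{Z}$. $G'$ is the commutator subgroup. For $g\in G'$, $\mathrm{cl}(g)$ is the least $n$ such that $g$ is a product of $n$ commutators of elements of $G$, and $\mathrm{scl}(g):=\lim_{n\to\infty}\mathrm{cl}(g^n)/n$. If $g^k\in G'$ for some $k\ge1$, $\mathrm{scl}(g):=\mathrm{scl}(g^k)/k$; otherwise $\mathrm{scl}(g):=\infty$. *)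

theory Defs
  imports
    "HOL-Analysis.Analysis"
    "HOL-Algebra.Generated_Groups"
    "HOL-Computational_Algebra.Polynomial"
begin

definition tau :: real where
  "tau = (sqrt 5 - 1) / 2"

text \<open>The ring \<open>\<int>[\<tau>]\<close>: values at \<open>\<tau>\<close> of polynomials with integer coefficients.\<close>

definition Z_tau :: "real set" where
  "Z_tau = range (\<lambda>p :: int poly. poly (map_poly of_int p) tau)"


section \<open>The circle \<open>\<real>/\<int>\<close>\<close>

quotient_type circle = real / "\<lambda>x y :: real. x - y \<in> \<int>"
  morphisms rep_circle circle_of
proof (rule equivpI)
  show "reflp (\<lambda>x y :: real. x - y \<in> \<int>)"
    by (simp add: reflp_def)
  show "symp (\<lambda>x y :: real. x - y \<in> \<int>)"
    by (metis (mono_tags, lifting) Ints_minus minus_diff_eq sympI)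
  show "transp (\<lambda>x y :: real. x - y \<in> \<int>)"
  proof (rule transpI)
    fix x y z :: real
    assume "x - y \<in> \<int>" "y - z \<in> \<int>"
    then have "(x - y) + (y - z) \<in> \<int>" by (rule Ints_add)
    then show "x - z \<in> \<int>" by simp
  qed
qed

text \<open>The quotient topology.\<close>

instantiation circle :: topological_space
begin

definition open_circle :: "circle set \<Rightarrow> bool" where
  "open_circle U \<longleftrightarrow> open (circle_of -` U)"

instance
proof
  show "open (UNIV :: circle set)"
    by (simp add: open_circle_def)
  show "open (S \<inter> T)" if "open S" "open T" for S T :: "circle set"
    using that by (simp add: open_circle_def vimage_Int open_Int)
  show "open (\<Union>K)" if "\<forall>S\<in>K. open S" for K :: "circle set set"
    using that by (auto simp: open_circle_def vimage_Union intro!: open_UN)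
qed

end


section \<open>The golden ratio Thompson group and its total lift\<close>

definition is_lift :: "(real \<Rightarrow> real) \<Rightarrow> (circle \<Rightarrow> circle) \<Rightarrow> bool" where
  "is_lift f g \<longleftrightarrow> continuous_on UNIV f \<and> (\<forall>x. circle_of (f x) = g (circle_of x))"

definition breakpoints :: "(real \<Rightarrow> real) \<Rightarrow> real set" where
  "breakpoints f = {x. \<not> (\<exists>a b. \<forall>\<^sub>F y in nhds x. f y = a * y + b)}"

text \<open>
  A homeomorphism of the circle is orientation-preserving if it has a strictly increasing lift.
  Two lifts of the same map differ by an integer constant, so breakpoints (modulo \<open>\<int>\<close>) and
  derivatives do not depend on the chosen lift. Finiteness of the set of breakpoints
  is what makes the map piecewise linear.
\<close>

definition T_tau :: "(circle \<Rightarrow> circle) set" where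
  "T_tau = {g. (\<exists>h. homeomorphism UNIV UNIV g h) \<and>
     (\<exists>f. is_lift f g \<and> strict_mono f \<and>
        finite (circle_of ` breakpoints f) \<and>
        circle_of ` breakpoints f \<subseteq> circle_of ` Z_tau \<and>
        (\<forall>x d. (f has_real_derivative d) (at x) \<longrightarrow> (\<exists>k :: int. d = tau powi k))) \<and>
     g ` (circle_of ` Z_tau) = circle_of ` Z_tau}"

definition total_lift :: "(circle \<Rightarrow> circle) set \<Rightarrow> (real \<Rightarrow> real) monoid" where
  "total_lift T =
     \<lparr>carrier = {f. (\<exists>h. homeomorphism UNIV UNIV f h) \<and>
                    (\<forall>x. \<forall>n :: int. f (x + of_int n) = f x + of_int n) \<and>
                    (\<exists>g\<in>T. is_lift f g)},
      mult = (\<circ>),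
      one = id\<rparr>"


section \<open>Stable commutator length\<close>

text \<open>
  Products of \<open>n = 0\<close> commutators are allowed, so the identity has commutator length \<open>0\<close>.
  The value is meaningful only for elements of the commutator subgroup
  \<^term>\<open>derived G (carrier G)\<close>.
\<close>

definition cl :: "('a, 'b) monoid_scheme \<Rightarrow> 'a \<Rightarrow> nat" where
  "cl G g = (LEAST n. \<exists>cs. length cs = n \<and> set cs \<subseteq> derived_set G (carrier G) \<and>
                          g = foldr (mult G) cs (one G))"

definition scl_derived :: "('a, 'b) monoid_scheme \<Rightarrow> 'a \<Rightarrow> real" where
  "scl_derived G g = lim (\<lambda>n. real (cl G (g [^]\<^bsub>G\<^esub> n)) / real n)"

text \<open>
  The extension to all of \<open>G\<close>. The quotient does not depend on the exponent \<open>k\<close>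
  with \<open>g\<^sup>k \<in> G'\<close>; we take the least one, which is \<open>1\<close> for \<open>g \<in> G'\<close>.
\<close>

definition scl :: "('a, 'b) monoid_scheme \<Rightarrow> 'a \<Rightarrow> ereal" where
  "scl G g =
     (if \<exists>k :: nat. k \<ge> 1 \<and> g [^]\<^bsub>G\<^esub> k \<in> derived G (carrier G)
      then let k = (LEAST k :: nat. k \<ge> 1 \<and> g [^]\<^bsub>G\<^esub> k \<in> derived G (carrier G))
           in ereal (scl_derived G (g [^]\<^bsub>G\<^esub> k) / real k)
      else \<infinity>)"

end

theory Submission
  imports Defs
begin

text \<open>
  The translation by \<open>2x\<close> has stable commutator length \<open>x\<close>.

  Lower bound: a commutator of homeomorphisms commuting with integer translations moves no point
  by more than \<open>2\<close>.

  Upper bound: commutators in the group can move \<open>0\<close> by any \<open>d \<in> \<int>[\<tau>]\<close> with \<open>0 \<le> d < 2\<close>, so for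
  \<open>y \<ge> 0\<close> the translation by \<open>y\<close> agrees, up to an element \<open>Q\<close> fixing \<open>0\<close>, with a product of about
  \<open>y/2\<close> commutators. It remains to bound the commutator length of \<open>Q\<^sup>2\<close>. Here \<open>Q\<close> is a product of
  two maps supported in arcs, so it suffices to treat \<open>h\<^sup>2\<close> for \<open>h\<close> piecewise linear with compact
  support in an interval. Presenting \<open>h\<close> as a product of homotheties of half-lines identifies the
  abelianization of the compactly supported group with the kernel of a central extension of the
  affine group \<open>\<int>[\<tau>] \<rtimes> \<langle>\<tau>\<rangle>\<close>, and a bilinear form computation shows that this kernel has
  exponent \<open>2\<close>. Finally, a compactly supported product of commutators is a product of two
  commutators, because its support can be displaced indefinitely.
\<close>

section \<open>The ring \<open>\<int>[\<tau>]\<close>\<close>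

text \<open>The obstacle is that the abelianization of the compactly supported group is shown to
  have exponent 2, not to vanish, so only the square of the error \<open>Q\<close> is known to be a
  product of commutators. Hence the translation by \<open>2y\<close> is treated as the square of
  \<open>T = PQ\<close>, where \<open>T\<close> is the translation by \<open>y\<close>: in
  \<open>(PQ)^2 = P^2 [P^-1, Q] Q^2\<close> the first factor costs about \<open>y\<close>
  commutators and the others a bounded number, which the stable limit ignores. The rate of half a
  commutator per unit of length matches the lower bound. The same doubling separates the two claims:
  the translation by \<open>2y\<close> lies in \<open>G'\<close> for every \<open>y \<ge> 0\<close>
  in \<open>Z[tau]\<close>, whereas for \<open>x\<close> in half of \<open>Z[tau]\<close> the
  translation by \<open>2x\<close> is only known to have its square in \<open>G'\<close>. The
  algebra takes place on the whole line because there the germs at plus infinity carry the affine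
  group. The price is that the commutators obtained have uncontrolled supports, which must be
  squeezed into a fundamental domain before anything can be made periodic.\<close>

lemma tau_pos: "0 < tau" and tau_less_1: "tau < 1" and tau_sq: "tau * tau = 1 - tau"
proof -
  have "sqrt 5 > 1" "sqrt 5 < 3" by (auto intro: real_less_rsqrt real_less_lsqrt)
  then show "0 < tau" "tau < 1" by (auto simp: tau_def)
  show "tau * tau = 1 - tau" by (simp add: tau_def field_simps)
qed

lemma tau_neq_0 [simp]: "tau \<noteq> 0"
  using tau_pos by simp

lemma inverse_tau: "inverse tau = 1 + tau"
  using tau_pos tau_sq by (simp add: field_simps)

lemma tau_powi_pos: "0 < tau powi k"
  using tau_pos by (simp add: zero_less_power_int)

lemma tau_powi_add: "tau powi (k + l) = tau powi k * tau powi l"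
  using tau_pos by (simp add: power_int_add)

lemma tau_powi_eq_1_iff: "tau powi k = 1 \<longleftrightarrow> k = 0"
proof
  assume *: "tau powi k = 1"
  have "tau ^ Suc n < 1" for n using tau_pos tau_less_1 by (metis power_Suc_less_one)
  then have "tau ^ n \<noteq> 1" if "n > 0" for n using that by (metis gr0_implies_Suc less_irrefl)
  then show "k = 0" using * tau_pos
  proof (cases "k \<ge> 0")
    case True
    then have "tau ^ nat k = 1" using * by (simp add: power_int_def)
    then have "\<not> nat k > 0" using \<open>\<And>n. n > 0 \<Longrightarrow> tau ^ n \<noteq> 1\<close> by blast
    then show ?thesis using True by simp
  next
    case False
    then have "tau ^ nat (- k) = 1" using * by (simp add: power_int_def power_inverse)
    then show ?thesis using False \<open>\<And>n. n > 0 \<Longrightarrow> tau ^ n \<noteq> 1\<close>[of "nat (- k)"] by simp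
  qed
qed simp

lemma Z_tau_iff: "x \<in> Z_tau \<longleftrightarrow> (\<exists>a b :: int. x = of_int a + of_int b * tau)"
proof
  have "\<exists>a b :: int. poly (map_poly of_int p) tau = of_int a + of_int b * tau" for p :: "int poly"
  proof (induction p)
    case (pCons c p)
    then obtain a b :: int where "poly (map_poly of_int p) tau = of_int a + of_int b * tau" by auto
    then have "poly (map_poly of_int (pCons c p)) tau = of_int c + tau * (of_int a + of_int b * tau)"
      by (simp add: map_poly_pCons)
    also have "\<dots> = of_int c + of_int a * tau + of_int b * (tau * tau)" by (simp add: algebra_simps)
    also have "\<dots> = of_int (c + b) + of_int (a - b) * tau" by (simp add: tau_sq algebra_simps)
    finally show ?case by blast
  qed (auto intro: exI[of _ 0])
  then show "x \<in> Z_tau \<Longrightarrow> \<exists>a b :: int. x = of_int a + of_int b * tau" by (auto simp: Z_tau_def)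
next
  assume "\<exists>a b :: int. x = of_int a + of_int b * tau"
  then obtain a b :: int where "x = of_int a + of_int b * tau" by auto
  then have "x = poly (map_poly of_int [:a, b:]) tau" by (simp add: map_poly_pCons mult.commute)
  then show "x \<in> Z_tau" unfolding Z_tau_def by blast
qed

lemma Z_tau_of_int [simp, intro]: "of_int a \<in> Z_tau"
  unfolding Z_tau_iff by (rule exI[of _ a], rule exI[of _ 0]) simp

lemma Z_tau_tau [simp, intro]: "tau \<in> Z_tau"
  unfolding Z_tau_iff by (rule exI[of _ 0], rule exI[of _ 1]) simp

lemma Z_tau_0 [simp, intro]: "0 \<in> Z_tau" and Z_tau_1 [simp, intro]: "1 \<in> Z_tau"
  using Z_tau_of_int[of 0] Z_tau_of_int[of 1] by auto

lemma Z_tau_add [intro]: "x \<in> Z_tau \<Longrightarrow> y \<in> Z_tau \<Longrightarrow> x + y \<in> Z_tau"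
  unfolding Z_tau_iff
proof (elim exE)
  fix a b c d :: int assume "x = of_int a + of_int b * tau" "y = of_int c + of_int d * tau"
  then have "x + y = of_int (a + c) + of_int (b + d) * tau" by (simp add: algebra_simps)
  then show "\<exists>a b :: int. x + y = of_int a + of_int b * tau" by blast
qed

lemma Z_tau_minus [intro]: "x \<in> Z_tau \<Longrightarrow> - x \<in> Z_tau"
  unfolding Z_tau_iff
proof (elim exE)
  fix a b :: int assume "x = of_int a + of_int b * tau"
  then have "- x = of_int (- a) + of_int (- b) * tau" by (simp add: algebra_simps)
  then show "\<exists>a b :: int. - x = of_int a + of_int b * tau" by blast
qed

lemma Z_tau_diff [intro]: "x \<in> Z_tau \<Longrightarrow> y \<in> Z_tau \<Longrightarrow> x - y \<in> Z_tau"
  using Z_tau_add[of x "- y"] Z_tau_minus[of y] by simp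

lemma Z_tau_add_iff: "x \<in> Z_tau \<Longrightarrow> x + y \<in> Z_tau \<longleftrightarrow> y \<in> Z_tau"
  using Z_tau_add[of x y] Z_tau_diff[of "x + y" x] by auto

lemma Z_tau_mult [intro]: "x \<in> Z_tau \<Longrightarrow> y \<in> Z_tau \<Longrightarrow> x * y \<in> Z_tau"
  unfolding Z_tau_iff
proof (elim exE)
  fix a b c d :: int assume "x = of_int a + of_int b * tau" "y = of_int c + of_int d * tau"
  then have "x * y = of_int a * of_int c + (of_int a * of_int d + of_int b * of_int c) * tau
      + of_int b * of_int d * (tau * tau)" by (simp add: algebra_simps)
  also have "\<dots> = of_int (a * c + b * d) + of_int (a * d + b * c - b * d) * tau"
    by (simp add: tau_sq algebra_simps)
  finally show "\<exists>a b :: int. x * y = of_int a + of_int b * tau" by blast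
qed

lemma Z_tau_power [intro]: "x \<in> Z_tau \<Longrightarrow> x ^ n \<in> Z_tau"
  by (induction n) auto

lemma Z_tau_powi [simp, intro]: "tau powi k \<in> Z_tau"
  by (auto simp: power_int_def inverse_tau intro!: Z_tau_power Z_tau_add)

lemma Z_tau_powi_mult_iff: "tau powi k * x \<in> Z_tau \<longleftrightarrow> x \<in> Z_tau"
proof
  assume "tau powi k * x \<in> Z_tau"
  then have "tau powi (- k) * (tau powi k * x) \<in> Z_tau" by auto
  then show "x \<in> Z_tau" using tau_powi_pos[of k] by (simp add: power_int_minus flip: mult.assoc)
qed auto

lemma Z_tau_dense:
  fixes a b :: real assumes "a < b"
  obtains x where "x \<in> Z_tau" "a < x" "x < b"
proof -
  have "(\<lambda>n. tau ^ n) \<longlonglongrightarrow> 0" using tau_pos tau_less_1 by (intro LIMSEQ_realpow_zero) auto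
  then have "eventually (\<lambda>n. tau ^ n < b - a) sequentially"
    using assms by (intro order_tendstoD) auto
  then obtain n where n: "tau ^ n < b - a" by (auto simp: eventually_sequentially)
  \<comment> \<open>The first multiple of \<open>tau ^ n\<close> beyond \<open>a\<close>; it
    overshoots by at most \<open>tau ^ n < b - a\<close>.\<close>
  define m where "m = \<lfloor>a / tau ^ n\<rfloor> + 1"
  have p: "tau ^ n > 0" using tau_pos by simp
  have "a / tau ^ n < m" "m \<le> a / tau ^ n + 1" unfolding m_def by linarith+
  then have "a < m * tau ^ n" "m * tau ^ n \<le> (a / tau ^ n + 1) * tau ^ n"
    using p by (auto simp: pos_divide_less_eq intro!: mult_right_mono)
  moreover have "(a / tau ^ n + 1) * tau ^ n = a + tau ^ n" using p by (simp add: distrib_right)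
  ultimately have "a < m * tau ^ n" "m * tau ^ n \<le> a + tau ^ n" by auto
  then show ?thesis using n by (intro that[of "of_int m * tau ^ n"]) auto
qed

text \<open>With \<open>x = a\<^sub>n \<tau>\<^sup>n + b\<^sub>n \<tau>\<^sup>n\<^sup>+\<^sup>1\<close>, the Galois conjugate of \<open>a\<^sub>n + b\<^sub>n \<tau>\<close> keeps a bounded
  absolute value while \<open>a\<^sub>n + b\<^sub>n \<tau>\<close> tends to infinity, so both coefficients become positive.\<close>
lemma Z_tau_pos_decomp:
  assumes "x \<in> Z_tau" "x > 0"
  obtains m m' n :: nat where "x = real m * tau ^ n + real m' * tau ^ Suc n" "m > 0" "m' > 0"
proof -
  obtain a b :: int where ab: "x = of_int a + of_int b * tau" using assms by (auto simp: Z_tau_iff)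
  \<comment> \<open>The conjugate of \<open>tau\<close> is \<open>- (1 + tau)\<close>, so this is
    the absolute value of the conjugate of \<open>x\<close>. Dividing by \<open>tau\<close>
    multiplies the conjugate by \<open>- tau\<close>, hence \<open>K\<close> bounds it at every
    level \<open>n\<close>.\<close>
  define K where "K = \<bar>of_int a - of_int b * (1 + tau)\<bar>"
  have ex: "\<exists>c d :: int. x = (of_int c + of_int d * tau) * tau ^ n \<and> \<bar>of_int c - of_int d * (1 + tau)\<bar> \<le> K" for n
  proof (induction n)
    case 0
    then show ?case using ab unfolding K_def by auto
  next
    case (Suc n)
    then obtain c d :: int where cd: "x = (of_int c + of_int d * tau) * tau ^ n"
      "\<bar>of_int c - of_int d * (1 + tau)\<bar> \<le> K" by auto
    have "of_int c + of_int d * tau = of_int c * (tau + tau * tau) + of_int d * tau" by (simp add: tau_sq)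
    then have "of_int c + of_int d * tau = (of_int (c + d) + of_int c * tau) * tau" by (simp add: algebra_simps)
    then have 1: "x = (of_int (c + d) + of_int c * tau) * tau ^ Suc n" using cd by simp
    have "tau * (of_int c - of_int d * (1 + tau)) = of_int c * tau - of_int d * (tau + tau * tau)"
      by (simp add: algebra_simps)
    also have "\<dots> = - (of_int (c + d) - of_int c * (1 + tau))" by (simp add: tau_sq algebra_simps)
    finally have "\<bar>of_int (c + d) - of_int c * (1 + tau)\<bar> = tau * \<bar>of_int c - of_int d * (1 + tau)\<bar>"
      using tau_pos by (metis abs_minus_cancel abs_mult abs_of_pos)
    also have "\<dots> \<le> 1 * \<bar>of_int c - of_int d * (1 + tau)\<bar>" using tau_less_1 by (intro mult_right_mono) auto
    finally show ?case using 1 cd(2) by (intro exI[of _ "c + d"] exI[of _ c]) auto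
  qed
  have "(\<lambda>n. tau ^ n) \<longlonglongrightarrow> 0" using tau_pos tau_less_1 by (intro LIMSEQ_realpow_zero) auto
  then have "eventually (\<lambda>n. tau ^ n < x / (2 * K + 1)) sequentially"
    using assms by (intro order_tendstoD[where y = 0] divide_pos_pos add_nonneg_pos) (auto simp: K_def)
  then obtain n where n: "tau ^ n < x / (2 * K + 1)" by (auto simp: eventually_sequentially)
  obtain c d :: int where cd: "x = (of_int c + of_int d * tau) * tau ^ n"
      "\<bar>of_int c - of_int d * (1 + tau)\<bar> \<le> K" using ex by blast
  have K0: "K \<ge> 0" by (simp add: K_def)
  have "tau ^ n * (2 * K + 1) < x" using n K0 by (simp add: field_simps)
  then have big: "2 * K + 1 < of_int c + of_int d * tau" using cd(1) tau_pos
    by (simp add: mult.commute mult_less_cancel_left_pos)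
  \<comment> \<open>This is the number minus its conjugate: the number exceeds
    \<open>2 * K + 1\<close>, the conjugate is at most \<open>K\<close>.\<close>
  have "of_int d * (1 + 2 * tau) > 0" using cd(2) big K0 by (simp add: algebra_simps)
  then have d: "d > 0" using tau_pos by (simp add: zero_less_mult_iff)
  have "tau * (of_int c - of_int d * (1 + tau)) \<ge> - K"
  proof -
    have "\<bar>tau * (of_int c - of_int d * (1 + tau))\<bar> \<le> 1 * K"
      unfolding abs_mult using tau_pos tau_less_1 cd(2) by (intro mult_mono) auto
    then show ?thesis by simp
  qed
  moreover have "tau * (of_int c - of_int d * (1 + tau)) = of_int c * tau - of_int d"
  proof -
    have "tau * (of_int c - of_int d * (1 + tau)) = of_int c * tau - of_int d * (tau + tau * tau)"
      by (simp add: algebra_simps)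
    then show ?thesis by (simp add: tau_sq)
  qed
  ultimately have "of_int c * tau - of_int d \<ge> - K" by simp
  have "of_int c * tau + of_int c > 0"
  proof -
    have "of_int d * tau \<le> tau * (of_int c * tau + K)" 
      using \<open>of_int c * tau - of_int d \<ge> - K\<close> tau_pos by (simp add: mult.commute mult_left_mono)
    also have "\<dots> \<le> of_int c * (tau * tau) + K" using tau_less_1 tau_pos K0 mult_left_le_one_le[of K tau]
      by (simp add: algebra_simps)
    finally have "0 < of_int c * (2 - tau)" using big K0 by (simp add: tau_sq algebra_simps)
    then have "c > 0" using tau_less_1 by (simp add: zero_less_mult_iff)
    then show ?thesis using tau_pos by (simp add: add_pos_pos)
  qed
  then have "of_int c * (1 + tau) > 0" by (simp add: algebra_simps)
  then have c: "c > 0" using tau_pos by (simp add: zero_less_mult_iff)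
  show ?thesis
    by (rule that[of "nat c" n "nat d"]) (use c d cd in \<open>auto simp: algebra_simps\<close>)
qed

section \<open>Piecewise linear homeomorphisms of the line\<close>

text \<open>Prescribing the two one-sided germs at each point makes composition, inversion and
  gluing local checks. By compactness breakpoints can accumulate only at infinity, which leaves room
  for periodic maps.\<close>

definition PL :: "(real \<Rightarrow> real) set" where
  "PL = {f. strict_mono f \<and> surj f \<and> (\<forall>x. f x \<in> Z_tau \<longleftrightarrow> x \<in> Z_tau) \<and>
     (\<forall>x. \<exists>k l :: int. \<exists>e>0. (\<forall>y\<in>{x..x+e}. f y = f x + tau powi k * (y - x)) \<and>
        (\<forall>y\<in>{x-e..x}. f y = f x + tau powi l * (y - x)) \<and> (x \<in> Z_tau \<or> k = l))}"

lemma germI: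
  fixes f :: "real \<Rightarrow> real" and k l :: int
  assumes "e > 0" "\<And>y. y \<in> {x..x+e} \<Longrightarrow> f y = f x + tau powi k * (y - x)"
    "\<And>y. y \<in> {x-e..x} \<Longrightarrow> f y = f x + tau powi l * (y - x)" "P \<or> k = l"
  shows "\<exists>k l :: int. \<exists>e>0. (\<forall>y\<in>{x..x+e}. f y = f x + tau powi k * (y - x)) \<and>
        (\<forall>y\<in>{x-e..x}. f y = f x + tau powi l * (y - x)) \<and> (P \<or> k = l)"
  by (rule exI[of _ k], rule exI[of _ l], rule exI[of _ e], intro conjI ballI; rule assms)

lemma PL_I:
  assumes "strict_mono f" "surj f" "\<And>x. f x \<in> Z_tau \<longleftrightarrow> x \<in> Z_tau"
    "\<And>x. \<exists>k l :: int. \<exists>e>0. (\<forall>y\<in>{x..x+e}. f y = f x + tau powi k * (y - x)) \<and>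
        (\<forall>y\<in>{x-e..x}. f y = f x + tau powi l * (y - x)) \<and> (x \<in> Z_tau \<or> k = l)"
  shows "f \<in> PL"
  using assms unfolding PL_def by blast

lemma PL_strict_mono: "f \<in> PL \<Longrightarrow> strict_mono f"
  and PL_surj: "f \<in> PL \<Longrightarrow> surj f"
  and PL_Z_tau: "f \<in> PL \<Longrightarrow> f x \<in> Z_tau \<longleftrightarrow> x \<in> Z_tau"
  by (auto simp: PL_def)

lemma PL_less_iff: "f \<in> PL \<Longrightarrow> f x < f y \<longleftrightarrow> x < y"
  using PL_strict_mono strict_mono_less by blast

lemma PL_le_iff: "f \<in> PL \<Longrightarrow> f x \<le> f y \<longleftrightarrow> x \<le> y"
  using PL_strict_mono strict_mono_less_eq by blast

lemma PL_eq_iff: "f \<in> PL \<Longrightarrow> f x = f y \<longleftrightarrow> x = y"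
  using PL_strict_mono strict_mono_eq by blast

lemma PL_bij: "f \<in> PL \<Longrightarrow> bij f"
  using PL_eq_iff PL_surj by (auto simp: bij_def inj_def)

lemma PL_germ:
  assumes "f \<in> PL"
  obtains k l :: int and e where "e > 0" "\<And>y. x \<le> y \<Longrightarrow> y \<le> x + e \<Longrightarrow> f y = f x + tau powi k * (y - x)"
    "\<And>y. x - e \<le> y \<Longrightarrow> y \<le> x \<Longrightarrow> f y = f x + tau powi l * (y - x)" "x \<in> Z_tau \<or> k = l"
proof -
  have "\<exists>k l :: int. \<exists>e>0. (\<forall>y\<in>{x..x+e}. f y = f x + tau powi k * (y - x)) \<and>
        (\<forall>y\<in>{x-e..x}. f y = f x + tau powi l * (y - x)) \<and> (x \<in> Z_tau \<or> k = l)"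
    using assms unfolding PL_def by blast
  then obtain k l :: int and e where "e > 0" "\<forall>y\<in>{x..x+e}. f y = f x + tau powi k * (y - x)"
        "\<forall>y\<in>{x-e..x}. f y = f x + tau powi l * (y - x)" "x \<in> Z_tau \<or> k = l" by blast
  then show ?thesis by (intro that[of e k l]; (simp only: atLeastAtMost_iff)?)
qed

lemma PL_affine:
  assumes "b \<in> Z_tau" shows "(\<lambda>x. tau powi k * x + b) \<in> PL"
proof (rule PL_I)
  show "strict_mono (\<lambda>x. tau powi k * x + b)" using tau_powi_pos by (auto simp: strict_mono_def)
  show "surj (\<lambda>x. tau powi k * x + b)"
    using tau_powi_pos[of k] by (intro surjI[of _ "\<lambda>y. (y - b) / tau powi k"]) auto
  show "tau powi k * x + b \<in> Z_tau \<longleftrightarrow> x \<in> Z_tau" for x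
    using Z_tau_add_iff[OF assms] Z_tau_powi_mult_iff by (simp add: add.commute[of _ b])
  show "\<exists>k' l :: int. \<exists>e>0. (\<forall>y\<in>{x..x+e}. tau powi k * y + b = tau powi k * x + b + tau powi k' * (y - x)) \<and>
        (\<forall>y\<in>{x-e..x}. tau powi k * y + b = tau powi k * x + b + tau powi l * (y - x)) \<and> (x \<in> Z_tau \<or> k' = l)" for x
    by (rule exI[of _ k], rule exI[of _ k], rule exI[of _ 1]) (auto simp: algebra_simps)
qed

lemma PL_translation: "b \<in> Z_tau \<Longrightarrow> (\<lambda>x. x + b) \<in> PL"
  using PL_affine[of b 0] by simp

lemma PL_id: "id \<in> PL" "(\<lambda>x. x) \<in> PL"
  using PL_translation[of 0] by (auto simp: id_def)

lemma PL_comp: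
  assumes f: "f \<in> PL" and g: "g \<in> PL" shows "f \<circ> g \<in> PL"
proof (rule PL_I)
  show "strict_mono (f \<circ> g)" using f g by (auto simp: strict_mono_def PL_less_iff)
  show "surj (f \<circ> g)" using f g by (intro comp_surj PL_surj)
  show "(f \<circ> g) x \<in> Z_tau \<longleftrightarrow> x \<in> Z_tau" for x using f g by (simp add: PL_Z_tau)
  fix x
  obtain k l :: int and e where g1: "e > 0" "\<And>y. x \<le> y \<Longrightarrow> y \<le> x + e \<Longrightarrow> g y = g x + tau powi k * (y - x)"
    "\<And>y. x - e \<le> y \<Longrightarrow> y \<le> x \<Longrightarrow> g y = g x + tau powi l * (y - x)" "x \<in> Z_tau \<or> k = l"
    using PL_germ[OF g] by metis
  obtain k' l' :: int and e' where f1: "e' > 0" "\<And>y. g x \<le> y \<Longrightarrow> y \<le> g x + e' \<Longrightarrow> f y = f (g x) + tau powi k' * (y - g x)"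
    "\<And>y. g x - e' \<le> y \<Longrightarrow> y \<le> g x \<Longrightarrow> f y = f (g x) + tau powi l' * (y - g x)" "g x \<in> Z_tau \<or> k' = l'"
    using PL_germ[OF f] by metis
  \<comment> \<open>Small enough that \<open>g\<close> maps each side of the
    \<open>d\<close>-neighbourhood of \<open>x\<close> into the \<open>e'\<close>-neighbourhood of
    \<open>g x\<close>.\<close>
  define d where "d = min e (min (e' / tau powi k) (e' / tau powi l))"
  have pk: "tau powi k > 0" "tau powi l > 0" by (rule tau_powi_pos)+
  have d: "d > 0" using g1(1) f1(1) pk by (auto simp: d_def)
  have "d \<le> e' / tau powi k" "d \<le> e' / tau powi l" by (auto simp: d_def)
  then have dk: "tau powi k * d \<le> e'" "tau powi l * d \<le> e'" using pk by (auto simp: field_simps)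
  have de: "d \<le> e" by (simp add: d_def)
  show "\<exists>k l :: int. \<exists>e>0. (\<forall>y\<in>{x..x+e}. (f \<circ> g) y = (f \<circ> g) x + tau powi k * (y - x)) \<and>
        (\<forall>y\<in>{x-e..x}. (f \<circ> g) y = (f \<circ> g) x + tau powi l * (y - x)) \<and> (x \<in> Z_tau \<or> k = l)"
  proof (rule germI[of d _ _ "k' + k" "l' + l"])
    fix y assume y: "y \<in> {x..x + d}"
    then have gy: "g y = g x + tau powi k * (y - x)" using de by (intro g1(2)) auto
    have "tau powi k * (y - x) \<le> tau powi k * d" using y pk by (intro mult_left_mono) auto
    moreover have "tau powi k * (y - x) \<ge> 0" using y pk by auto
    ultimately have "f (g y) = f (g x) + tau powi k' * (g y - g x)" using gy dk by (intro f1) auto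
    then show "(f \<circ> g) y = (f \<circ> g) x + tau powi (k' + k) * (y - x)"
      by (simp add: gy tau_powi_add)
  next
    fix y assume y: "y \<in> {x - d..x}"
    then have gy: "g y = g x + tau powi l * (y - x)" using de by (intro g1(3)) auto
    have "tau powi l * (x - y) \<le> tau powi l * d" using y pk by (intro mult_left_mono) auto
    moreover have "tau powi l * (x - y) \<ge> 0" using y pk by auto
    ultimately have "f (g y) = f (g x) + tau powi l' * (g y - g x)" using gy dk
      by (intro f1) (auto simp: algebra_simps)
    then show "(f \<circ> g) y = (f \<circ> g) x + tau powi (l' + l) * (y - x)"
      by (simp add: gy tau_powi_add)
  next
    show "d > 0" by fact
    show "x \<in> Z_tau \<or> k' + k = l' + l" using f1(4) g1(4) PL_Z_tau[OF g] by auto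
  qed
qed

lemma PL_inv_simps:
  assumes "f \<in> PL" shows "f (inv_into UNIV f x) = x" "inv_into UNIV f (f x) = x"
  using PL_bij[OF assms] by (auto simp: bij_def surj_f_inv_f)

lemma PL_inv:
  assumes f: "f \<in> PL" shows "inv_into UNIV f \<in> PL"
proof (rule PL_I)
  let ?g = "inv_into UNIV f"
  note [simp] = PL_inv_simps[OF f]
  show "strict_mono ?g"
    unfolding strict_mono_def by (metis PL_less_iff[OF f] PL_inv_simps(1)[OF f])
  show "surj ?g" by (rule surjI[of _ f]) simp
  show "?g x \<in> Z_tau \<longleftrightarrow> x \<in> Z_tau" for x using PL_Z_tau[OF f, of "?g x"] by simp
  fix x
  obtain k l :: int and e where g1: "e > 0" "\<And>y. ?g x \<le> y \<Longrightarrow> y \<le> ?g x + e \<Longrightarrow> f y = f (?g x) + tau powi k * (y - ?g x)"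
    "\<And>y. ?g x - e \<le> y \<Longrightarrow> y \<le> ?g x \<Longrightarrow> f y = f (?g x) + tau powi l * (y - ?g x)" "?g x \<in> Z_tau \<or> k = l"
    using PL_germ[OF f] by metis
  have pk: "tau powi k > 0" "tau powi l > 0" by (rule tau_powi_pos)+
  define d where "d = min (tau powi k * e) (tau powi l * e)"
  have d: "d > 0" "d \<le> tau powi k * e" "d \<le> tau powi l * e" using g1(1) pk by (auto simp: d_def)
  show "\<exists>k l :: int. \<exists>e>0. (\<forall>y\<in>{x..x+e}. ?g y = ?g x + tau powi k * (y - x)) \<and>
        (\<forall>y\<in>{x-e..x}. ?g y = ?g x + tau powi l * (y - x)) \<and> (x \<in> Z_tau \<or> k = l)"
  proof (rule germI[of d _ _ "- k" "- l"])
    fix y assume y: "y \<in> {x..x + d}"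
    have "f (?g x + tau powi (- k) * (y - x)) = f (?g x) + tau powi k * (?g x + tau powi (- k) * (y - x) - ?g x)"
      using y pk d by (intro g1) (auto simp: power_int_minus field_simps)
    also have "\<dots> = y" using pk by (simp add: power_int_minus flip: mult.assoc)
    finally show "?g y = ?g x + tau powi (- k) * (y - x)" by (metis PL_inv_simps(2)[OF f])
  next
    fix y assume y: "y \<in> {x - d..x}"
    have "f (?g x + tau powi (- l) * (y - x)) = f (?g x) + tau powi l * (?g x + tau powi (- l) * (y - x) - ?g x)"
      using y pk d by (intro g1) (auto simp: power_int_minus field_simps)
    also have "\<dots> = y" using pk by (simp add: power_int_minus flip: mult.assoc)
    finally show "?g y = ?g x + tau powi (- l) * (y - x)" by (metis PL_inv_simps(2)[OF f])
  next
    show "d > 0" by fact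
    show "x \<in> Z_tau \<or> - k = - l" using g1(4) PL_Z_tau[OF f, of "?g x"] by auto
  qed
qed

section \<open>Gluing, and transitivity on finite sets of points\<close>

definition glue :: "real \<Rightarrow> (real \<Rightarrow> real) \<Rightarrow> (real \<Rightarrow> real) \<Rightarrow> real \<Rightarrow> real" where
  "glue v f g x = (if x \<le> v then f x else g x)"

lemma glue_le [simp]: "x \<le> v \<Longrightarrow> glue v f g x = f x"
  by (simp add: glue_def)

lemma glue_ge: "f v = g v \<Longrightarrow> v \<le> x \<Longrightarrow> glue v f g x = g x"
  by (auto simp: glue_def)

text \<open>The joint may become a breakpoint, which \<open>v \<in> Z_tau\<close> permits.\<close>

lemma PL_glue:
  assumes f: "f \<in> PL" and g: "g \<in> PL" and v: "v \<in> Z_tau" and fg: "f v = g v"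
  shows "glue v f g \<in> PL"
proof (rule PL_I)
  let ?h = "glue v f g"
  show "strict_mono ?h"
  proof (rule strict_monoI)
    fix x y :: real assume "x < y"
    then show "?h x < ?h y"
    proof (cases "x \<le> v \<and> v < y")
      case True
      then have "f x \<le> f v" "g v < g y" using PL_le_iff[OF f] PL_less_iff[OF g] by blast+
      then show ?thesis using True fg unfolding glue_def by simp
    next
      case False
      then show ?thesis using \<open>x < y\<close> PL_less_iff[OF f] PL_less_iff[OF g] by (auto simp: glue_def)
    qed
  qed
  show "surj ?h" unfolding surj_def
  proof
    fix y
    obtain x x' where xx: "y = f x" "y = g x'" using PL_surj[OF f] PL_surj[OF g] by (metis surj_def)
    show "\<exists>x. y = ?h x"
    proof (cases "y \<le> f v")
      case True
      then have "x \<le> v" using xx PL_le_iff[OF f] by auto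
      then show ?thesis using xx by (intro exI[of _ x]) (simp add: glue_def)
    next
      case False
      then have "x' > v" using xx PL_less_iff[OF g, of v x'] fg by simp
      then show ?thesis using xx by (intro exI[of _ x']) (simp add: glue_def)
    qed
  qed
  show "?h x \<in> Z_tau \<longleftrightarrow> x \<in> Z_tau" for x using PL_Z_tau[OF f] PL_Z_tau[OF g] by (simp add: glue_def)
  fix x
  obtain k l :: int and e where f1: "e > 0" "\<And>y. x \<le> y \<Longrightarrow> y \<le> x + e \<Longrightarrow> f y = f x + tau powi k * (y - x)"
    "\<And>y. x - e \<le> y \<Longrightarrow> y \<le> x \<Longrightarrow> f y = f x + tau powi l * (y - x)" "x \<in> Z_tau \<or> k = l"
    using PL_germ[OF f] by metis
  obtain k' l' :: int and e' where g1: "e' > 0" "\<And>y. x \<le> y \<Longrightarrow> y \<le> x + e' \<Longrightarrow> g y = g x + tau powi k' * (y - x)"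
    "\<And>y. x - e' \<le> y \<Longrightarrow> y \<le> x \<Longrightarrow> g y = g x + tau powi l' * (y - x)" "x \<in> Z_tau \<or> k' = l'"
    using PL_germ[OF g] by metis
  consider "x < v" | "x = v" | "x > v" by linarith
  then show "\<exists>k l :: int. \<exists>e>0. (\<forall>y\<in>{x..x+e}. ?h y = ?h x + tau powi k * (y - x)) \<and>
        (\<forall>y\<in>{x-e..x}. ?h y = ?h x + tau powi l * (y - x)) \<and> (x \<in> Z_tau \<or> k = l)"
  proof cases
    case 1
    define d where "d = min e (v - x)"
    have d: "d > 0" "d \<le> e" "x + d \<le> v" using 1 f1(1) by (auto simp: d_def)
    show ?thesis
    proof (rule germI[of d _ _ k l])
      fix y assume "y \<in> {x..x+d}"
      then have "f y = f x + tau powi k * (y - x)" "y \<le> v" using d by (auto intro!: f1(2))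
      then show "?h y = ?h x + tau powi k * (y - x)" using 1 by (simp add: glue_def)
    next
      fix y assume "y \<in> {x-d..x}"
      then have "f y = f x + tau powi l * (y - x)" "y \<le> v" using d 1 by (auto intro!: f1(3))
      then show "?h y = ?h x + tau powi l * (y - x)" using 1 by (simp add: glue_def)
    qed (use d f1(4) in auto)
  next
    case 2
    define d where "d = min e e'"
    have d: "d > 0" "d \<le> e" "d \<le> e'" using f1(1) g1(1) by (auto simp: d_def)
    show ?thesis
    proof (rule germI[of d _ _ k' l])
      fix y assume y: "y \<in> {x..x+d}"
      then have "g y = g x + tau powi k' * (y - x)" using d by (intro g1(2)) auto
      moreover have "?h y = g y" "?h x = g x" using fg y 2 by (auto intro: glue_ge)
      ultimately show "?h y = ?h x + tau powi k' * (y - x)" by (simp only:)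
    next
      fix y assume y: "y \<in> {x-d..x}"
      then have "f y = f x + tau powi l * (y - x)" using d by (intro f1(3)) auto
      moreover have "?h y = f y" "?h x = f x" using fg y 2 by auto
      ultimately show "?h y = ?h x + tau powi l * (y - x)" by (simp only:)
    qed (use d v 2 in auto)
  next
    case 3
    define d where "d = min e' ((x - v) / 2)"
    have d: "d > 0" "d \<le> e'" using 3 g1(1) by (auto simp: d_def)
    have "d \<le> (x - v) / 2" unfolding d_def by (rule min.cobounded2)
    then have d': "x - d > v" using 3 by (simp add: field_simps)
    show ?thesis
    proof (rule germI[of d _ _ k' l'])
      fix y assume y: "y \<in> {x..x+d}"
      then have "g y = g x + tau powi k' * (y - x)" using d by (intro g1(2)) auto
      moreover have "?h y = g y" "?h x = g x" using fg y 3 by (auto intro: glue_ge)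
      ultimately show "?h y = ?h x + tau powi k' * (y - x)" by (simp only:)
    next
      fix y assume y: "y \<in> {x-d..x}"
      then have "g y = g x + tau powi l' * (y - x)" using d by (intro g1(3)) auto
      moreover have "?h y = g y" "?h x = g x" using fg y 3 d' by (auto intro: glue_ge)
      ultimately show "?h y = ?h x + tau powi l' * (y - x)" by (simp only:)
    qed (use d g1(4) in auto)
  qed
qed

text \<open>Two-point transitivity: lengths that can be mapped onto each other form an additive
  equivalence relation for which \<open>1 \<sim> \<tau>\<close>, and \<open>1 = \<tau> + \<tau>\<^sup>2\<close> gives \<open>1 + 1 \<sim> 1\<close>.\<close>

definition same_length :: "real \<Rightarrow> real \<Rightarrow> bool" where
  "same_length a b \<longleftrightarrow> (\<exists>f\<in>PL. f 0 = 0 \<and> f a = b)"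

lemma same_length_refl: "same_length a a"
  using PL_id(2) by (auto simp: same_length_def)

lemma same_length_sym: "same_length a b \<Longrightarrow> same_length b a"
  unfolding same_length_def by (metis PL_inv PL_inv_simps(2))

lemma same_length_trans: "same_length a b \<Longrightarrow> same_length b c \<Longrightarrow> same_length a c"
  unfolding same_length_def
proof (elim bexE conjE)
  fix f g assume *: "f \<in> PL" "g \<in> PL" "f 0 = 0" "f a = b" "g 0 = 0" "g b = c"
  show "\<exists>f\<in>PL. f 0 = 0 \<and> f a = c"
    by (rule bexI[OF _ PL_comp[OF *(2,1)]]) (simp add: *)
qed

lemma same_length_scale: "same_length a (tau powi k * a)"
  unfolding same_length_def using PL_affine[of 0 k] by (intro bexI[of _ "\<lambda>x. tau powi k * x + 0"]) auto

text \<open>Concatenation: a shifted copy of \<open>g\<close> continues \<open>f\<close> behind the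
  joint \<open>a\<close>; positivity of the lengths puts \<open>0\<close> and \<open>a + c\<close>
  on the proper sides of it.\<close>

lemma same_length_add:
  assumes "same_length a b" "same_length c d" "a \<in> Z_tau" "a > 0" "c > 0"
  shows "same_length (a + c) (b + d)"
proof -
  obtain f g where fg: "f \<in> PL" "f 0 = 0" "f a = b" "g \<in> PL" "g 0 = 0" "g c = d"
    using assms by (auto simp: same_length_def)
  define g' where "g' = (\<lambda>x. x + b) \<circ> (g \<circ> (\<lambda>x. x + (- a)))"
  have "b \<in> Z_tau" using fg assms PL_Z_tau by blast
  then have "g' \<in> PL" unfolding g'_def using fg assms by (intro PL_comp PL_translation) auto
  moreover have "g' a = b" "g' (a + c) = b + d" using fg by (auto simp: g'_def)
  ultimately show ?thesis unfolding same_length_def using fg assms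
    by (intro bexI[of _ "glue a f g'"]) (auto intro!: PL_glue simp: glue_def)
qed

lemma same_length_nat: "n > 0 \<Longrightarrow> a \<in> Z_tau \<Longrightarrow> a > 0 \<Longrightarrow> same_length (real n * a) a"
proof (induction n)
  case (Suc n)
  have two: "same_length (a + a) a"
  proof -
    have "same_length (a + a) (tau powi 1 * a + tau powi 2 * a)"
      using Suc.prems by (intro same_length_add same_length_scale) auto
    moreover have "tau powi 1 * a + tau powi 2 * a = (tau + tau * tau) * a"
      by (simp add: power2_eq_square distrib_right)
    moreover have "\<dots> = a" by (simp add: tau_sq)
    ultimately show ?thesis by simp
  qed
  show ?case
  proof (cases "n = 0")
    case False
    then have "same_length (real n * a) a" using Suc by auto
    then have "same_length (real n * a + a) (a + a)"
      using False Suc.prems by (intro same_length_add same_length_refl) (auto simp: Z_tau_of_int[of "int n", simplified])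
    then show ?thesis using two same_length_trans by (auto simp: algebra_simps)
  qed (simp add: same_length_refl)
qed simp

text \<open>Only positive lengths can be concatenated, which is why a decomposition with both
  coefficients positive is required. Collapsing the multiples leaves
  \<open>tau ^ n + tau ^ Suc n\<close>, a power of \<open>tau\<close> again.\<close>

lemma same_length_1:
  assumes "x \<in> Z_tau" "x > 0" shows "same_length x 1"
proof -
  obtain m m' n :: nat where x: "x = real m * tau ^ n + real m' * tau ^ Suc n" "m > 0" "m' > 0"
    using Z_tau_pos_decomp[OF assms] by metis
  have [simp]: "real m \<in> Z_tau" using Z_tau_of_int[of "int m"] by simp
  have p: "tau ^ n > 0" "tau ^ Suc n > 0" using tau_pos by auto
  have "same_length x (tau ^ n + tau ^ Suc n)"
    unfolding x(1) using x p by (intro same_length_add same_length_nat) (auto intro!: Z_tau_mult Z_tau_power)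
  moreover have "tau ^ n + tau ^ Suc n = tau powi (int n - 1) * 1"
  proof -
    have "tau powi (int n - 1) * 1 = tau ^ n * inverse tau"
      using tau_pos by (simp add: power_int_diff divide_inverse)
    then show ?thesis by (simp add: inverse_tau algebra_simps)
  qed
  ultimately show ?thesis using same_length_trans same_length_sym same_length_scale by metis
qed

lemma PL_two_points:
  assumes "x0 \<in> Z_tau" "x1 \<in> Z_tau" "y0 \<in> Z_tau" "y1 \<in> Z_tau" "x0 < x1" "y0 < y1"
  obtains f where "f \<in> PL" "f x0 = y0" "f x1 = y1"
proof -
  have "same_length (x1 - x0) (y1 - y0)"
    using assms by (intro same_length_trans[OF same_length_1 same_length_sym[OF same_length_1]]) auto
  then obtain f where f: "f \<in> PL" "f 0 = 0" "f (x1 - x0) = y1 - y0" by (auto simp: same_length_def)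
  show ?thesis
    using f assms by (intro that[of "(\<lambda>x. x + y0) \<circ> (f \<circ> (\<lambda>x. x + (- x0)))"] PL_comp PL_translation) auto
qed

text \<open>Two-point transitivity supplies the leftmost piece; it is glued at the second node to
  the map that the induction gives for the tail.\<close>

lemma PL_interpolate_ex:
  assumes "length xs = length ys" "sorted_wrt (<) xs" "sorted_wrt (<) ys" "set xs \<subseteq> Z_tau" "set ys \<subseteq> Z_tau"
  shows "\<exists>f\<in>PL. map f xs = ys"
  using assms
proof (induction xs ys rule: list_induct2)
  case (Cons x xs y ys)
  then obtain f where f: "f \<in> PL" "map f xs = ys" by auto
  show ?case
  proof (cases xs)
    case Nil
    then show ?thesis using Cons f by (intro bexI[of _ "\<lambda>t. t + (y - x)"] PL_translation) auto
  next
    case (Cons x' xs')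
    then obtain y' ys' where ys: "ys = y' # ys'" using f by auto
    have "x \<in> Z_tau" "x' \<in> Z_tau" "y \<in> Z_tau" "y' \<in> Z_tau" "x < x'" "y < y'"
      using Cons Cons.prems ys by auto
    then obtain g where g: "g \<in> PL" "g x = y" "g x' = y'"
      by (rule PL_two_points)
    have eq: "g x' = f x'" using Cons ys f g by simp
    then have "glue x' g f z = f z" if "z \<in> set xs" for z
      using Cons Cons.prems that eq by (cases "z = x'") (auto simp: glue_def)
    moreover have "glue x' g f x = y" using \<open>x < x'\<close> g by simp
    moreover have "map (glue x' g f) xs = map f xs"
      by (rule map_cong) (use calculation in auto)
    ultimately have m: "map (glue x' g f) (x # xs) = y # ys"
      using f(2) by simp
    moreover have "glue x' g f \<in> PL"
      using Cons.prems Cons f(1) g(1) eq by (intro PL_glue) auto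
    ultimately show ?thesis by (intro bexI[of "\<lambda>h. map h (x # xs) = y # ys", OF m])
  qed
qed (simp, blast intro: PL_id)

lemma PL_continuous: "f \<in> PL \<Longrightarrow> continuous_on UNIV f"
  by (rule continuous_onI_mono) (auto simp: PL_surj PL_le_iff)

section \<open>The total lift as a group of piecewise linear maps\<close>

text \<open>The derivative is locally constant, hence constant on a connected interval; subtracting
  the linear part then leaves a function of zero derivative.\<close>

lemma affine_without_breakpoints:
  assumes "{a<..<b} \<inter> breakpoints f = {}"
  obtains c d where "\<And>x. a < x \<Longrightarrow> x < b \<Longrightarrow> f x = c * x + d"
proof -
  have loc: "\<exists>c d. \<forall>\<^sub>F y in nhds x. f y = c * y + d" if x: "x \<in> {a<..<b}" for x
    using assms x by (auto simp: breakpoints_def)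
  have der: "(f has_field_derivative c) (at x)" if "\<forall>\<^sub>F y in nhds x. f y = c * y + d" for x c d
  proof -
    have "((\<lambda>y. c * y + d) has_field_derivative c) (at x)" by (auto intro!: derivative_eq_intros)
    moreover have "((\<lambda>y. c * y + d) has_field_derivative c) (at x) \<longleftrightarrow> (f has_field_derivative c) (at x)"
      using that by (intro DERIV_cong_ev) (auto elim: eventually_mono)
    ultimately show ?thesis by blast
  qed
  have "(deriv f has_field_derivative 0) (at x within {a<..<b})" if x: "x \<in> {a<..<b}" for x
  proof -
    obtain c d where "\<forall>\<^sub>F y in nhds x. f y = c * y + d" using loc[OF x] by blast
    then have "\<forall>\<^sub>F y in nhds x. \<forall>\<^sub>F z in nhds y. f z = c * z + d" by (simp add: eventually_eventually)
    then have "\<forall>\<^sub>F y in nhds x. deriv f y = c"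
      by (rule eventually_mono) (auto dest: der DERIV_imp_deriv)
    then have "(deriv f has_field_derivative 0) (at x) \<longleftrightarrow> ((\<lambda>_. c) has_field_derivative 0) (at x)"
      by (intro DERIV_cong_ev) auto
    then have "(deriv f has_field_derivative 0) (at x)" by simp
    then show ?thesis by (rule has_field_derivative_at_within)
  qed
  then obtain c where c: "\<And>x. x \<in> {a<..<b} \<Longrightarrow> deriv f x = c"
    using has_field_derivative_zero_constant[of "{a<..<b}" "deriv f"] by (auto simp: convex_real_interval)
  have "((\<lambda>x. f x - c * x) has_field_derivative 0) (at x within {a<..<b})" if x: "x \<in> {a<..<b}" for x
  proof -
    obtain c' d where "\<forall>\<^sub>F y in nhds x. f y = c' * y + d" using loc[OF x] by blast
    then have "(f has_field_derivative c') (at x)" by (rule der)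
    then have "(f has_field_derivative c) (at x)" using c[OF x] DERIV_imp_deriv by blast
    then have "((\<lambda>x. f x - c * x) has_field_derivative 0) (at x)" by (auto intro!: derivative_eq_intros)
    then show ?thesis by (rule has_field_derivative_at_within)
  qed
  then obtain d where "\<And>x. x \<in> {a<..<b} \<Longrightarrow> f x - c * x = d"
    using has_field_derivative_zero_constant[of "{a<..<b}" "\<lambda>x. f x - c * x"] by (auto simp: convex_real_interval)
  then have "f x = c * x + d" if "a < x" "x < b" for x using that by (fastforce simp: algebra_simps)
  then show ?thesis by (rule that)
qed

lemma not_breakpoint:
  assumes "x \<in> {a<..<b}" "\<And>y. y \<in> {a<..<b} \<Longrightarrow> f y = c * y + d"
  shows "x \<notin> breakpoints f"
proof -
  have "\<forall>\<^sub>F y in nhds x. f y = c * y + d"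
    by (rule eventually_nhds_in_open[of "{a<..<b}", THEN eventually_mono]) (use assms in auto)
  then show ?thesis by (auto simp: breakpoints_def)
qed

lemma PL_breakpoints_Z_tau:
  assumes f: "f \<in> PL" and x: "x \<in> breakpoints f" shows "x \<in> Z_tau"
proof (rule ccontr)
  assume "x \<notin> Z_tau"
  then obtain k :: int and e where e: "e > 0" "\<And>y. x \<le> y \<Longrightarrow> y \<le> x + e \<Longrightarrow> f y = f x + tau powi k * (y - x)"
    "\<And>y. x - e \<le> y \<Longrightarrow> y \<le> x \<Longrightarrow> f y = f x + tau powi k * (y - x)"
    using PL_germ[OF f, of x] by metis
  have "x \<notin> breakpoints f"
  proof (rule not_breakpoint[of x "x - e" "x + e" f "tau powi k" "f x - tau powi k * x"])
    fix y assume "y \<in> {x - e<..<x + e}"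
    then have "f y = f x + tau powi k * (y - x)" using e(2)[of y] e(3)[of y] by (cases "x \<le> y") auto
    then show "f y = tau powi k * y + (f x - tau powi k * x)" by (simp only: algebra_simps)
  qed (use e(1) in auto)
  then show False using x by blast
qed

text \<open>Bisection: both one-sided germs at \<open>x\<close> are affine, so a short interval
  around \<open>x\<close> contains no breakpoint other than possibly \<open>x\<close>.\<close>

lemma PL_finite_breakpoints:
  assumes f: "f \<in> PL" shows "finite (breakpoints f \<inter> {a..b})"
proof (cases "a \<le> b")
  case True
  then show ?thesis
  proof (induction rule: Bolzano)
    case (trans a b c)
    then have "breakpoints f \<inter> {a..c} = (breakpoints f \<inter> {a..b}) \<union> (breakpoints f \<inter> {b..c})" by auto
    then show ?case using trans by simp
  next
    case (local x)
    obtain k l :: int and e where e: "e > 0" "\<And>y. x \<le> y \<Longrightarrow> y \<le> x + e \<Longrightarrow> f y = f x + tau powi k * (y - x)"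
      "\<And>y. x - e \<le> y \<Longrightarrow> y \<le> x \<Longrightarrow> f y = f x + tau powi l * (y - x)"
      using PL_germ[OF f, of x] by metis
    have 1: "z \<notin> breakpoints f" if "z \<in> {x<..<x+e}" for z
    proof (rule not_breakpoint[OF that, of f "tau powi k" "f x - tau powi k * x"])
      fix y assume "y \<in> {x<..<x + e}"
      then have "f y = f x + tau powi k * (y - x)" by (intro e) auto
      then show "f y = tau powi k * y + (f x - tau powi k * x)" by (simp only: algebra_simps)
    qed
    have 2: "z \<notin> breakpoints f" if "z \<in> {x-e<..<x}" for z
    proof (rule not_breakpoint[OF that, of f "tau powi l" "f x - tau powi l * x"])
      fix y assume "y \<in> {x-e<..<x}"
      then have "f y = f x + tau powi l * (y - x)" by (intro e) auto
      then show "f y = tau powi l * y + (f x - tau powi l * x)" by (simp only: algebra_simps)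
    qed
    show ?case
    proof (intro exI[of _ e] conjI allI impI)
      fix a b assume ab: "a \<le> x \<and> x \<le> b \<and> b - a < e"
      have "breakpoints f \<inter> {a..b} \<subseteq> {x}"
      proof
        fix z assume z: "z \<in> breakpoints f \<inter> {a..b}"
        then have "z \<notin> {x<..<x+e}" "z \<notin> {x-e<..<x}" using 1 2 by blast+
        then show "z \<in> {x}" using z ab by auto
      qed
      then show "finite (breakpoints f \<inter> {a..b})" by (rule finite_subset) simp
    qed (rule e)
  qed
qed simp

section \<open>Periodic maps and the circle maps they induce\<close>

definition PLZ :: "(real \<Rightarrow> real) set" where
  "PLZ = {f \<in> PL. \<forall>x. f (x + 1) = f x + 1}"

lemma PLZ_PL: "f \<in> PLZ \<Longrightarrow> f \<in> PL"
  by (simp add: PLZ_def)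

lemma PLZ_add_nat: "f \<in> PLZ \<Longrightarrow> f (x + real n) = f x + real n"
proof (induction n)
  case (Suc n)
  have "f (x + real n + 1) = f (x + real n) + 1" using Suc.prems unfolding PLZ_def by blast
  then show ?case using Suc by (simp add: algebra_simps)
qed simp

lemma PLZ_add_int: assumes "f \<in> PLZ" shows "f (x + of_int n) = f x + of_int n"
proof (cases "n \<ge> 0")
  case True
  then show ?thesis using PLZ_add_nat[OF assms, of x "nat n"] by simp
next
  case False
  then show ?thesis using PLZ_add_nat[OF assms, of "x + of_int n" "nat (- n)"] by simp
qed

lemma PLZ_comp: "f \<in> PLZ \<Longrightarrow> g \<in> PLZ \<Longrightarrow> f \<circ> g \<in> PLZ"
  by (auto simp: PLZ_def intro: PL_comp)

lemma PLZ_inv: assumes f: "f \<in> PLZ" shows "inv_into UNIV f \<in> PLZ"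
proof -
  note inv = PL_inv_simps[OF PLZ_PL[OF f]]
  have "inv_into UNIV f (x + 1) = inv_into UNIV f x + 1" for x
  proof -
    have "f (inv_into UNIV f x + 1) = x + 1" using f inv(1)[of x] by (simp add: PLZ_def)
    then show ?thesis by (metis inv(2))
  qed
  then show ?thesis using PL_inv[OF PLZ_PL[OF f]] by (simp add: PLZ_def)
qed

lemma PLZ_translation: "b \<in> Z_tau \<Longrightarrow> (\<lambda>x. x + b) \<in> PLZ"
  by (auto simp: PLZ_def PL_translation)

lemma circle_of_eq_iff: "circle_of x = circle_of y \<longleftrightarrow> x - y \<in> \<int>"
  by (rule circle.abs_eq_iff)

lemma circle_of_add_int [simp]: "circle_of (x + of_int n) = circle_of x"
  by (simp add: circle_of_eq_iff)

lemma circle_of_surj: "\<exists>x. c = circle_of x"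
  by (metis Quotient_abs_rep Quotient_circle)

lemma circle_of_Z_tau_iff: "circle_of x \<in> circle_of ` Z_tau \<longleftrightarrow> x \<in> Z_tau"
proof
  assume "circle_of x \<in> circle_of ` Z_tau"
  then obtain y where y: "y \<in> Z_tau" "x - y \<in> \<int>" by (auto simp: circle_of_eq_iff)
  then obtain n where "x - y = of_int n" by (auto elim: Ints_cases)
  then have "x = y + of_int n" by simp
  then show "x \<in> Z_tau" using y by auto
qed auto

definition circle_map :: "(real \<Rightarrow> real) \<Rightarrow> circle \<Rightarrow> circle" where
  "circle_map f c = circle_of (f (rep_circle c))"

lemma circle_map_circle_of:
  assumes "f \<in> PLZ" shows "circle_map f (circle_of x) = circle_of (f x)"
proof -
  have "circle_of (rep_circle (circle_of x)) = circle_of x" by (metis Quotient_abs_rep Quotient_circle)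
  then obtain n where "rep_circle (circle_of x) - x = of_int n" by (auto simp: circle_of_eq_iff elim: Ints_cases)
  then have "rep_circle (circle_of x) = x + of_int n" by simp
  then show ?thesis using PLZ_add_int[OF assms] by (simp add: circle_map_def)
qed

lemma circle_map_continuous:
  assumes "f \<in> PLZ" shows "continuous_on UNIV (circle_map f)"
proof -
  have "open (circle_map f -` U)" if "open U" for U
  proof -
    have "circle_of -` (circle_map f -` U) = f -` (circle_of -` U)"
      using circle_map_circle_of[OF assms] by auto
    moreover have "open (f -` (circle_of -` U))"
      using that PL_continuous[OF PLZ_PL[OF assms]] by (intro open_vimage[of _ f]) (auto simp: open_circle_def)
    ultimately show ?thesis by (simp add: open_circle_def)
  qed
  then show ?thesis by (simp add: continuous_on_open_vimage)
qed

lemma circle_map_inverse: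
  assumes "f \<in> PLZ" "g \<in> PLZ" "\<And>x. f (g x) = x" shows "circle_map f (circle_map g c) = c"
  using circle_of_surj[of c] assms by (auto simp: circle_map_circle_of)

lemma circle_map_T_tau:
  assumes f: "f \<in> PLZ" shows "circle_map f \<in> T_tau"
  unfolding T_tau_def
proof (intro CollectI conjI exI)
  let ?g = "inv_into UNIV f"
  note inv = PL_inv_simps[OF PLZ_PL[OF f]]
  show "homeomorphism UNIV UNIV (circle_map f) (circle_map ?g)"
    using f PLZ_inv[OF f] inv by (intro homeomorphismI circle_map_continuous circle_map_inverse) auto
  show "is_lift f (circle_map f)"
    using circle_map_circle_of[OF f] PL_continuous[OF PLZ_PL[OF f]] by (simp add: is_lift_def)
  show "strict_mono f" using PLZ_PL[OF f] PL_strict_mono by blast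
  \<comment> \<open>Breakpoints are invariant under integer translations, so modulo the integers all
    of them come from the compact interval \<open>{0..1}\<close>.\<close>
  have "circle_of ` breakpoints f \<subseteq> circle_of ` (breakpoints f \<inter> {0..1})"
  proof
    fix c assume "c \<in> circle_of ` breakpoints f"
    then obtain x where x: "c = circle_of x" "x \<in> breakpoints f" by auto
    define n where "n = \<lfloor>x\<rfloor>"
    have "x - of_int n \<in> breakpoints f"
    proof (rule ccontr)
      assume "\<not> ?thesis"
      then obtain a b where "\<forall>\<^sub>F y in nhds (x - of_int n). f y = a * y + b" by (auto simp: breakpoints_def)
      moreover have "filterlim (\<lambda>y. y - of_int n) (nhds (x - of_int n)) (nhds x)"
        by (intro tendsto_intros filterlim_ident)
      ultimately have "\<forall>\<^sub>F y in nhds x. f (y - of_int n) = a * (y - of_int n) + b"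
        by (auto simp: filterlim_iff)
      then have "\<forall>\<^sub>F y in nhds x. f y = a * y + (b - a * of_int n + of_int n)"
      proof (rule eventually_mono)
        fix y assume "f (y - of_int n) = a * (y - of_int n) + b"
        moreover have "f y = f (y - of_int n) + of_int n"
          using PLZ_add_int[OF f, of "y - of_int n" n] by simp
        ultimately show "f y = a * y + (b - a * of_int n + of_int n)" by (simp add: algebra_simps)
      qed
      then show False using x unfolding breakpoints_def by blast
    qed
    moreover have "x - of_int n \<in> {0..1}" unfolding n_def by (simp add: floor_le_iff) linarith
    moreover have "c = circle_of (x - of_int n)" using x by (simp add: circle_of_eq_iff)
    ultimately show "c \<in> circle_of ` (breakpoints f \<inter> {0..1})" by blast
  qed
  then show "finite (circle_of ` breakpoints f)"
    using PL_finite_breakpoints[OF PLZ_PL[OF f]] by (meson finite_imageI finite_subset)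
  show "circle_of ` breakpoints f \<subseteq> circle_of ` Z_tau"
    using PL_breakpoints_Z_tau[OF PLZ_PL[OF f]] by blast
  show "\<forall>x d. (f has_real_derivative d) (at x) \<longrightarrow> (\<exists>k :: int. d = tau powi k)"
  proof (intro allI impI)
    fix x d assume d: "(f has_real_derivative d) (at x)"
    obtain k :: int and e where e: "e > 0" "\<And>y. x \<le> y \<Longrightarrow> y \<le> x + e \<Longrightarrow> f y = f x + tau powi k * (y - x)"
      using PL_germ[OF PLZ_PL[OF f], of x] by metis
    \<comment> \<open>Following the right germ suffices: wherever \<open>f\<close> is
      differentiable, its derivative is the right-hand slope.\<close>
    have "((\<lambda>y. f x + tau powi k * (y - x)) has_real_derivative tau powi k) (at x within {x..})"
      by (auto intro!: derivative_eq_intros)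
    then have "(f has_real_derivative tau powi k) (at x within {x..})"
    proof (rule has_field_derivative_transform_within[OF _ e(1)])
      fix y assume "y \<in> {x..}" "dist y x < e"
      then show "f x + tau powi k * (y - x) = f y" by (intro e(2)[symmetric]) (auto simp: dist_real_def)
    qed simp
    then have "(f has_real_derivative tau powi k) (at_right x)"
      by (rule DERIV_subset) auto
    moreover have "(f has_real_derivative d) (at_right x)"
      using d by (rule has_field_derivative_at_within)
    ultimately have "d = tau powi k"
      by (intro has_field_derivative_unique[of f _ x "{x<..}"]) auto
    then show "\<exists>k :: int. d = tau powi k" by blast
  qed
  have "circle_map f ` circle_of ` Z_tau = circle_of ` f ` Z_tau"
    using circle_map_circle_of[OF f] by (auto simp: image_image)
  also have "f ` Z_tau = Z_tau"
  proof
    show "f ` Z_tau \<subseteq> Z_tau" using PL_Z_tau[OF PLZ_PL[OF f]] by blast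
    show "Z_tau \<subseteq> f ` Z_tau"
    proof
      fix x assume "x \<in> Z_tau"
      then have "?g x \<in> Z_tau" using PL_Z_tau[OF PLZ_PL[OF f], of "?g x"] inv(1) by simp
      then show "x \<in> f ` Z_tau" using inv(1) by (metis imageI)
    qed
  qed
  finally show "circle_map f ` circle_of ` Z_tau = circle_of ` Z_tau" .
qed

text \<open>Membership in \<open>T_tau\<close> speaks of some increasing lift \<open>f0\<close>, not
  of \<open>f\<close>. The difference of two lifts is continuous and integer valued, hence constant,
  and this transfers monotonicity, breakpoints and slopes to \<open>f\<close>.\<close>

lemma lift_T_tau_PLZ:
  assumes hom: "homeomorphism UNIV UNIV f h" and per: "\<forall>x. \<forall>n :: int. f (x + of_int n) = f x + of_int n"
    and g: "g \<in> T_tau" and lift: "is_lift f g"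
  shows "f \<in> PLZ"
proof -
  obtain f0 where f0: "is_lift f0 g" "strict_mono f0" "finite (circle_of ` breakpoints f0)"
     "circle_of ` breakpoints f0 \<subseteq> circle_of ` Z_tau"
     "\<And>x d. (f0 has_real_derivative d) (at x) \<Longrightarrow> \<exists>k :: int. d = tau powi k"
    and gZ: "g ` (circle_of ` Z_tau) = circle_of ` Z_tau" and ginj: "inj g"
    using g unfolding T_tau_def homeomorphism_def inj_def by (smt (verit) UNIV_I mem_Collect_eq)
  have "(\<lambda>x. f x - f0 x) constant_on UNIV"
  proof (rule continuous_discrete_range_constant)
    show "continuous_on UNIV (\<lambda>x. f x - f0 x)" using lift f0(1) by (auto simp: is_lift_def intro!: continuous_intros)
    fix x
    have int: "f y - f0 y \<in> \<int>" for y
      using lift f0(1) by (metis is_lift_def circle_of_eq_iff)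
    show "\<exists>e>0. \<forall>y. y \<in> UNIV \<and> f y - f0 y \<noteq> f x - f0 x \<longrightarrow> e \<le> norm (f y - f0 y - (f x - f0 x))"
    proof (intro exI[of _ 1] conjI allI impI)
      fix y assume "y \<in> UNIV \<and> f y - f0 y \<noteq> f x - f0 x"
      then have "f y - f0 y - (f x - f0 x) \<in> \<int>" "f y - f0 y - (f x - f0 x) \<noteq> 0" using int by (auto intro: Ints_diff)
      then show "1 \<le> norm (f y - f0 y - (f x - f0 x))" unfolding real_norm_def by (rule Ints_nonzero_abs_ge1)
    qed simp
  qed simp
  then obtain m where m: "\<And>x. f x = f0 x + m" unfolding constant_on_def by (metis UNIV_I diff_eq_eq add.commute)
  have mono: "strict_mono f" using f0(2) m by (auto simp: strict_mono_def)
  have br: "breakpoints f = breakpoints f0"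
  proof -
    have "(\<exists>a b. \<forall>\<^sub>F y in nhds x. f y = a * y + b) \<longleftrightarrow> (\<exists>a b. \<forall>\<^sub>F y in nhds x. f0 y = a * y + b)" for x
    proof safe
      fix a b assume "\<forall>\<^sub>F y in nhds x. f y = a * y + b"
      then have "\<forall>\<^sub>F y in nhds x. f0 y = a * y + (b - m)" by (rule eventually_mono) (simp add: m)
      then show "\<exists>a b. \<forall>\<^sub>F y in nhds x. f0 y = a * y + b" by blast
    next
      fix a b assume "\<forall>\<^sub>F y in nhds x. f0 y = a * y + b"
      then have "\<forall>\<^sub>F y in nhds x. f y = a * y + (b + m)" by (rule eventually_mono) (simp add: m)
      then show "\<exists>a b. \<forall>\<^sub>F y in nhds x. f y = a * y + b" by blast
    qed
    then show ?thesis by (simp add: breakpoints_def)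
  qed
  have der: "\<exists>k :: int. d = tau powi k" if "(f has_real_derivative d) (at x)" for x d
  proof -
    have "((\<lambda>y. f y - m) has_real_derivative d) (at x)" using that by (auto intro!: derivative_eq_intros)
    then show ?thesis using f0(5) m by simp
  qed
  have brZ: "x \<in> Z_tau" if "x \<in> breakpoints f" for x
    using that f0(4) br circle_of_Z_tau_iff by blast
  have fin: "finite (breakpoints f \<inter> {a..b})" for a b
  proof (rule finite_subset)
    show "breakpoints f \<inter> {a..b} \<subseteq> (\<Union>c\<in>circle_of ` breakpoints f0. {x \<in> {a..b}. circle_of x = c})"
      using br by auto
    have "finite {x \<in> {a..b}. circle_of x = circle_of z}" for z
    proof (rule finite_subset)
      show "{x \<in> {a..b}. circle_of x = circle_of z} \<subseteq> (\<lambda>n. z + of_int n) ` {\<lfloor>a - z\<rfloor>..\<lceil>b - z\<rceil>}"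
      proof
        fix x assume "x \<in> {x \<in> {a..b}. circle_of x = circle_of z}"
        then obtain n where n: "x - z = of_int n" "a \<le> x" "x \<le> b" by (auto simp: circle_of_eq_iff elim: Ints_cases)
        then have "n \<in> {\<lfloor>a - z\<rfloor>..\<lceil>b - z\<rceil>}" by (auto simp: floor_le_iff le_ceiling_iff)
        then show "x \<in> (\<lambda>n. z + of_int n) ` {\<lfloor>a - z\<rfloor>..\<lceil>b - z\<rceil>}" using n by (intro image_eqI[of _ _ n]) auto
      qed
    qed simp
    then show "finite (\<Union>c\<in>circle_of ` breakpoints f0. {x \<in> {a..b}. circle_of x = c})"
      using f0(3) by blast
  qed
  have slope: "\<exists>k :: int. c = tau powi k" if "a < b" "\<And>y. a < y \<Longrightarrow> y < b \<Longrightarrow> f y = c * y + d" for a b c d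
  proof -
    define z where "z = (a + b) / 2"
    have z: "a < z" "z < b" using that by (auto simp: z_def)
    have "((\<lambda>y. c * y + d) has_real_derivative c) (at z)" by (auto intro!: derivative_eq_intros)
    moreover have "\<forall>\<^sub>F y in nhds z. c * y + d = f y"
      by (rule eventually_nhds_in_open[of "{a<..<b}", THEN eventually_mono]) (use z that in auto)
    ultimately have "(f has_real_derivative c) (at z)" by (simp only: DERIV_cong_ev[OF refl _ refl])
    then show ?thesis using der by blast
  qed
  have cont: "continuous_on UNIV f" using lift by (simp add: is_lift_def)
  \<comment> \<open>An affine formula on an open interval extends to its end points by continuity;
    this yields the closed one-sided germs that \<open>PL\<close> asks for.\<close>
  have ext: "f x = c * x + d" if "a < b" "\<And>y. a < y \<Longrightarrow> y < b \<Longrightarrow> f y = c * y + d" "x \<in> {a..b}" for a b c d x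
  proof -
    have "continuous_on (closure {a<..<b}) (\<lambda>y. f y - (c * y + d))"
      by (intro continuous_intros continuous_on_subset[OF cont]) auto
    then have "f x - (c * x + d) = 0"
      by (rule continuous_constant_on_closure) (use that in auto)
    then show ?thesis by simp
  qed
  have "f \<in> PL"
  proof (rule PL_I)
    show "strict_mono f" by fact
    show "surj f" using hom by (auto simp: homeomorphism_def)
    show "f x \<in> Z_tau \<longleftrightarrow> x \<in> Z_tau" for x
    proof -
      have "circle_of (f x) = g (circle_of x)" using lift by (simp add: is_lift_def)
      moreover have "g (circle_of x) \<in> g ` circle_of ` Z_tau \<longleftrightarrow> circle_of x \<in> circle_of ` Z_tau"
        using ginj by (auto simp: inj_image_mem_iff)
      ultimately show ?thesis using gZ circle_of_Z_tau_iff by metis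
    qed
    fix x
    let ?S = "(breakpoints f \<inter> {x-1..x+1}) - {x}"
    have "finite ?S" using fin by blast
    then have "open (- ?S)" using finite_imp_closed open_Compl by blast
    moreover have "x \<in> - ?S" by blast
    ultimately obtain e0 where e0: "e0 > 0" "ball x e0 \<subseteq> - ?S" using open_contains_ball by blast
    define e where "e = min e0 1"
    have e: "e > 0" using e0 by (simp add: e_def)
    have nobr: "y \<notin> breakpoints f" if "y \<noteq> x" "x - e < y" "y < x + e" for y
    proof -
      have "y \<in> ball x e0" "y \<in> {x-1..x+1}" using that by (auto simp: e_def dist_real_def)
      then show ?thesis using e0 that by blast
    qed
    have "{x<..<x+e} \<inter> breakpoints f = {}" "{x-e<..<x} \<inter> breakpoints f = {}"
      using nobr e by force+
    note aff = this[THEN affine_without_breakpoints]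
    obtain c d where cd: "\<And>y. x < y \<Longrightarrow> y < x + e \<Longrightarrow> f y = c * y + d"
      using aff(1) by metis
    obtain c' d' where cd': "\<And>y. x - e < y \<Longrightarrow> y < x \<Longrightarrow> f y = c' * y + d'"
      using aff(2) by metis
    obtain k l :: int where kl: "c = tau powi k" "c' = tau powi l"
    proof -
      have "\<exists>k :: int. c = tau powi k" by (rule slope[of x "x + e" c d]) (use e cd in simp_all)
      moreover have "\<exists>k :: int. c' = tau powi k" by (rule slope[of "x - e" x c' d']) (use e cd' in simp_all)
      ultimately show ?thesis using that by blast
    qed
    have R: "f y = c * y + d" if "y \<in> {x..x+e}" for y using ext[of x "x+e" c d y] cd e that by auto
    have L: "f y = c' * y + d'" if "y \<in> {x-e..x}" for y using ext[of "x-e" x c' d' y] cd' e that by auto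
    show "\<exists>k l :: int. \<exists>e>0. (\<forall>y\<in>{x..x+e}. f y = f x + tau powi k * (y - x)) \<and>
        (\<forall>y\<in>{x-e..x}. f y = f x + tau powi l * (y - x)) \<and> (x \<in> Z_tau \<or> k = l)"
    proof (rule germI[of e _ _ k l])
      fix y assume "y \<in> {x..x+e}"
      then have "f y = c * y + d" "f x = c * x + d" using R e by auto
      then show "f y = f x + tau powi k * (y - x)" unfolding kl by (simp only: algebra_simps)
    next
      fix y assume "y \<in> {x-e..x}"
      then have "f y = c' * y + d'" "f x = c' * x + d'" using L e by auto
      then show "f y = f x + tau powi l * (y - x)" unfolding kl by (simp only: algebra_simps)
    next
      \<comment> \<open>If \<open>x\<close> is not a breakpoint, one affine piece crosses it and
        both one-sided slopes coincide; distinct powers of \<open>tau\<close> differ, so the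
        exponents coincide too.\<close>
      show "x \<in> Z_tau \<or> k = l"
      proof (cases "x \<in> breakpoints f")
        case False
        then have "{x - e<..<x + e} \<inter> breakpoints f = {}" using nobr by (metis disjoint_iff greaterThanLessThan_iff)
        then obtain p q where pq: "\<And>y. x - e < y \<Longrightarrow> y < x + e \<Longrightarrow> f y = p * y + q"
          using affine_without_breakpoints by blast
        have eq: "c1 = p" if "a < b" "x - e \<le> a" "b \<le> x + e" "\<And>y. a < y \<Longrightarrow> y < b \<Longrightarrow> f y = c1 * y + d1" for a b c1 d1
        proof -
          define y1 where "y1 = (2 * a + b) / 3"
          define y2 where "y2 = (a + 2 * b) / 3"
          have y: "a < y1" "y1 < b" "a < y2" "y2 < b" "y1 \<noteq> y2" using that by (auto simp: y1_def y2_def)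
          then have "c1 * y1 + d1 = p * y1 + q" "c1 * y2 + d1 = p * y2 + q"
            using that pq[of y1] pq[of y2] by (metis less_eq_real_def less_trans)+
          then have "(c1 - p) * (y1 - y2) = 0" by (simp add: algebra_simps)
          then show ?thesis using y by simp
        qed
        have "c = p" by (rule eq[of x "x + e" c d]) (use cd e in simp_all)
        moreover have "c' = p" by (rule eq[of "x - e" x c' d']) (use cd' e in simp_all)
        ultimately
        have "tau powi k = tau powi l" using kl by simp
        then have "tau powi (k - l) = 1" by (simp add: power_int_diff)
        then show ?thesis using tau_powi_eq_1_iff by simp
      qed (use brZ in blast)
    qed (use e in auto)
  qed
  moreover have "f (x + 1) = f x + 1" for x using per[rule_format, of x 1] by simp
  ultimately show ?thesis by (simp add: PLZ_def)
qed

section \<open>Groups of maps under composition\<close>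

definition trans_group :: "('a \<Rightarrow> 'a) set \<Rightarrow> ('a \<Rightarrow> 'a) monoid" where
  "trans_group S = \<lparr>carrier = S, mult = (\<circ>), one = id\<rparr>"

lemma trans_group_simps [simp]:
  "carrier (trans_group S) = S" "f \<otimes>\<^bsub>trans_group S\<^esub> g = f \<circ> g" "\<one>\<^bsub>trans_group S\<^esub> = id"
  by (auto simp: trans_group_def)

lemma group_trans_group:
  assumes "id \<in> S" "\<And>f g. f \<in> S \<Longrightarrow> g \<in> S \<Longrightarrow> f \<circ> g \<in> S"
    "\<And>f. f \<in> S \<Longrightarrow> inj f" "\<And>f. f \<in> S \<Longrightarrow> inv_into UNIV f \<in> S"
  shows "group (trans_group S)"
proof (rule groupI)
  fix f assume "f \<in> carrier (trans_group S)"
  then show "\<exists>g\<in>carrier (trans_group S). g \<otimes>\<^bsub>trans_group S\<^esub> f = \<one>\<^bsub>trans_group S\<^esub>"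
    using assms by (intro bexI[of _ "inv_into UNIV f"]) auto
qed (use assms in \<open>auto simp: o_assoc\<close>)

lemma inv_trans_group:
  assumes "group (trans_group S)" "f \<in> S" "inj f" "inv_into UNIV f \<in> S"
  shows "inv\<^bsub>trans_group S\<^esub> f = inv_into UNIV f"
  by (rule group.inv_equality[OF assms(1)]) (use assms in auto)

text \<open>Trades the circle for piecewise linear maps of the line, on which the whole remaining
  argument takes place.\<close>

lemma total_lift_T_tau: "total_lift T_tau = trans_group PLZ"
proof -
  have "(\<exists>h. homeomorphism UNIV UNIV f h) \<and> (\<forall>x. \<forall>n :: int. f (x + of_int n) = f x + of_int n) \<and>
      (\<exists>g\<in>T_tau. is_lift f g) \<longleftrightarrow> f \<in> PLZ" for f
  proof
    assume "f \<in> PLZ"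
    moreover from this have "homeomorphism UNIV UNIV f (inv_into UNIV f)"
      using PLZ_inv[of f] PL_inv_simps[of f] by (intro homeomorphismI PL_continuous) (auto intro: PLZ_PL)
    moreover have "is_lift f (circle_map f)" if "f \<in> PLZ"
      using circle_map_circle_of[OF that] PL_continuous[OF PLZ_PL[OF that]] by (simp add: is_lift_def)
    ultimately show "(\<exists>h. homeomorphism UNIV UNIV f h) \<and> (\<forall>x. \<forall>n :: int. f (x + of_int n) = f x + of_int n) \<and>
      (\<exists>g\<in>T_tau. is_lift f g)" using PLZ_add_int circle_map_T_tau by blast
  qed (use lift_T_tau_PLZ in blast)
  then show ?thesis by (simp add: total_lift_def trans_group_def)
qed

lemma PL_group: "group (trans_group PL)"
  by (rule group_trans_group) (auto intro: PL_id PL_comp PL_inv simp: inj_def PL_eq_iff)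

lemma PLZ_group: "group (trans_group PLZ)"
  by (rule group_trans_group)
    (auto intro: PLZ_comp PLZ_inv simp: inj_def PL_eq_iff PLZ_PL, simp add: PLZ_def PL_id)

lemma inv_PL: "f \<in> PL \<Longrightarrow> inv\<^bsub>trans_group PL\<^esub> f = inv_into UNIV f"
  by (rule inv_trans_group) (auto intro: PL_group PL_inv simp: inj_def PL_eq_iff)

lemma inv_PLZ: "f \<in> PLZ \<Longrightarrow> inv\<^bsub>trans_group PLZ\<^esub> f = inv_into UNIV f"
  by (rule inv_trans_group) (auto intro: PLZ_group PLZ_inv simp: inj_def PL_eq_iff PLZ_PL)

section \<open>Products of commutators\<close>

text \<open>\<open>cl G g\<close> is the least \<open>n\<close> with \<open>g\<close> in this set;
  recording \<open>n\<close> lets bounds on the length add up along products.\<close>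

definition comm_prods :: "('a, 'b) monoid_scheme \<Rightarrow> nat \<Rightarrow> 'a set" where
  "comm_prods G n = {foldr (mult G) cs (one G) | cs. length cs = n \<and> set cs \<subseteq> derived_set G (carrier G)}"

lemma comm_prods_0: "\<one>\<^bsub>G\<^esub> \<in> comm_prods G 0"
  unfolding comm_prods_def by (auto intro!: exI[of _ "[]"])

lemma cl_le: "g \<in> comm_prods G n \<Longrightarrow> cl G g \<le> n"
  unfolding cl_def comm_prods_def by (intro Least_le) auto

text \<open>A representation must be exhibited first: without one the \<open>LEAST\<close> in
  \<open>cl\<close> is an unspecified number.\<close>

lemma comm_prods_cl:
  assumes "g \<in> comm_prods G n" shows "g \<in> comm_prods G (cl G g)"
proof -
  let ?P = "\<lambda>n. \<exists>cs. length cs = n \<and> set cs \<subseteq> derived_set G (carrier G) \<and> g = foldr (mult G) cs (one G)"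
  have "?P n" using assms unfolding comm_prods_def by blast
  then have "?P (cl G g)" unfolding cl_def by (rule LeastI)
  then show ?thesis unfolding comm_prods_def by blast
qed

context group
begin

text \<open>Together with \<open>m_assoc\<close> these rules let the simplifier freely reduce
  right-nested words.\<close>

lemma cancel_left [simp]:
  assumes "x \<in> carrier G" "y \<in> carrier G"
  shows "inv x \<otimes> (x \<otimes> y) = y" "x \<otimes> (inv x \<otimes> y) = y"
  using assms by (simp_all flip: m_assoc)

abbreviation commutator :: "'a \<Rightarrow> 'a \<Rightarrow> 'a" where
  "commutator x y \<equiv> x \<otimes> y \<otimes> inv x \<otimes> inv y"

lemma derived_set_comm_prods: "derived_set G (carrier G) \<subseteq> comm_prods G 1"
proof
  fix c assume c: "c \<in> derived_set G (carrier G)"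
  then have "c \<in> carrier G" by auto
  then have "c = foldr (mult G) [c] (one G)" by simp
  then show "c \<in> comm_prods G 1" unfolding comm_prods_def using c
    by (intro CollectI exI[of _ "[c]"]) simp
qed

lemma commutator_comm_prods: "x \<in> carrier G \<Longrightarrow> y \<in> carrier G \<Longrightarrow> commutator x y \<in> comm_prods G 1"
  using derived_set_comm_prods by blast

lemma comm_prods_carrier: "comm_prods G n \<subseteq> carrier G"
proof -
  have "foldr (mult G) cs \<one> \<in> carrier G" if "set cs \<subseteq> derived_set G (carrier G)" for cs
    using that by (induction cs) auto
  then show ?thesis unfolding comm_prods_def by blast
qed

lemma comm_prods_mult:
  assumes "x \<in> comm_prods G m" "y \<in> comm_prods G n" shows "x \<otimes> y \<in> comm_prods G (m + n)"
proof -
  obtain cs ds where cs: "x = foldr (mult G) cs \<one>" "length cs = m" "set cs \<subseteq> derived_set G (carrier G)"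
    and ds: "y = foldr (mult G) ds \<one>" "length ds = n" "set ds \<subseteq> derived_set G (carrier G)"
    using assms unfolding comm_prods_def by blast
  have y: "y \<in> carrier G" using assms comm_prods_carrier by blast
  have foldr_closed: "foldr (mult G) cs \<one> \<in> carrier G" if "set cs \<subseteq> carrier G" for cs
    using that by (induction cs) auto
  have "foldr (mult G) cs \<one> \<otimes> y = foldr (mult G) cs y" if "set cs \<subseteq> carrier G" for cs
    using that by (induction cs) (auto simp: y m_assoc foldr_closed)
  moreover have "set cs \<subseteq> carrier G" using cs(3) by auto
  ultimately have "x \<otimes> y = foldr (mult G) (cs @ ds) \<one>" using cs ds by simp
  then show ?thesis unfolding comm_prods_def using cs ds
    by (intro CollectI exI[of _ "cs @ ds"]) auto
qed

lemma comm_prods_derived: "comm_prods G n \<subseteq> derived G (carrier G)"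
proof -
  have "foldr (mult G) cs \<one> \<in> derived G (carrier G)" if "set cs \<subseteq> derived_set G (carrier G)" for cs
    using that unfolding derived_def
  proof (induction cs)
    case (Cons c cs)
    then have "c \<in> derived_set G (carrier G)" by simp
    then show ?case using Cons by (simp only: foldr.simps o_apply) (intro generate.eng[OF generate.incl]; simp)
  qed (simp add: generate.one)
  then show ?thesis unfolding comm_prods_def by blast
qed

lemma commutator_conj:
  assumes "x \<in> carrier G" "y \<in> carrier G" "g \<in> carrier G"
  shows "g \<otimes> commutator x y \<otimes> inv g = commutator (g \<otimes> x \<otimes> inv g) (g \<otimes> y \<otimes> inv g)"
  using assms by (simp add: m_assoc inv_mult_group)

lemma inv_commutator:
  assumes "x \<in> carrier G" "y \<in> carrier G" shows "inv (commutator x y) = commutator y x"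
  using assms by (simp add: m_assoc inv_mult_group)

text \<open>The inverse of a commutator is a commutator, so the generated subgroup consists of plain
  products and can be built up by one commutator at a time on the left.\<close>

lemma derived_induct:
  assumes H: "subgroup H G" and x: "x \<in> derived G H" and one: "R \<one>"
    and step: "\<And>a b y. a \<in> H \<Longrightarrow> b \<in> H \<Longrightarrow> y \<in> derived G H \<Longrightarrow> R y \<Longrightarrow> R (commutator a b \<otimes> y)"
  shows "R x"
proof -
  have Hc: "H \<subseteq> carrier G" using H by (rule subgroup.subset)
  have Dc: "derived G H \<subseteq> carrier G" using derived_in_carrier[OF Hc] .
  \<comment> \<open>Strengthened to left multiplication by \<open>x\<close>, so that the case of a
    product of two generated elements merely applies both hypotheses in turn.\<close>
  have "\<forall>y\<in>derived G H. R y \<longrightarrow> R (x \<otimes> y)"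
    using x unfolding derived_def
  proof (induction x rule: generate.induct)
    case one
    then show ?case using Dc unfolding derived_def by auto
  next
    case (incl h)
    then show ?case using step unfolding derived_def by auto
  next
    case (inv h)
    then obtain a b where "a \<in> H" "b \<in> H" "h = commutator a b" by auto
    moreover from this have "inv h = commutator b a" using Hc inv_commutator by blast
    ultimately show ?case using step unfolding derived_def by auto
  next
    case (eng h1 h2)
    show ?case
    proof (intro ballI impI)
      fix y assume y: "y \<in> generate G (derived_set G H)" "R y"
      have "R (h2 \<otimes> y)" using eng.IH(2) y by blast
      moreover have "h2 \<otimes> y \<in> generate G (derived_set G H)" by (rule generate.eng[OF eng.hyps(2) y(1)])
      ultimately have "R (h1 \<otimes> (h2 \<otimes> y))" using eng.IH(1) by blast
      moreover have "h1 \<in> carrier G" "h2 \<in> carrier G" "y \<in> carrier G"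
        using eng.hyps y Dc unfolding derived_def by auto
      ultimately show "R (h1 \<otimes> h2 \<otimes> y)" by (simp add: m_assoc)
    qed
  qed
  moreover have "\<one> \<in> derived G H" unfolding derived_def by (rule generate.one)
  ultimately show ?thesis using one x Dc by force
qed

lemma derived_comm_prods:
  assumes "x \<in> derived G (carrier G)" shows "\<exists>n. x \<in> comm_prods G n"
proof (rule derived_induct[OF subgroup_self assms])
  show "\<exists>n. \<one> \<in> comm_prods G n" using comm_prods_0 by blast
  fix a b y assume "a \<in> carrier G" "b \<in> carrier G" "\<exists>n. y \<in> comm_prods G n"
  then show "\<exists>n. commutator a b \<otimes> y \<in> comm_prods G n"
    using comm_prods_mult[OF commutator_comm_prods] by blast
qed

text \<open>\<open>(xy)\<^sup>2 = x\<^sup>2 [x\<^sup>-\<^sup>1, y] y\<^sup>2\<close>\<close>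
lemma comm_prods_square_mult:
  assumes "x \<in> carrier G" "y \<in> carrier G" "x \<otimes> x \<in> comm_prods G m" "y \<otimes> y \<in> comm_prods G n"
  shows "(x \<otimes> y) \<otimes> (x \<otimes> y) \<in> comm_prods G (m + n + 1)"
proof -
  have "(x \<otimes> y) \<otimes> (x \<otimes> y) = x \<otimes> x \<otimes> (commutator (inv x) y \<otimes> (y \<otimes> y))"
    using assms(1,2) by (simp add: m_assoc)
  also have "\<dots> \<in> comm_prods G (m + (1 + n))"
    using assms by (intro comm_prods_mult commutator_comm_prods) auto
  finally show ?thesis by (simp add: ac_simps)
qed

text \<open>If \<open>t\<close> moves the support of \<open>P\<close> off itself indefinitely, the factors \<open>c\<^sub>i\<close> of a product of
  commutators can be spread over disjoint translates of the support, where they combine into one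
  commutator, at the cost of a second commutator with \<open>t\<close>.\<close>
lemma derived_displaced:
  assumes P: "subgroup P G" and Q: "subgroup Q G" and t: "t \<in> carrier G"
    and PQ: "\<And>p q. p \<in> P \<Longrightarrow> q \<in> Q \<Longrightarrow> p \<otimes> q = q \<otimes> p"
    and tP: "\<And>p. p \<in> P \<Longrightarrow> t \<otimes> p \<otimes> inv t \<in> Q" and tQ: "\<And>q. q \<in> Q \<Longrightarrow> t \<otimes> q \<otimes> inv t \<in> Q"
    and x: "x \<in> derived G P"
  shows "x \<in> comm_prods G 2"
proof -
  have Pc: "p \<in> carrier G" if "p \<in> P" for p using P that by (rule subgroup.mem_carrier)
  have Qc: "q \<in> carrier G" if "q \<in> Q" for q using Q that by (rule subgroup.mem_carrier)
  have DP: "derived G P \<subseteq> P" using P by (intro derived_incl) auto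
  note [simp] = t
  \<comment> \<open>\<open>A\<close> and \<open>B\<close> collect the entries of all commutators
    used so far, spread over translates by powers of \<open>t\<close>; \<open>F\<close> is the
    telescoping correction that makes up the difference to \<open>x\<close>.\<close>
  have "\<exists>F A B. F \<in> carrier G \<and> A \<in> carrier G \<and> B \<in> carrier G \<and>
      t \<otimes> A \<otimes> inv t \<in> Q \<and> t \<otimes> B \<otimes> inv t \<in> Q \<and>
      x = commutator F t \<otimes> (t \<otimes> commutator A B \<otimes> inv t)" (is "\<exists>F A B. ?R F A B x")
  proof (rule derived_induct[OF P x])
    have "?R \<one> \<one> \<one> \<one>" using subgroup.one_closed[OF Q] by simp
    then show "\<exists>F A B. ?R F A B \<one>" by blast
  next
    fix a b p assume ab: "a \<in> P" "b \<in> P" and p: "p \<in> derived G P" and "\<exists>F A B. ?R F A B p"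
    then obtain F A B where R: "?R F A B p" by blast
    define A' where "A' = t \<otimes> A \<otimes> inv t"
    define B' where "B' = t \<otimes> B \<otimes> inv t"
    define c where "c = commutator a b"
    define d where "d = commutator A' B'"
    have Q': "A' \<in> Q" "B' \<in> Q" using R by (auto simp: A'_def B'_def)
    then have dQ: "d \<in> Q" using subgroup.m_closed[OF Q] subgroup.m_inv_closed[OF Q] by (simp add: d_def)
    have cP: "c \<in> P" using subgroup.m_closed[OF P] subgroup.m_inv_closed[OF P] ab by (simp add: c_def)
    have pP: "p \<in> P" using p DP by blast
    have [simp]: "a \<in> carrier G" "b \<in> carrier G" "c \<in> carrier G" "d \<in> carrier G" "p \<in> carrier G"
      "F \<in> carrier G" "A \<in> carrier G" "B \<in> carrier G" "A' \<in> carrier G" "B' \<in> carrier G"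
      using Pc Qc ab cP dQ pP Q' R by auto
    have d: "t \<otimes> commutator A B \<otimes> inv t = d" unfolding d_def A'_def B'_def by (rule commutator_conj) auto
    have p_eq: "p = F \<otimes> t \<otimes> inv F \<otimes> inv t \<otimes> d" using R d by simp
    \<comment> \<open>Because \<open>p\<close> commutes with \<open>d\<close>, this equals
      \<open>c \<otimes> d \<otimes> F\<close>. Then \<open>commutator F' t\<close> telescopes and
      leaves exactly \<open>c \<otimes> p\<close> after the second factor is multiplied on.\<close>
    define F' where "F' = c \<otimes> p \<otimes> (t \<otimes> F \<otimes> inv t)"
    have [simp]: "F' \<in> carrier G" by (simp add: F'_def)
    \<comment> \<open>The pair \<open>a, b\<close> lives in \<open>P\<close> and the pair
      \<open>A', B'\<close> in \<open>Q\<close>; these subgroups commute elementwise, so two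
      commutators merge into one.\<close>
    have ab': "commutator (a \<otimes> A') (b \<otimes> B') = c \<otimes> d"
    proof -
      have "A' \<otimes> (b \<otimes> y) = b \<otimes> (A' \<otimes> y)" if "y \<in> carrier G" for y
        using PQ[OF ab(2) Q'(1)] that by (simp flip: m_assoc)
      moreover have "B' \<otimes> (inv A' \<otimes> (inv a \<otimes> y)) = inv a \<otimes> (B' \<otimes> (inv A' \<otimes> y))" if "y \<in> carrier G" for y
      proof -
        have "inv a \<otimes> (B' \<otimes> inv A') = B' \<otimes> inv A' \<otimes> inv a"
          using subgroup.m_closed[OF Q Q'(2) subgroup.m_inv_closed[OF Q Q'(1)]]
            subgroup.m_inv_closed[OF P ab(1)] by (intro PQ) auto
        then have "inv a \<otimes> (B' \<otimes> inv A') \<otimes> y = B' \<otimes> inv A' \<otimes> inv a \<otimes> y" by simp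
        then show ?thesis using that by (simp add: m_assoc)
      qed
      moreover have "A' \<otimes> (inv a \<otimes> y) = inv a \<otimes> (A' \<otimes> y)" if "y \<in> carrier G" for y
        using PQ[OF subgroup.m_inv_closed[OF P ab(1)] Q'(1)] that by (simp flip: m_assoc)
      moreover have "B' \<otimes> (inv A' \<otimes> (inv B' \<otimes> inv b)) = inv b \<otimes> (B' \<otimes> (inv A' \<otimes> inv B'))"
      proof -
        have "inv b \<otimes> (B' \<otimes> inv A' \<otimes> inv B') = B' \<otimes> inv A' \<otimes> inv B' \<otimes> inv b"
          using subgroup.m_closed[OF Q] subgroup.m_inv_closed[OF Q] Q'
            subgroup.m_inv_closed[OF P ab(2)] by (intro PQ) auto
        then show ?thesis by (simp add: m_assoc)
      qed
      moreover have "A' \<otimes> (inv b \<otimes> y) = inv b \<otimes> (A' \<otimes> y)" if "y \<in> carrier G" for y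
        using PQ[OF subgroup.m_inv_closed[OF P ab(2)] Q'(1)] that by (simp flip: m_assoc)
      ultimately show ?thesis
        unfolding c_def d_def by (simp add: m_assoc inv_mult_group)
    qed
    have "inv F' = (t \<otimes> inv F \<otimes> inv t) \<otimes> (inv p \<otimes> inv c)"
      unfolding F'_def by (simp add: m_assoc inv_mult_group)
    also have "t \<otimes> inv F \<otimes> inv t = inv F \<otimes> (p \<otimes> inv d)"
      unfolding p_eq by (simp add: m_assoc)
    also have "inv F \<otimes> (p \<otimes> inv d) \<otimes> (inv p \<otimes> inv c) = inv F \<otimes> (inv d \<otimes> inv c)"
    proof -
      have "p \<otimes> inv d = inv d \<otimes> p" using PQ[OF pP subgroup.m_inv_closed[OF Q dQ]] .
      then show ?thesis by (simp add: m_assoc)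
    qed
    also have "inv d \<otimes> inv c = inv (c \<otimes> d)" by (simp add: inv_mult_group)
    finally have F'inv: "inv F' = inv F \<otimes> inv (c \<otimes> d)" .
    have "commutator F' t \<otimes> (t \<otimes> (c \<otimes> d) \<otimes> inv t) = F' \<otimes> t \<otimes> (inv F' \<otimes> (c \<otimes> d)) \<otimes> inv t"
      by (simp add: m_assoc)
    also have "inv F' \<otimes> (c \<otimes> d) = inv F" unfolding F'inv by (simp add: m_assoc del: inv_mult_group)
    also have "F' \<otimes> t \<otimes> inv F \<otimes> inv t = c \<otimes> p" unfolding F'_def by (simp add: m_assoc)
    finally have "?R F' (a \<otimes> A') (b \<otimes> B') (c \<otimes> p)"
    proof -
      assume eq: "commutator F' t \<otimes> (t \<otimes> (c \<otimes> d) \<otimes> inv t) = c \<otimes> p"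
      have "t \<otimes> (a \<otimes> A') \<otimes> inv t = (t \<otimes> a \<otimes> inv t) \<otimes> (t \<otimes> A' \<otimes> inv t)"
        "t \<otimes> (b \<otimes> B') \<otimes> inv t = (t \<otimes> b \<otimes> inv t) \<otimes> (t \<otimes> B' \<otimes> inv t)" by (simp_all add: m_assoc)
      then have "t \<otimes> (a \<otimes> A') \<otimes> inv t \<in> Q" "t \<otimes> (b \<otimes> B') \<otimes> inv t \<in> Q"
        using subgroup.m_closed[OF Q] tP[OF ab(1)] tP[OF ab(2)] tQ[OF Q'(1)] tQ[OF Q'(2)] by auto
      then show ?thesis using eq ab' by simp
    qed
    then show "\<exists>F A B. ?R F A B (commutator a b \<otimes> p)" unfolding c_def by blast
  qed
  then obtain F A B where R: "?R F A B x" by blast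
  then have "x = commutator F t \<otimes> commutator (t \<otimes> A \<otimes> inv t) (t \<otimes> B \<otimes> inv t)"
    using commutator_conj[of A B t] by auto
  also have "\<dots> \<in> comm_prods G (1 + 1)"
    using R by (intro comm_prods_mult commutator_comm_prods) auto
  finally show ?thesis by (simp add: numeral_2_eq_2)
qed

end

lemma hom_comm_prods:
  assumes "group_hom G H h" "x \<in> comm_prods G n" shows "h x \<in> comm_prods H n"
proof -
  interpret group_hom G H h by fact
  obtain cs where cs: "x = foldr (mult G) cs \<one>\<^bsub>G\<^esub>" "length cs = n" "set cs \<subseteq> derived_set G (carrier G)"
    using assms(2) unfolding comm_prods_def by blast
  have "h (foldr (mult G) cs \<one>\<^bsub>G\<^esub>) = foldr (mult H) (map h cs) \<one>\<^bsub>H\<^esub> \<and> foldr (mult G) cs \<one>\<^bsub>G\<^esub> \<in> carrier G"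
    if "set cs \<subseteq> carrier G" for cs
    using that by (induction cs) auto
  moreover have "set cs \<subseteq> carrier G" using cs(3) by auto
  ultimately have "h x = foldr (mult H) (map h cs) \<one>\<^bsub>H\<^esub>" using cs by simp
  moreover have "h c \<in> derived_set H (carrier H)" if c: "c \<in> set cs" for c
  proof -
    have "c \<in> derived_set G (carrier G)" using c cs by blast
    then obtain a b where "a \<in> carrier G" "b \<in> carrier G" "c = a \<otimes>\<^bsub>G\<^esub> b \<otimes>\<^bsub>G\<^esub> inv\<^bsub>G\<^esub> a \<otimes>\<^bsub>G\<^esub> inv\<^bsub>G\<^esub> b" by auto
    then have "h a \<in> carrier H" "h b \<in> carrier H" "h c = h a \<otimes>\<^bsub>H\<^esub> h b \<otimes>\<^bsub>H\<^esub> inv\<^bsub>H\<^esub> h a \<otimes>\<^bsub>H\<^esub> inv\<^bsub>H\<^esub> h b"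
      by auto
    then show ?thesis by blast
  qed
  ultimately show ?thesis unfolding comm_prods_def using cs by (intro CollectI exI[of _ "map h cs"]) auto
qed

section \<open>The conjugation relations of affine germs\<close>

text \<open>Abstract form of the computation in a central extension of the affine group
  \<open>\<int>[\<tau>] \<rtimes> \<langle>\<tau>\<rangle>\<close>: \<open>A\<^sub>u\<close> lifts the homothety of ratio \<open>\<tau>\<close> with centre \<open>u\<close>, so \<open>t\<^sub>u\<close> lifts a
  translation. The commutator pairing \<open>\<omega>\<close> of the \<open>t\<^sub>u\<close> is bilinear, alternating and invariant
  under multiplication by \<open>\<tau>\<close>; together with \<open>\<tau>\<^sup>-\<^sup>1 = 1 + \<tau>\<close> this forces \<open>\<omega>\<^sup>2 = 1\<close>.\<close>
lemma (in group) affine_extension: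
  fixes A :: "real \<Rightarrow> 'a"
  defines "t \<equiv> (\<lambda>u. A u \<otimes> inv (A 0))"
  assumes A: "\<And>u. u \<in> Z_tau \<Longrightarrow> A u \<in> carrier G"
    and conj: "\<And>u v. u \<in> Z_tau \<Longrightarrow> v \<in> Z_tau \<Longrightarrow> A v \<otimes> A u \<otimes> inv (A v) = A (tau * u + tau * tau * v)"
    and C: "subgroup C G" and central: "\<And>z g. z \<in> C \<Longrightarrow> g \<in> carrier G \<Longrightarrow> z \<otimes> g = g \<otimes> z"
    and comm: "\<And>u v. u \<in> Z_tau \<Longrightarrow> v \<in> Z_tau \<Longrightarrow> commutator (t u) (t v) \<in> C"
    and g: "g \<in> generate G (A ` Z_tau)"
  shows "\<exists>z u k. z \<in> C \<and> z \<otimes> z = \<one> \<and> u \<in> Z_tau \<and> g = z \<otimes> t u \<otimes> A 0 [^] (k :: int)"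
proof -
  define s where "s = A 0"
  define w where "w = (\<lambda>u v. commutator (t u) (t v))"
  define Z where "Z = {z \<in> C. z \<otimes> z = \<one>}"
  have s [simp]: "s \<in> carrier G" using A by (simp add: s_def)
  have t_eq: "t u = A u \<otimes> inv s" for u by (simp add: t_def s_def)
  have t [simp]: "t u \<in> carrier G" if "u \<in> Z_tau" for u using A that by (simp add: t_eq)
  have t0: "t 0 = \<one>" by (simp add: t_def A)
  have Cc: "z \<in> carrier G" if "z \<in> C" for z using C that by (rule subgroup.mem_carrier)
  have wC: "w u v \<in> C" if "u \<in> Z_tau" "v \<in> Z_tau" for u v using comm that by (simp add: w_def)
  have wc [simp]: "w u v \<in> carrier G" if "u \<in> Z_tau" "v \<in> Z_tau" for u v using wC Cc that by blast
  have tauZ [simp]: "tau * u \<in> Z_tau" "inverse tau * u \<in> Z_tau" if "u \<in> Z_tau" for u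
    using that Z_tau_powi[of "-1"] by auto
  have s_conj: "s \<otimes> A u \<otimes> inv s = A (tau * u)" if "u \<in> Z_tau" for u using conj[of u 0] that by (simp add: s_def)
  have s_t: "s \<otimes> t u \<otimes> inv s = t (tau * u)" if u: "u \<in> Z_tau" for u
    unfolding t_eq s_conj[OF u, symmetric] using A[OF u] by (simp add: m_assoc)
  have s_inv_conj: "inv s \<otimes> A u \<otimes> s = A (inverse tau * u)" if u: "u \<in> Z_tau" for u
  proof -
    have "A u = s \<otimes> A (inverse tau * u) \<otimes> inv s" using s_conj[of "inverse tau * u"] u by (simp flip: mult.assoc)
    moreover have "A (inverse tau * u) \<in> carrier G" using A u by simp
    ultimately show ?thesis by (simp add: m_assoc)
  qed
  \<comment> \<open>\<open>A v\<close> after the inverse of \<open>A 0\<close> models the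
    translation by \<open>(1 - tau) * v\<close>, and \<open>1 - tau = tau * tau\<close>.\<close>
  have t_conj: "t v \<otimes> A u \<otimes> inv (t v) = A (u + tau * tau * v)" if u: "u \<in> Z_tau" and v: "v \<in> Z_tau" for u v
  proof -
    have "t v \<otimes> A u \<otimes> inv (t v) = A v \<otimes> (inv s \<otimes> A u \<otimes> s) \<otimes> inv (A v)"
      using A[OF u] A[OF v] by (simp add: t_eq m_assoc inv_mult_group)
    also have "\<dots> = A (tau * (inverse tau * u) + tau * tau * v)"
      unfolding s_inv_conj[OF u] using u v by (intro conj) auto
    finally show ?thesis by (simp flip: mult.assoc)
  qed
  \<comment> \<open>Conjugating \<open>t u = A u \<otimes> inv s\<close> by \<open>t v\<close>
    shifts both centres, so \<open>t\<close> is additive up to a value of the pairing.\<close>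
  have t_add: "t (u + tau * tau * v) = w v u \<otimes> t u \<otimes> t (tau * tau * v)" if u: "u \<in> Z_tau" and v: "v \<in> Z_tau" for u v
  proof -
    have tv: "tau * tau * v \<in> Z_tau" using v by (simp add: mult.assoc)
    have "t v \<otimes> t u \<otimes> inv (t v) = (t v \<otimes> A u \<otimes> inv (t v)) \<otimes> inv (t v \<otimes> A 0 \<otimes> inv (t v))"
      using u v A[OF u] by (simp add: t_eq[of u] s_def[symmetric] m_assoc inv_mult_group)
    also have "\<dots> = A (u + tau * tau * v) \<otimes> inv (A (tau * tau * v))"
      using t_conj[OF u v] t_conj[OF Z_tau_0 v] by simp
    also have "\<dots> = t (u + tau * tau * v) \<otimes> inv (t (tau * tau * v))"
      using A[OF tv] A[OF Z_tau_add[OF u tv]] by (simp add: t_eq m_assoc inv_mult_group)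
    finally have "t (u + tau * tau * v) = t v \<otimes> t u \<otimes> inv (t v) \<otimes> t (tau * tau * v)"
      using u v tv Z_tau_add[OF u tv] by (simp add: m_assoc)
    then show ?thesis using u v tv by (simp add: w_def m_assoc)
  qed
  have t_add': "t (u + v) = w (inverse tau * (inverse tau * v)) u \<otimes> t u \<otimes> t v" if u: "u \<in> Z_tau" and v: "v \<in> Z_tau" for u v
  proof -
    have "tau * tau * (inverse tau * (inverse tau * v)) = (tau * inverse tau) * (tau * inverse tau) * v"
      by (simp only: ac_simps)
    then have e: "tau * tau * (inverse tau * (inverse tau * v)) = v" by simp
    show ?thesis using t_add[OF u tauZ(2)[OF tauZ(2)[OF v]]] by (simp only: e)
  qed
  \<comment> \<open>The central defect of additivity cancels inside a commutator, so the pairing is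
    additive although \<open>t\<close> need not be.\<close>
  have w_add: "w (u + u') v = w u v \<otimes> w u' v" if u: "u \<in> Z_tau" "u' \<in> Z_tau" and v: "v \<in> Z_tau" for u u' v
  proof -
    define z where "z = w (inverse tau * (inverse tau * u')) u"
    have z: "z \<in> C" "t (u + u') = z \<otimes> t u \<otimes> t u'"
      unfolding z_def using u by (blast intro: wC tauZ) (rule t_add'[OF u])
    have [simp]: "z \<in> carrier G" using Cc z by blast
    have "w (u + u') v = z \<otimes> (t u \<otimes> t u' \<otimes> t v \<otimes> inv (t u') \<otimes> inv (t u)) \<otimes> inv z \<otimes> inv (t v)"
      unfolding w_def z(2) using u v by (simp add: m_assoc inv_mult_group)
    also have "\<dots> = (t u \<otimes> t u' \<otimes> t v \<otimes> inv (t u') \<otimes> inv (t u)) \<otimes> inv (t v)"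
    proof -
      let ?y = "t u \<otimes> t u' \<otimes> t v \<otimes> inv (t u') \<otimes> inv (t u)"
      have y: "?y \<in> carrier G" using u v by simp
      then have "z \<otimes> ?y \<otimes> inv z = ?y \<otimes> z \<otimes> inv z" using central[OF z(1) y] by (simp only:)
      also have "\<dots> = ?y" using y by (simp only: m_assoc[OF y] \<open>z \<in> carrier G\<close> inv_closed r_inv r_one)
      finally show ?thesis by (simp only:)
    qed
    also have "\<dots> = t u \<otimes> w u' v \<otimes> t v \<otimes> inv (t u) \<otimes> inv (t v)"
      unfolding w_def using u v by (simp add: m_assoc)
    also have "t u \<otimes> w u' v = w u' v \<otimes> t u" using u v by (intro central[OF wC, symmetric] t)
    also have "w u' v \<otimes> t u \<otimes> t v \<otimes> inv (t u) \<otimes> inv (t v) = w u' v \<otimes> w u v"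
      unfolding w_def using u v by (simp add: m_assoc)
    also have "\<dots> = w u v \<otimes> w u' v" using u v by (intro central[OF wC] wc)
    finally show ?thesis .
  qed
  have w_swap: "inv (w u v) = w v u" if "u \<in> Z_tau" "v \<in> Z_tau" for u v
    unfolding w_def using that by (simp add: inv_commutator)
  \<comment> \<open>Conjugation by \<open>s\<close> multiplies both arguments by \<open>tau\<close>
    and fixes the value, which is central.\<close>
  have w_tau: "w (tau * u) (tau * v) = w u v" if u: "u \<in> Z_tau" and v: "v \<in> Z_tau" for u v
  proof -
    have "w (tau * u) (tau * v) = s \<otimes> w u v \<otimes> inv s"
      unfolding w_def s_t[OF u, symmetric] s_t[OF v, symmetric] using u v by (simp add: commutator_conj)
    also have "\<dots> = w u v" using central[OF wC[OF u v] s, symmetric] u v by (simp add: m_assoc)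
    finally show ?thesis .
  qed
  \<comment> \<open>Divide both arguments by \<open>tau\<close> and expand the first one with
    \<open>inverse tau = 1 + tau\<close>.\<close>
  have w_half: "w u (tau * v) = w u v \<otimes> w (tau * u) v" if u: "u \<in> Z_tau" and v: "v \<in> Z_tau" for u v
  proof -
    have "w u (tau * v) = w (tau * (inverse tau * u)) (tau * v)" by (simp flip: mult.assoc)
    also have "\<dots> = w (inverse tau * u) v" using u v by (intro w_tau) auto
    also have "inverse tau * u = u + tau * u" by (simp add: inverse_tau distrib_right)
    also have "w (u + tau * u) v = w u v \<otimes> w (tau * u) v" using u v by (intro w_add) auto
    finally show ?thesis .
  qed
  \<comment> \<open>Additively, \<open>w_half\<close> together with antisymmetry gives
    \<open>w (tau * u) v = w u (tau * v) + w u v\<close>. Substituting this back into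
    \<open>w_half\<close> yields \<open>w u (tau * v) = 2 * w u v + w u (tau * v)\<close>.\<close>
  have w_sq: "w u v \<otimes> w u v = \<one>" if u: "u \<in> Z_tau" and v: "v \<in> Z_tau" for u v
  proof -
    have "w (tau * u) v = inv (w v u \<otimes> w (tau * v) u)"
      using w_half[OF v u] w_swap[of v "tau * u"] u v by simp
    also have "\<dots> = w u (tau * v) \<otimes> w u v" using u v w_swap by (simp add: inv_mult_group)
    finally have "w u (tau * v) = w u v \<otimes> (w u (tau * v) \<otimes> w u v)" using w_half[OF u v] by simp
    also have "\<dots> = w u v \<otimes> w u v \<otimes> w u (tau * v)" using central[OF wC[OF u v], of "w u (tau * v)"] u v
      by (simp add: m_assoc)
    finally show ?thesis using u v by (metis r_cancel_one' tauZ(1) wc m_closed)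
  qed
  have wZ: "w u v \<in> Z" if "u \<in> Z_tau" "v \<in> Z_tau" for u v using w_sq wC that by (simp add: Z_def)
  have Z_mult: "z \<otimes> z' \<in> Z" if z: "z \<in> Z" "z' \<in> Z" for z z'
  proof -
    have c: "z \<in> carrier G" "z' \<in> carrier G" using z Cc by (auto simp: Z_def)
    have "z \<otimes> z' \<otimes> (z \<otimes> z') = z \<otimes> (z' \<otimes> z) \<otimes> z'" using c by (simp add: m_assoc)
    also have "z' \<otimes> z = z \<otimes> z'" using z c by (intro central) (auto simp: Z_def)
    also have "z \<otimes> (z \<otimes> z') \<otimes> z' = z \<otimes> z \<otimes> (z' \<otimes> z')" using c by (simp add: m_assoc)
    finally show ?thesis using z subgroup.m_closed[OF C] c by (simp add: Z_def)
  qed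
  have s_pow: "s [^] k \<otimes> t v = t (tau powi k * v) \<otimes> s [^] k" if v: "v \<in> Z_tau" for v and k :: int
    using v
  proof (induction k arbitrary: v rule: int_induct[where k = 0])
    case base
    then show ?case by simp
  next
    case (step1 k)
    have e: "s [^] (k + 1) = s [^] k \<otimes> s" using int_pow_mult[of s k 1] by simp
    have "s \<otimes> t v = t (tau * v) \<otimes> s" using s_t[OF step1(3), symmetric] step1(3) by (simp add: m_assoc)
    then have "s [^] (k + 1) \<otimes> t v = s [^] k \<otimes> t (tau * v) \<otimes> s" unfolding e using step1(3) by (simp add: m_assoc)
    also have "\<dots> = t (tau powi k * (tau * v)) \<otimes> s [^] k \<otimes> s" using step1 by simp
    finally show ?case unfolding e using step1(3) Z_tau_powi_mult_iff[of k "tau * v"]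
      by (simp add: power_int_add mult.assoc m_assoc)
  next
    case (step2 k)
    have e: "s [^] (k - 1) = s [^] k \<otimes> inv s" using int_pow_mult[of s k "-1"] int_pow_neg[of s 1] by simp
    define v' where "v' = inverse tau * v"
    have v': "v' \<in> Z_tau" "tau * v' = v" using step2(3) by (auto simp: v'_def simp flip: mult.assoc)
    have "s \<otimes> t v' = t v \<otimes> s" using s_t[OF v'(1), symmetric] v' step2(3) by (simp add: m_assoc)
    then have "inv s \<otimes> (s \<otimes> t v') \<otimes> inv s = inv s \<otimes> (t v \<otimes> s) \<otimes> inv s" by simp
    then have "inv s \<otimes> t v = t v' \<otimes> inv s" using v' step2(3) by (simp add: m_assoc)
    then have "s [^] (k - 1) \<otimes> t v = s [^] k \<otimes> t v' \<otimes> inv s" unfolding e using step2(3) v' by (simp add: m_assoc)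
    also have "\<dots> = t (tau powi k * v') \<otimes> s [^] k \<otimes> inv s" using step2 v' by simp
    also have "tau powi k * v' = tau powi (k - 1) * v" by (simp add: v'_def power_int_diff divide_inverse mult.assoc)
    finally show ?case unfolding e using step2(3) Z_tau_powi_mult_iff[of "k - 1" v] by (simp add: m_assoc)
  qed
  have oneZ: "\<one> \<in> Z" using subgroup.one_closed[OF C] by (simp add: Z_def)
  have Zc: "z \<in> carrier G" if "z \<in> Z" for z using that Cc by (simp add: Z_def)
  \<comment> \<open>Normal forms of the extension. Every central factor that arises when they are
    multiplied is a value of \<open>w\<close>, so it can be kept in the subset \<open>Z\<close> of
    elements of square one rather than in all of \<open>C\<close>.\<close>
  define W where "W = {z \<otimes> t u \<otimes> s [^] k | z u (k :: int). z \<in> Z \<and> u \<in> Z_tau}"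
  have W_mult: "x \<otimes> y \<in> W" if x: "x \<in> W" and y: "y \<in> W" for x y
  proof -
    obtain z u and k :: int where x: "x = z \<otimes> t u \<otimes> s [^] k" "z \<in> Z" "u \<in> Z_tau" using x by (auto simp: W_def)
    obtain z' v and l :: int where y: "y = z' \<otimes> t v \<otimes> s [^] l" "z' \<in> Z" "v \<in> Z_tau" using y by (auto simp: W_def)
    define v' where "v' = tau powi k * v"
    have v': "v' \<in> Z_tau" using y by (auto simp: v'_def)
    define r where "r = w (inverse tau * (inverse tau * v')) u"
    have r: "r \<in> Z" using v' x by (simp add: r_def wZ)
    have [simp]: "z \<in> carrier G" "z' \<in> carrier G" "r \<in> carrier G" using x y r Zc by auto
    have "t u \<otimes> t v' = r \<otimes> t (u + v')"
    proof -
      have "r \<otimes> t (u + v') = r \<otimes> r \<otimes> (t u \<otimes> t v')" using t_add'[OF x(3) v'] x v' by (simp add: r_def m_assoc)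
      also have "r \<otimes> r = \<one>" using r by (simp add: Z_def)
      finally show ?thesis using x v' by simp
    qed
    have zc: "z' \<otimes> a = a \<otimes> z'" "r \<otimes> a = a \<otimes> r" if "a \<in> carrier G" for a using central y(2) r that by (auto simp: Z_def)
    have "x \<otimes> y = z \<otimes> t u \<otimes> (s [^] k \<otimes> z') \<otimes> t v \<otimes> s [^] l" unfolding x y using x y by (simp add: m_assoc)
    also have "s [^] k \<otimes> z' = z' \<otimes> s [^] k" by (intro zc(1)[symmetric]) simp
    also have "z \<otimes> t u \<otimes> (z' \<otimes> s [^] k) \<otimes> t v \<otimes> s [^] l = z \<otimes> (t u \<otimes> z') \<otimes> (s [^] k \<otimes> t v) \<otimes> s [^] l"
      using x y by (simp add: m_assoc)
    also have "t u \<otimes> z' = z' \<otimes> t u" using x by (intro zc(1)[symmetric]) simp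
    also have "s [^] k \<otimes> t v = t v' \<otimes> s [^] k" using s_pow y by (simp add: v'_def)
    also have "z \<otimes> (z' \<otimes> t u) \<otimes> (t v' \<otimes> s [^] k) \<otimes> s [^] l = z \<otimes> z' \<otimes> (t u \<otimes> t v') \<otimes> (s [^] k \<otimes> s [^] l)"
      using x y v' by (simp add: m_assoc)
    also have "t u \<otimes> t v' = r \<otimes> t (u + v')" by fact
    also have "s [^] k \<otimes> s [^] l = s [^] (k + l)" by (simp add: int_pow_mult)
    also have "z \<otimes> z' \<otimes> (r \<otimes> t (u + v')) \<otimes> s [^] (k + l) = (z \<otimes> z' \<otimes> r) \<otimes> t (u + v') \<otimes> s [^] (k + l)"
      using x v' Z_tau_add[OF x(3) v'] by (simp add: m_assoc)
    finally show ?thesis unfolding W_def using Z_mult x y r v' by blast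
  qed
  have "A v = \<one> \<otimes> t v \<otimes> s [^] (1 :: int)" if "v \<in> Z_tau" for v
    using A[OF that] by (simp add: t_eq m_assoc)
  then have AW: "A v \<in> W" if "v \<in> Z_tau" for v unfolding W_def using oneZ that by blast
  have "inv s = \<one> \<otimes> t 0 \<otimes> s [^] (- 1 :: int)" using int_pow_neg[of s 1] by (simp add: t0)
  then have sW: "inv s \<in> W" unfolding W_def using oneZ Z_tau_0 by blast
  have "g \<in> W" using g
  proof (induction rule: generate.induct)
    case one
    have "\<one> = \<one> \<otimes> t 0 \<otimes> s [^] (0 :: int)" by (simp add: t0)
    then show ?case unfolding W_def using oneZ Z_tau_0 by blast
  next
    case (incl h)
    then show ?case using AW by blast
  next
    case (inv h)
    then obtain v where v: "v \<in> Z_tau" "h = A v" by blast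
    define r where "r = w (inverse tau * (inverse tau * - v)) v"
    have mv: "- v \<in> Z_tau" using v by auto
    have r: "r \<in> Z" unfolding r_def using v mv by (intro wZ tauZ)
    have [simp]: "r \<in> carrier G" using r Zc by blast
    have "r \<otimes> t v \<otimes> t (- v) = \<one>" using t_add'[OF v(1) mv] t0 by (simp add: r_def)
    moreover have "r \<otimes> t v = t v \<otimes> r" using r v by (intro central t) (auto simp: Z_def)
    ultimately have "t v \<otimes> (r \<otimes> t (- v)) = \<one>" using v mv by (simp add: m_assoc)
    then have "inv (t v) = r \<otimes> t (- v)" using v mv by (metis \<open>r \<in> carrier G\<close> inv_comm inv_equality m_closed t)
    then have "inv (t v) = r \<otimes> t (- v) \<otimes> s [^] (0 :: int)" using mv by simp
    then have "inv (t v) \<in> W" unfolding W_def using r mv by blast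
    moreover have "inv (A v) = inv s \<otimes> inv (t v)" using A[OF v(1)] by (simp add: t_eq inv_mult_group)
    ultimately show ?case using W_mult sW v by simp
  next
    case (eng h1 h2)
    then show ?case using W_mult by blast
  qed
  then show ?thesis unfolding W_def Z_def s_def by blast
qed

section \<open>Compactly supported maps and their squares\<close>

text \<open>Two-point transitivity bridges the gap between \<open>p\<close> and \<open>q\<close>;
  the condition \<open>f p < g q\<close> leaves room for an increasing transition.\<close>

lemma PL_join:
  assumes f: "f \<in> PL" and g: "g \<in> PL" and p: "p \<in> Z_tau" and q: "q \<in> Z_tau" and "p < q" "f p < g q"
  obtains h where "h \<in> PL" "\<And>x. x \<le> p \<Longrightarrow> h x = f x" "\<And>x. q \<le> x \<Longrightarrow> h x = g x"
proof -
  obtain m where m: "m \<in> PL" "m p = f p" "m q = g q"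
    using PL_two_points[of p q "f p" "g q"] assms by (auto simp: PL_Z_tau)
  have "glue p f (glue q m g) \<in> PL"
    using m f g p q \<open>p < q\<close> by (intro PL_glue) auto
  moreover have "glue p f (glue q m g) x = g x" if "q \<le> x" for x
    using that \<open>p < q\<close> glue_ge[of m q g x] m by (simp add: glue_def)
  ultimately show ?thesis by (intro that[of "glue p f (glue q m g)"]) auto
qed

definition PL_supp :: "real \<Rightarrow> real \<Rightarrow> (real \<Rightarrow> real) set" where
  "PL_supp a b = {f \<in> PL. \<forall>x. x \<le> a \<or> b \<le> x \<longrightarrow> f x = x}"

definition PL_compact :: "(real \<Rightarrow> real) set" where
  "PL_compact = (\<Union>M. PL_supp (- M) M)"

lemma PL_suppD: "f \<in> PL_supp a b \<Longrightarrow> f \<in> PL" "f \<in> PL_supp a b \<Longrightarrow> x \<le> a \<Longrightarrow> f x = x"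
  "f \<in> PL_supp a b \<Longrightarrow> b \<le> x \<Longrightarrow> f x = x"
  by (auto simp: PL_supp_def)

lemma PL_supp_mono: "a' \<le> a \<Longrightarrow> b \<le> b' \<Longrightarrow> PL_supp a b \<subseteq> PL_supp a' b'"
  by (auto simp: PL_supp_def)

lemma PL_compactI:
  assumes "f \<in> PL" "\<And>x. x \<le> a \<Longrightarrow> f x = x" "\<And>x. b \<le> x \<Longrightarrow> f x = x" shows "f \<in> PL_compact"
proof -
  have "f \<in> PL_supp (- max \<bar>a\<bar> \<bar>b\<bar>) (max \<bar>a\<bar> \<bar>b\<bar>)" using assms by (auto simp: PL_supp_def)
  then show ?thesis unfolding PL_compact_def by blast
qed

lemma inv_fixed: "f \<in> PL \<Longrightarrow> f x = x \<Longrightarrow> inv_into UNIV f x = x"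
  by (metis PL_inv_simps(2))

lemma PL_supp_subgroup: "subgroup (PL_supp a b) (trans_group PL)"
proof (rule group.subgroupI[OF PL_group])
  show "PL_supp a b \<subseteq> carrier (trans_group PL)" by (auto simp: PL_supp_def)
  have "id \<in> PL_supp a b" by (simp add: PL_supp_def PL_id)
  then show "PL_supp a b \<noteq> {}" by blast
  fix f assume f: "f \<in> PL_supp a b"
  then show "inv\<^bsub>trans_group PL\<^esub> f \<in> PL_supp a b"
    using PL_suppD[OF f] by (simp add: inv_PL) (auto simp: PL_supp_def PL_inv inv_fixed)
  fix g assume "g \<in> PL_supp a b"
  then show "f \<otimes>\<^bsub>trans_group PL\<^esub> g \<in> PL_supp a b"
    using f by (auto simp: PL_supp_def PL_comp)
qed

lemma PL_compact_PL: "f \<in> PL_compact \<Longrightarrow> f \<in> PL"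
  by (auto simp: PL_compact_def PL_supp_def)

lemma PL_compactE:
  assumes "f \<in> PL_compact" obtains M where "M > 0" "f \<in> PL_supp (- M) M"
proof -
  obtain M where "f \<in> PL_supp (- M) M" using assms by (auto simp: PL_compact_def)
  then have "f \<in> PL_supp (- max M 1) (max M 1)" using PL_supp_mono[of "- max M 1" "- M" M "max M 1"] by auto
  then show ?thesis by (intro that[of "max M 1"]) auto
qed

lemma PL_compact_subgroup: "subgroup PL_compact (trans_group PL)"
proof (rule group.subgroupI[OF PL_group])
  show "PL_compact \<subseteq> carrier (trans_group PL)" using PL_compact_PL by auto
  have "id \<in> PL_compact" by (rule PL_compactI[of _ 0 0]) (auto simp: PL_id)
  then show "PL_compact \<noteq> {}" by blast
  fix f assume f: "f \<in> PL_compact"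
  then obtain M where M: "f \<in> PL_supp (- M) M" by (auto simp: PL_compact_def)
  show "inv\<^bsub>trans_group PL\<^esub> f \<in> PL_compact"
    using subgroup.m_inv_closed[OF PL_supp_subgroup M] unfolding PL_compact_def by blast
  fix g assume g: "g \<in> PL_compact"
  then obtain L where L: "g \<in> PL_supp (- L) L" by (auto simp: PL_compact_def)
  have "f \<in> PL_supp (- max L M) (max L M)" "g \<in> PL_supp (- max L M) (max L M)"
    using M L PL_supp_mono[of "- max L M" "- M" M "max L M"] PL_supp_mono[of "- max L M" "- L" L "max L M"] by auto
  then show "f \<otimes>\<^bsub>trans_group PL\<^esub> g \<in> PL_compact"
    using subgroup.m_closed[OF PL_supp_subgroup] unfolding PL_compact_def by blast
qed

lemma PL_conj_supp:
  assumes k: "k \<in> PL" and f: "f \<in> PL_supp a b" shows "k \<circ> f \<circ> inv_into UNIV k \<in> PL_supp (k a) (k b)"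
proof -
  note i = PL_inv_simps[OF k]
  have "(k \<circ> f \<circ> inv_into UNIV k) x = x" if "x \<le> k a \<or> k b \<le> x" for x
  proof -
    have "inv_into UNIV k x \<le> a \<or> b \<le> inv_into UNIV k x"
      using that PL_le_iff[OF k, of "inv_into UNIV k x" a] PL_le_iff[OF k, of b "inv_into UNIV k x"] i by simp
    then have "f (inv_into UNIV k x) = inv_into UNIV k x" using f by (auto simp: PL_supp_def)
    then show ?thesis using i by simp
  qed
  then show ?thesis using k PL_suppD(1)[OF f] by (auto simp: PL_supp_def intro!: PL_comp PL_inv)
qed

lemma PL_compact_normal: "PL_compact \<lhd> trans_group PL"
proof (rule group.normal_invI[OF PL_group PL_compact_subgroup])
  fix k h assume k: "k \<in> carrier (trans_group PL)" and h: "h \<in> PL_compact"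
  then obtain M where M: "h \<in> PL_supp (- M) M" by (auto simp: PL_compact_def)
  then have c: "k \<circ> h \<circ> inv_into UNIV k \<in> PL_supp (k (- M)) (k M)" using k by (intro PL_conj_supp) auto
  then show "k \<otimes>\<^bsub>trans_group PL\<^esub> h \<otimes>\<^bsub>trans_group PL\<^esub> inv\<^bsub>trans_group PL\<^esub> k \<in> PL_compact"
    using k PL_suppD[OF c] by (auto simp: inv_PL intro!: PL_compactI[of _ "k (- M)" "k M"])
qed

text \<open>Makes any element of \<open>PL\<close> act on a given compactly supported map as a
  compactly supported element does; this is the source of centrality in the quotient below.\<close>

lemma PL_compact_extend:
  assumes k: "k \<in> PL" shows "\<exists>k'\<in>PL_compact. \<forall>x\<in>{-M..M}. k' x = k x"
proof -
  define m where "m = \<lceil>\<bar>M\<bar>\<rceil>"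
  \<comment> \<open>Beyond \<open>m\<close> and beyond the images of \<open>m\<close> and
    \<open>- m\<close>, so that increasing transitions from \<open>k\<close> to the identity exist
    on both sides.\<close>
  define L where "L = max m (\<lceil>\<bar>k (of_int m)\<bar>\<rceil> + \<lceil>\<bar>k (- of_int m)\<bar>\<rceil>) + 1"
  have m: "\<bar>M\<bar> \<le> of_int m" by (simp add: m_def)
  have "\<bar>k (of_int m)\<bar> \<le> of_int \<lceil>\<bar>k (of_int m)\<bar>\<rceil>" "\<bar>k (- of_int m)\<bar> \<le> of_int \<lceil>\<bar>k (- of_int m)\<bar>\<rceil>" by auto
  moreover have "of_int m < (of_int L :: real)" "of_int (\<lceil>\<bar>k (of_int m)\<bar>\<rceil> + \<lceil>\<bar>k (- of_int m)\<bar>\<rceil>) < (of_int L :: real)"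
    unfolding L_def of_int_less_iff by auto
  ultimately have L: "of_int m < (of_int L :: real)" "k (of_int m) < of_int L" "- of_int L < k (- of_int m)"
    unfolding of_int_add by linarith+
  have Z: "- of_int L \<in> Z_tau" "- of_int m \<in> Z_tau" by auto
  obtain h where h: "h \<in> PL" "\<And>x. x \<le> - of_int L \<Longrightarrow> h x = x" "\<And>x. - of_int m \<le> x \<Longrightarrow> h x = k x"
    using PL_join[OF PL_id(1) k Z] L by auto
  have "h (of_int m) = k (of_int m)" using h m by simp
  then obtain k' where k': "k' \<in> PL" "\<And>x. x \<le> of_int m \<Longrightarrow> k' x = h x" "\<And>x. of_int L \<le> x \<Longrightarrow> k' x = x"
    using PL_join[OF h(1) PL_id(1), of "of_int m" "of_int L"] L by auto
  have "k' \<in> PL_compact"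
    using k' h m L by (intro PL_compactI[of _ "- of_int L" "of_int L"]) auto
  moreover have "k' x = k x" if "x \<in> {-M..M}" for x
    using that k' h m by auto
  ultimately show ?thesis by blast
qed

section \<open>Homotheties of half-lines and the maps they generate\<close>

definition homothety :: "real \<Rightarrow> int \<Rightarrow> real \<Rightarrow> real" where
  "homothety u k = glue u id (\<lambda>x. u + tau powi k * (x - u))"

lemma homothety_le [simp]: "x \<le> u \<Longrightarrow> homothety u k x = x"
  by (simp add: homothety_def)

lemma homothety_ge: "u \<le> x \<Longrightarrow> homothety u k x = u + tau powi k * (x - u)"
  unfolding homothety_def by (rule glue_ge) simp_all

lemma homothety_PL:
  assumes u: "u \<in> Z_tau" shows "homothety u k \<in> PL"
proof -
  have "(\<lambda>x. tau powi k * x + (u - tau powi k * u)) \<in> PL" using u by (intro PL_affine) auto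
  moreover have "(\<lambda>x. tau powi k * x + (u - tau powi k * u)) = (\<lambda>x. u + tau powi k * (x - u))"
    by (auto simp: algebra_simps)
  ultimately show ?thesis unfolding homothety_def using u PL_id by (intro PL_glue) auto
qed

lemma homothety_add: "homothety u k \<circ> homothety u l = homothety u (k + l)"
proof
  fix x
  show "(homothety u k \<circ> homothety u l) x = homothety u (k + l) x"
  proof (cases "x \<le> u")
    case False
    then have "u \<le> u + tau powi l * (x - u)" using tau_powi_pos[of l] by simp
    then show ?thesis using False by (simp add: homothety_ge tau_powi_add)
  qed simp
qed

lemma homothety_0: "homothety u 0 = id"
  by (auto simp: homothety_def glue_def)

lemma homothety_inv: "u \<in> Z_tau \<Longrightarrow> inv\<^bsub>trans_group PL\<^esub> (homothety u k) = homothety u (- k)"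
  by (rule group.inv_equality[OF PL_group]) (auto simp: homothety_PL homothety_add homothety_0)

lemma homothety_pow:
  assumes u: "u \<in> Z_tau" shows "homothety u 1 [^]\<^bsub>trans_group PL\<^esub> (k :: int) = homothety u k"
proof -
  interpret group "trans_group PL" by (rule PL_group)
  have c: "homothety u 1 \<in> carrier (trans_group PL)" using homothety_PL[OF u] by simp
  show ?thesis
  proof (induction k rule: int_induct[where k = 0])
    case base
    then show ?case by (simp add: homothety_0)
  next
    case (step1 k)
    then show ?case using int_pow_mult[OF c, of k 1] int_pow_1[OF c] by (simp add: homothety_add)
  next
    case (step2 k)
    have "homothety u 1 [^]\<^bsub>trans_group PL\<^esub> (- 1 :: int) = homothety u (- 1)"
      using int_pow_neg[OF c, of 1] int_pow_1[OF c] homothety_inv[OF u] by simp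
    then show ?case using step2 int_pow_mult[OF c, of k "- 1"] by (simp add: homothety_add)
  qed
qed

text \<open>\<open>homothety u j\<close> preserves the half-line from \<open>u\<close> on, where
  \<open>k\<close> is affine, and is the identity below \<open>u\<close>, where monotonicity of
  \<open>k\<close> suffices.\<close>

lemma homothety_conj:
  assumes k: "k \<in> PL" and aff: "\<And>x. u \<le> x \<Longrightarrow> k x = tau powi m * x + b"
  shows "k \<circ> homothety u j = homothety (k u) j \<circ> k"
proof
  fix x
  show "(k \<circ> homothety u j) x = (homothety (k u) j \<circ> k) x"
  proof (cases "x \<le> u")
    case True
    then show ?thesis using PL_le_iff[OF k, of x u] by simp
  next
    case False
    then have "u \<le> u + tau powi j * (x - u)" using tau_powi_pos[of j] by simp
    moreover have "k u \<le> k x" using False PL_le_iff[OF k] by simp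
    ultimately show ?thesis using False by (simp add: homothety_ge aff algebra_simps)
  qed
qed

text \<open>The whole stretch before \<open>b\<close> lies in one affine piece, and two points of
  the region where \<open>f\<close> is the identity determine that piece.\<close>

lemma no_breakpoints_before:
  assumes f: "f \<in> PL" and id: "\<And>x. x \<le> a \<Longrightarrow> f x = x" and br: "\<And>y. y < b \<Longrightarrow> y \<notin> breakpoints f"
    and x: "x < b"
  shows "f x = x"
proof -
  define a' where "a' = min a x - 1"
  have "{a' - 1<..<b} \<inter> breakpoints f = {}" using br by auto
  then obtain c d where cd: "\<And>x. a' - 1 < x \<Longrightarrow> x < b \<Longrightarrow> f x = c * x + d"
    using affine_without_breakpoints by metis
  have "c * a' + d = a'" "c * (a' + 1/2) + d = a' + 1/2"
    using cd[of a'] cd[of "a' + 1/2"] id[of a'] id[of "a' + 1/2"] x by (auto simp: a'_def)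
  then have "c = 1" by (simp add: algebra_simps)
  moreover from this have "d = 0" using \<open>c * a' + d = a'\<close> by simp
  ultimately show ?thesis using cd[of x] x by (auto simp: a'_def)
qed

text \<open>Induction on the number of breakpoints. At the leftmost one, \<open>s\<close>, composing
  with a homothety centred at \<open>s\<close> undoes the right slope; it removes this breakpoint
  and carries the remaining ones along without creating any.\<close>

lemma generate_homotheties:
  assumes "f \<in> PL" "\<And>x. x \<le> a \<Longrightarrow> f x = x" "finite (breakpoints f)"
  shows "f \<in> generate (trans_group PL) ((\<lambda>u. homothety u 1) ` Z_tau)"
  using assms
proof (induction "card (breakpoints f)" arbitrary: f a rule: less_induct)
  case (less f)
  note f = less.prems(1)
  interpret group "trans_group PL" by (rule PL_group)
  show ?case
  proof (cases "breakpoints f = {}")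
    case True
    have "f x = x" for x
      by (rule no_breakpoints_before[OF f less.prems(2), where b = "x + 1"]) (use True in auto)
    then have "f = \<one>\<^bsub>trans_group PL\<^esub>" by auto
    then show ?thesis by (simp only: generate.one)
  next
    case False
    define s where "s = Min (breakpoints f)"
    have sb: "s \<in> breakpoints f" unfolding s_def using less.prems(3) False by (rule Min_in)
    have smin: "y \<notin> breakpoints f" if "y < s" for y
      using that Min_le[OF less.prems(3), of y] unfolding s_def by force
    have sZ: "s \<in> Z_tau" using PL_breakpoints_Z_tau[OF f sb] .
    have below: "f x = x" if "x < s" for x using no_breakpoints_before[OF f less.prems(2) smin that] by blast
    obtain k l :: int and e where e: "e > 0" "\<And>y. s \<le> y \<Longrightarrow> y \<le> s + e \<Longrightarrow> f y = f s + tau powi k * (y - s)"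
      "\<And>y. s - e \<le> y \<Longrightarrow> y \<le> s \<Longrightarrow> f y = f s + tau powi l * (y - s)"
      using PL_germ[OF f, of s] by metis
    \<comment> \<open>Two points below \<open>s\<close>, where \<open>f\<close> is the identity,
      determine the left germ and thereby give \<open>f s = s\<close>.\<close>
    have "f (s - e) = f s + tau powi l * (s - e - s)" "f (s - e/2) = f s + tau powi l * (s - e/2 - s)"
      using e(1) by (intro e(3); simp)+
    moreover have "f (s - e) = s - e" "f (s - e/2) = s - e/2" using e(1) by (intro below; simp)+
    ultimately have "s - e = f s + tau powi l * (s - e - s)" "s - e/2 = f s + tau powi l * (s - e/2 - s)"
      by (simp_all only:)
    then have fs: "f s = s" by (simp add: algebra_simps)
    let ?A = "homothety s"
    define f' where "f' = f \<circ> ?A (- k)"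
    have f': "f' \<in> PL" using PL_comp[OF f homothety_PL[OF sZ]] by (simp add: f'_def)
    have f_eq: "f = f' \<circ> ?A k"
      unfolding f'_def by (simp add: o_assoc[symmetric] homothety_add homothety_0)
    have id': "f' x = x" if x: "x < s + tau powi k * e" for x
    proof (cases "x < s")
      case True
      then show ?thesis using below by (simp add: f'_def)
    next
      case False
      define y where "y = s + tau powi (- k) * (x - s)"
      have inv: "tau powi k * tau powi (- k) = 1" by (simp flip: tau_powi_add)
      have "0 \<le> tau powi (- k) * (x - s)" using False tau_powi_pos[of "- k"] by simp
      moreover have "tau powi (- k) * (x - s) \<le> tau powi (- k) * (tau powi k * e)"
        using x tau_powi_pos[of "- k"] by (intro mult_left_mono) auto
      moreover have "tau powi (- k) * (tau powi k * e) = e" 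
        by (simp add: mult.assoc[symmetric] tau_powi_add[symmetric])
      ultimately have "s \<le> y" "y \<le> s + e" unfolding y_def by linarith+
      then have "f y = f s + tau powi k * (y - s)" by (rule e(2))
      also have "\<dots> = s + (tau powi k * tau powi (- k)) * (x - s)" by (simp add: y_def fs)
      also have "\<dots> = x" by (simp add: inv)
      finally show ?thesis using False by (simp add: f'_def homothety_ge y_def)
    qed
    have sub: "breakpoints f' \<subseteq> ?A k ` (breakpoints f - {s})"
    proof
      fix x assume x: "x \<in> breakpoints f'"
      define d where "d = s + tau powi k * e"
      have ds: "s < d" using e(1) tau_powi_pos[of k] by (simp add: d_def)
      have xd: "d \<le> x"
      proof (rule ccontr)
        assume "\<not> d \<le> x"
        then have "x \<notin> breakpoints f'"
          using id' by (intro not_breakpoint[of x "x - 1" d f' 1 0]) (auto simp: d_def)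
        then show False using x by blast
      qed
      define y where "y = ?A (- k) x"
      have y_eq: "y = s + tau powi (- k) * (x - s)" using xd ds by (simp add: y_def homothety_ge)
      have ys: "y > s" using xd ds tau_powi_pos[of "- k"] by (simp add: y_eq)
      have xy: "x = ?A k y" using homothety_add[of s k "- k"] by (simp add: y_def homothety_0 fun_eq_iff)
      have "y \<in> breakpoints f"
      proof (rule ccontr)
        assume "y \<notin> breakpoints f"
        then obtain a b where ab: "\<forall>\<^sub>F z in nhds y. f z = a * z + b" by (auto simp: breakpoints_def)
        have "filterlim (\<lambda>z. s + tau powi (- k) * (z - s)) (nhds y) (nhds x)"
          unfolding y_eq by (intro tendsto_intros filterlim_ident)
        then have "\<forall>\<^sub>F z in nhds x. f (s + tau powi (- k) * (z - s)) = a * (s + tau powi (- k) * (z - s)) + b"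
          using ab by (auto simp: filterlim_iff)
        moreover have "\<forall>\<^sub>F z in nhds x. z \<in> {s<..}"
          using xd ds by (intro eventually_nhds_in_open) auto
        ultimately have "\<forall>\<^sub>F z in nhds x. f' z = (a * tau powi (- k)) * z + (a * (s - tau powi (- k) * s) + b)"
        proof eventually_elim
          case (elim z)
          then have "f' z = f (s + tau powi (- k) * (z - s))" by (simp add: f'_def homothety_ge)
          then show ?case using elim(1) by (simp add: algebra_simps)
        qed
        then show False using x unfolding breakpoints_def by blast
      qed
      then show "x \<in> ?A k ` (breakpoints f - {s})" using xy ys by blast
    qed
    have fin: "finite (breakpoints f - {s})" using less.prems(3) by simp
    have "card (breakpoints f') \<le> card (?A k ` (breakpoints f - {s}))"
      using sub fin by (intro card_mono) auto
    also have "\<dots> \<le> card (breakpoints f - {s})" using fin by (rule card_image_le)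
    also have "\<dots> < card (breakpoints f)" using less.prems(3) sb by (intro psubset_card_mono) auto
    finally have "f' \<in> generate (trans_group PL) ((\<lambda>u. homothety u 1) ` Z_tau)"
    proof (rule less.hyps[OF _ f'])
      show "f' x = x" if "x \<le> s" for x
        using id'[of x] that mult_pos_pos[OF tau_powi_pos[of k] e(1)] by simp
      show "finite (breakpoints f')" using sub fin by (meson finite_imageI finite_subset)
    qed
    moreover have "?A k \<in> generate (trans_group PL) ((\<lambda>u. homothety u 1) ` Z_tau)"
    proof -
      have sg: "subgroup (generate (trans_group PL) ((\<lambda>u. homothety u 1) ` Z_tau)) (trans_group PL)"
        by (rule generate_is_subgroup) (auto simp: homothety_PL)
      show ?thesis
        using subgroup_int_pow_closed[OF sg, of "homothety s 1" k] sZ homothety_pow[OF sZ]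
        by (auto intro: generate.incl)
    qed
    ultimately have "f' \<otimes>\<^bsub>trans_group PL\<^esub> ?A k \<in> generate (trans_group PL) ((\<lambda>u. homothety u 1) ` Z_tau)"
      by (rule generate.eng)
    then show ?thesis by (simp add: f_eq[symmetric])
  qed
qed

lemma PL_compact_generate:
  assumes f: "f \<in> PL_compact" shows "f \<in> generate (trans_group PL) ((\<lambda>u. homothety u 1) ` Z_tau)"
proof -
  obtain M where M: "f \<in> PL_supp (- M) M" using f by (auto simp: PL_compact_def)
  have "breakpoints f \<subseteq> breakpoints f \<inter> {-M..M}"
  proof
    fix x assume x: "x \<in> breakpoints f"
    have "x \<notin> {x-1<..<-M}" "x \<notin> {M<..<x+1}"
      using x not_breakpoint[of x "x-1" "-M" f 1 0] not_breakpoint[of x M "x+1" f 1 0] PL_suppD[OF M] by auto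
    then show "x \<in> breakpoints f \<inter> {-M..M}" using x by auto
  qed
  then have "finite (breakpoints f)"
    using PL_finite_breakpoints[OF PL_compact_PL[OF f]] finite_subset by blast
  then show ?thesis
    using PL_suppD[OF M] by (intro generate_homotheties[of f "- M"]) auto
qed

section \<open>The quotient by commutators of compactly supported maps\<close>

lemma (in group) conj_hom:
  assumes "g \<in> carrier G" shows "group_hom G G (\<lambda>x. g \<otimes> x \<otimes> inv g)"
  by (unfold_locales, rule homI) (use assms in \<open>auto simp: m_assoc\<close>)

text \<open>The germs at plus infinity are translations, and these commute.\<close>

lemma commutator_translations_compact:
  assumes f: "f \<in> PL" "\<And>x. x \<le> a \<Longrightarrow> f x = x" "\<And>x. b \<le> x \<Longrightarrow> f x = x + c"
    and g: "g \<in> PL" "\<And>x. x \<le> a \<Longrightarrow> g x = x" "\<And>x. b \<le> x \<Longrightarrow> g x = x + d"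
  shows "f \<circ> g \<circ> inv_into UNIV f \<circ> inv_into UNIV g \<in> PL_compact"
proof (rule PL_compactI[of _ a "b + \<bar>c\<bar> + \<bar>d\<bar>"])
  show "f \<circ> g \<circ> inv_into UNIV f \<circ> inv_into UNIV g \<in> PL" using f(1) g(1) by (intro PL_comp PL_inv)
  show "(f \<circ> g \<circ> inv_into UNIV f \<circ> inv_into UNIV g) x = x" if "x \<le> a" for x
    using that f(2) g(2) inv_fixed[OF f(1)] inv_fixed[OF g(1)] by simp
  fix x assume x: "b + \<bar>c\<bar> + \<bar>d\<bar> \<le> x"
  have "g (x - d) = x" "f (x - d - c) = x - d" "g (x - d - c) = x - c" "f (x - c) = x"
    using x f(3)[of "x - d - c"] f(3)[of "x - c"] g(3)[of "x - d"] g(3)[of "x - d - c"] by auto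
  then have "inv_into UNIV g x = x - d" "inv_into UNIV f (x - d) = x - d - c" "g (x - d - c) = x - c" "f (x - c) = x"
    using PL_inv_simps(2)[OF g(1), of "x - d"] PL_inv_simps(2)[OF f(1), of "x - d - c"] by auto
  then show "(f \<circ> g \<circ> inv_into UNIV f \<circ> inv_into UNIV g) x = x" by simp
qed

lemma PL_supp_commute:
  assumes f: "f \<in> PL_supp a b" and j: "j \<in> PL" "\<And>x. a \<le> x \<Longrightarrow> x \<le> b \<Longrightarrow> j x = x" and "a \<le> b"
  shows "f \<circ> j = j \<circ> f"
proof
  fix x
  note fPL = PL_suppD(1)[OF f]
  consider "x < a" | "b < x" | "a \<le> x" "x \<le> b" by linarith
  then show "(f \<circ> j) x = (j \<circ> f) x"
  proof cases
    case 1
    then have "j x < a" using PL_less_iff[OF j(1), of x a] j(2) \<open>a \<le> b\<close> by simp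
    then show ?thesis using 1 PL_suppD(2)[OF f] by simp
  next
    case 2
    then have "b < j x" using PL_less_iff[OF j(1), of b x] j(2) \<open>a \<le> b\<close> by simp
    then show ?thesis using 2 PL_suppD(3)[OF f] by simp
  next
    case 3
    then have "a \<le> f x" "f x \<le> b"
      using PL_le_iff[OF fPL, of a x] PL_le_iff[OF fPL, of x b] PL_suppD(2)[OF f, of a] PL_suppD(3)[OF f, of b] by auto
    then show ?thesis using 3 j(2) by simp
  qed
qed

text \<open>Modulo commutators, \<open>PL_compact\<close> is the kernel of a central extension of the affine germs at
  infinity, so \<open>affine_extension\<close> applies to the homotheties.\<close>
lemma PL_compact_square:
  assumes h: "h \<in> PL_compact"
  shows "h \<circ> h \<in> derived (trans_group PL) PL_compact"
proof -
  let ?K = "trans_group PL"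
  let ?N = "derived ?K PL_compact"
  let ?E = "?K Mod ?N"
  let ?A = "\<lambda>u. homothety u 1"
  interpret K: group ?K by (rule PL_group)
  have compact_carrier: "PL_compact \<subseteq> carrier ?K" using PL_compact_PL by auto
  interpret N: normal ?N ?K by (rule K.derived_is_normal[OF PL_compact_normal])
  interpret E: group ?E by (rule N.factorgroup_is_group)
  define \<pi> where "\<pi> = (\<lambda>f. ?N #>\<^bsub>?K\<^esub> f)"
  interpret \<pi>: group_hom ?K ?E \<pi>
    unfolding \<pi>_def by (rule group_hom.intro[OF K.group_axioms E.group_axioms]) (simp add: group_hom_axioms_def N.r_coset_hom_Mod)
  have \<pi>_comp: "\<pi> (f \<circ> g) = \<pi> f \<otimes>\<^bsub>?E\<^esub> \<pi> g" if "f \<in> PL" "g \<in> PL" for f g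
    using \<pi>.hom_mult[of f g] that by simp
  have \<pi>_inv: "\<pi> (inv_into UNIV f) = inv\<^bsub>?E\<^esub> \<pi> f" if "f \<in> PL" for f
    using \<pi>.hom_inv[of f] that by (simp add: inv_PL)
  have \<pi>_carrier: "\<pi> f \<in> carrier ?E" if "f \<in> PL" for f using \<pi>.hom_closed[of f] that by simp
  have N_one: "\<pi> f = \<one>\<^bsub>?E\<^esub>" if "f \<in> ?N" for f
  proof -
    have "f \<in> carrier ?K" using that N.subset by blast
    then show ?thesis unfolding \<pi>_def using K.coset_join2[OF _ N.subgroup_axioms that] by simp
  qed
  have one_N: "f \<in> ?N" if "\<pi> f = \<one>\<^bsub>?E\<^esub>" "f \<in> PL" for f
    using K.coset_join1[OF _ _ N.subgroup_axioms, of f] that unfolding \<pi>_def by simp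
  have comm_pi: "\<pi> f \<otimes>\<^bsub>?E\<^esub> \<pi> g = \<pi> g \<otimes>\<^bsub>?E\<^esub> \<pi> f" if f: "f \<in> PL_compact" and g: "g \<in> PL_compact" for f g
  proof -
    have fg: "f \<in> PL" "g \<in> PL" using f g PL_compact_PL by auto
    have "f \<otimes>\<^bsub>?K\<^esub> g \<otimes>\<^bsub>?K\<^esub> inv\<^bsub>?K\<^esub> f \<otimes>\<^bsub>?K\<^esub> inv\<^bsub>?K\<^esub> g \<in> ?N"
      unfolding derived_def using f g by (intro generate.incl) blast
    then have "\<pi> (f \<otimes>\<^bsub>?K\<^esub> g \<otimes>\<^bsub>?K\<^esub> inv\<^bsub>?K\<^esub> f \<otimes>\<^bsub>?K\<^esub> inv\<^bsub>?K\<^esub> g) = \<one>\<^bsub>?E\<^esub>" by (rule N_one)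
    then have "\<pi> (f \<circ> g \<circ> inv_into UNIV f \<circ> inv_into UNIV g) = \<one>\<^bsub>?E\<^esub>" using fg by (simp add: inv_PL)
    moreover have "\<pi> (f \<circ> g \<circ> inv_into UNIV f \<circ> inv_into UNIV g) = E.commutator (\<pi> f) (\<pi> g)"
      using fg by (simp only: \<pi>_comp \<pi>_inv PL_comp PL_inv)
    ultimately have 1: "E.commutator (\<pi> f) (\<pi> g) = \<one>\<^bsub>?E\<^esub>" by (simp only:)
    have c: "\<pi> f \<in> carrier ?E" "\<pi> g \<in> carrier ?E" using fg \<pi>_carrier by auto
    have "\<pi> f \<otimes>\<^bsub>?E\<^esub> \<pi> g = E.commutator (\<pi> f) (\<pi> g) \<otimes>\<^bsub>?E\<^esub> (\<pi> g \<otimes>\<^bsub>?E\<^esub> \<pi> f)"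
      using c by (simp only: E.m_assoc E.cancel_left E.inv_closed E.m_closed E.l_inv E.r_one)
    then show ?thesis using c by (simp only: 1 E.l_one E.m_closed)
  qed
  \<comment> \<open>Split \<open>k\<close> as \<open>k' \<circ> j\<close>, where the compactly
    supported \<open>k'\<close> agrees with \<open>k\<close> on the support of \<open>f\<close>.
    Then \<open>j\<close> fixes that support pointwise and commutes with \<open>f\<close>, while
    \<open>k'\<close> commutes with \<open>f\<close> modulo \<open>?N\<close>.\<close>
  have central: "\<pi> f \<otimes>\<^bsub>?E\<^esub> \<pi> k = \<pi> k \<otimes>\<^bsub>?E\<^esub> \<pi> f" if f: "f \<in> PL_compact" and k: "k \<in> PL" for f k
  proof -
    obtain M where M: "M > 0" "f \<in> PL_supp (- M) M" using PL_compactE[OF f] .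
    obtain k' where k': "k' \<in> PL_compact" "\<forall>x\<in>{-M..M}. k' x = k x" using PL_compact_extend[OF k] by blast
    have k'PL: "k' \<in> PL" using k' PL_compact_PL by blast
    define j where "j = inv_into UNIV k' \<circ> k"
    have j: "j \<in> PL" unfolding j_def using k'PL k by (intro PL_comp PL_inv)
    have jfix: "j x = x" if "- M \<le> x" "x \<le> M" for x
      using k' that PL_inv_simps(2)[OF k'PL, of x] by (simp add: j_def)
    have "f \<circ> j = j \<circ> f" using PL_supp_commute[OF M(2) j jfix] M(1) by simp
    then have fj: "\<pi> f \<otimes>\<^bsub>?E\<^esub> \<pi> j = \<pi> j \<otimes>\<^bsub>?E\<^esub> \<pi> f" using \<pi>_comp j PL_compact_PL[OF f] by metis
    have "k = k' \<circ> j" unfolding j_def using PL_inv_simps(1)[OF k'PL] by auto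
    then have k_eq: "\<pi> k = \<pi> k' \<otimes>\<^bsub>?E\<^esub> \<pi> j" using \<pi>_comp[OF k'PL j] by simp
    have c: "\<pi> f \<in> carrier ?E" "\<pi> k' \<in> carrier ?E" "\<pi> j \<in> carrier ?E"
      using \<pi>_carrier f k'PL j PL_compact_PL by auto
    have "\<pi> f \<otimes>\<^bsub>?E\<^esub> \<pi> k = (\<pi> f \<otimes>\<^bsub>?E\<^esub> \<pi> k') \<otimes>\<^bsub>?E\<^esub> \<pi> j" unfolding k_eq using c by (simp only: E.m_assoc)
    also have "\<dots> = \<pi> k' \<otimes>\<^bsub>?E\<^esub> (\<pi> f \<otimes>\<^bsub>?E\<^esub> \<pi> j)" unfolding comm_pi[OF f k'(1)] using c by (simp only: E.m_assoc)
    also have "\<dots> = \<pi> k \<otimes>\<^bsub>?E\<^esub> \<pi> f" unfolding fj k_eq using c by (simp only: E.m_assoc)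
    finally show ?thesis .
  qed
  have conj: "\<pi> (?A v) \<otimes>\<^bsub>?E\<^esub> \<pi> (?A u) \<otimes>\<^bsub>?E\<^esub> inv\<^bsub>?E\<^esub> \<pi> (?A v) = \<pi> (?A (tau * u + tau * tau * v))"
    if u: "u \<in> Z_tau" and v: "v \<in> Z_tau" for u v
  proof -
    \<comment> \<open>The homothety of the whole line with centre \<open>v\<close>.
      \<open>?A v\<close> is not affine on all of the half-line from \<open>u\<close> when
      \<open>u < v\<close>, so it is replaced by a map \<open>k\<close> that is; the discrepancy
      \<open>\<eta>\<close> has compact support and is therefore central in the quotient.\<close>
    define \<theta> where "\<theta> = (\<lambda>x. tau powi 1 * x + (v - tau * v))"
    have \<theta>: "\<theta> \<in> PL" unfolding \<theta>_def using v by (intro PL_affine) auto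
    have \<theta>u: "\<theta> u = tau * u + tau * tau * v" by (simp add: \<theta>_def tau_sq algebra_simps)
    define p :: real where "p = of_int (\<lfloor>min u (\<theta> u)\<rfloor> - 1)"
    have "of_int \<lfloor>min u (\<theta> u)\<rfloor> \<le> min u (\<theta> u)" by (rule of_int_floor_le)
    then have p: "p \<in> Z_tau" "p < u" "p < \<theta> u" by (auto simp: p_def)
    obtain k where k: "k \<in> PL" "\<And>x. x \<le> p \<Longrightarrow> k x = x" "\<And>x. u \<le> x \<Longrightarrow> k x = \<theta> x"
      using PL_join[OF PL_id(2) \<theta> p(1) u p(2)] p(3) by metis
    define \<eta> where "\<eta> = inv_into UNIV k \<circ> ?A v"
    have AvPL: "?A v \<in> PL" "?A u \<in> PL" using homothety_PL u v by auto
    have \<eta>: "\<eta> \<in> PL_compact"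
    proof (rule PL_compactI[of _ "min p v" "max u v"])
      show "\<eta> \<in> PL" unfolding \<eta>_def using k AvPL by (intro PL_comp PL_inv)
      show "\<eta> x = x" if "x \<le> min p v" for x
        using that inv_fixed[OF k(1) k(2)] by (simp add: \<eta>_def)
      fix x assume x: "max u v \<le> x"
      have "?A v x = k x" using x k(3)[of x] by (simp add: homothety_ge \<theta>_def algebra_simps)
      then show "\<eta> x = x" using PL_inv_simps(2)[OF k(1)] by (simp add: \<eta>_def)
    qed
    have "?A v = k \<circ> \<eta>" unfolding \<eta>_def using PL_inv_simps(1)[OF k(1)] by auto
    then have Av: "\<pi> (?A v) = \<pi> k \<otimes>\<^bsub>?E\<^esub> \<pi> \<eta>" using \<pi>_comp[OF k(1) PL_compact_PL[OF \<eta>]] by simp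
    have c: "\<pi> k \<in> carrier ?E" "\<pi> \<eta> \<in> carrier ?E" "\<pi> (?A u) \<in> carrier ?E" "\<pi> (?A (\<theta> u)) \<in> carrier ?E"
      using \<pi>_carrier k(1) PL_compact_PL[OF \<eta>] AvPL homothety_PL[of "\<theta> u"] PL_Z_tau[OF \<theta>] u by auto
    have "k \<circ> ?A u = homothety (k u) 1 \<circ> k"
      using k(3) by (intro homothety_conj[OF k(1), of u 1 "v - tau * v"]) (simp add: \<theta>_def)
    then have kA: "\<pi> k \<otimes>\<^bsub>?E\<^esub> \<pi> (?A u) = \<pi> (?A (\<theta> u)) \<otimes>\<^bsub>?E\<^esub> \<pi> k"
      using \<pi>_comp[OF k(1) AvPL(2)] \<pi>_comp[of "?A (\<theta> u)" k] k(1) k(3)[of u] homothety_PL[of "\<theta> u"] PL_Z_tau[OF \<theta>] u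
      by simp
    have "\<pi> (?A v) \<otimes>\<^bsub>?E\<^esub> \<pi> (?A u) = \<pi> k \<otimes>\<^bsub>?E\<^esub> (\<pi> \<eta> \<otimes>\<^bsub>?E\<^esub> \<pi> (?A u))"
      unfolding Av using c by (simp only: E.m_assoc)
    also have "\<pi> \<eta> \<otimes>\<^bsub>?E\<^esub> \<pi> (?A u) = \<pi> (?A u) \<otimes>\<^bsub>?E\<^esub> \<pi> \<eta>" by (rule central[OF \<eta> AvPL(2)])
    also have "\<pi> k \<otimes>\<^bsub>?E\<^esub> (\<pi> (?A u) \<otimes>\<^bsub>?E\<^esub> \<pi> \<eta>) = (\<pi> k \<otimes>\<^bsub>?E\<^esub> \<pi> (?A u)) \<otimes>\<^bsub>?E\<^esub> \<pi> \<eta>"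
      using c by (simp only: E.m_assoc)
    also have "\<dots> = \<pi> (?A (\<theta> u)) \<otimes>\<^bsub>?E\<^esub> \<pi> (?A v)" unfolding kA Av using c by (simp only: E.m_assoc)
    finally have "\<pi> (?A v) \<otimes>\<^bsub>?E\<^esub> \<pi> (?A u) \<otimes>\<^bsub>?E\<^esub> inv\<^bsub>?E\<^esub> \<pi> (?A v)
        = \<pi> (?A (\<theta> u)) \<otimes>\<^bsub>?E\<^esub> \<pi> (?A v) \<otimes>\<^bsub>?E\<^esub> inv\<^bsub>?E\<^esub> \<pi> (?A v)" by (simp only:)
    also have "\<dots> = \<pi> (?A (\<theta> u))"
      using c \<pi>_carrier[OF AvPL(1)] by (simp only: E.m_assoc E.r_inv E.r_one E.inv_closed)
    finally show ?thesis unfolding \<theta>u .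
  qed
  have t_eq: "\<pi> (?A u) \<otimes>\<^bsub>?E\<^esub> inv\<^bsub>?E\<^esub> \<pi> (?A 0) = \<pi> (?A u \<circ> homothety 0 (- 1))" if "u \<in> Z_tau" for u
  proof -
    have "inv\<^bsub>?E\<^esub> \<pi> (?A 0) = \<pi> (homothety 0 (- 1))"
      using \<pi>.hom_inv[of "?A 0"] homothety_PL[of 0 1] homothety_inv[of 0 1] by simp
    then show ?thesis using \<pi>_comp[of "?A u" "homothety 0 (- 1)"] homothety_PL that by simp
  qed
  have t_far: "(?A u \<circ> homothety 0 (- 1)) x = x + (u - tau * u)" if "\<bar>u\<bar> \<le> x" for u x
  proof -
    have "homothety 0 (- 1) x = x + tau * x"
      using that homothety_ge[of 0 x "- 1"] inverse_tau by (simp add: distrib_right)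
    moreover have "u \<le> x + tau * x" using that tau_pos by (simp add: add_increasing2)
    moreover have "tau * (x + tau * x) = x"
    proof -
      have "tau * (x + tau * x) = (tau + tau * tau) * x" by (simp only: distrib_left distrib_right mult.assoc)
      then show ?thesis by (simp add: tau_sq)
    qed
    ultimately show ?thesis by (simp add: homothety_ge right_diff_distrib)
  qed
  have comm: "E.commutator (\<pi> (?A u) \<otimes>\<^bsub>?E\<^esub> inv\<^bsub>?E\<^esub> \<pi> (?A 0)) (\<pi> (?A v) \<otimes>\<^bsub>?E\<^esub> inv\<^bsub>?E\<^esub> \<pi> (?A 0)) \<in> \<pi> ` PL_compact"
    if u: "u \<in> Z_tau" and v: "v \<in> Z_tau" for u v
  proof -
    define f where "f = ?A u \<circ> homothety 0 (- 1)"
    define g where "g = ?A v \<circ> homothety 0 (- 1)"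
    have fg: "f \<in> PL" "g \<in> PL" unfolding f_def g_def using u v by (auto intro!: PL_comp homothety_PL)
    have "f \<circ> g \<circ> inv_into UNIV f \<circ> inv_into UNIV g \<in> PL_compact"
    proof (rule commutator_translations_compact[OF fg(1) _ _ fg(2)])
      fix x assume x: "max \<bar>u\<bar> \<bar>v\<bar> \<le> x"
      show "f x = x + (u - tau * u)" unfolding f_def using x by (intro t_far) simp
      show "g x = x + (v - tau * v)" unfolding g_def using x by (intro t_far) simp
    next
      fix x assume x: "x \<le> min 0 (min u v)"
      show "f x = x" "g x = x" using x by (simp_all add: f_def g_def)
    qed
    moreover have "\<pi> (f \<circ> g \<circ> inv_into UNIV f \<circ> inv_into UNIV g) = E.commutator (\<pi> f) (\<pi> g)"
      using fg by (simp only: \<pi>_comp \<pi>_inv PL_comp PL_inv)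
    ultimately show ?thesis unfolding t_eq[OF u] t_eq[OF v] f_def[symmetric] g_def[symmetric] by (metis imageI)
  qed
  have "h \<in> generate ?K (?A ` Z_tau)" by (rule PL_compact_generate[OF h])
  then have gen: "\<pi> h \<in> generate ?E ((\<lambda>u. \<pi> (?A u)) ` Z_tau)"
    using \<pi>.generate_img[of "?A ` Z_tau"] homothety_PL by (auto simp: image_image)
  have "\<exists>z u k. z \<in> \<pi> ` PL_compact \<and> z \<otimes>\<^bsub>?E\<^esub> z = \<one>\<^bsub>?E\<^esub> \<and> u \<in> Z_tau \<and>
      \<pi> h = z \<otimes>\<^bsub>?E\<^esub> (\<pi> (?A u) \<otimes>\<^bsub>?E\<^esub> inv\<^bsub>?E\<^esub> \<pi> (?A 0)) \<otimes>\<^bsub>?E\<^esub> \<pi> (?A 0) [^]\<^bsub>?E\<^esub> (k :: int)"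
  proof (rule E.affine_extension[OF _ conj _ _ comm gen])
    show "\<pi> (?A u) \<in> carrier ?E" if "u \<in> Z_tau" for u using \<pi>_carrier homothety_PL that by blast
    show "subgroup (\<pi> ` PL_compact) ?E" by (rule \<pi>.subgroup_img_is_subgroup[OF PL_compact_subgroup])
    fix z g assume z: "z \<in> \<pi> ` PL_compact" and g: "g \<in> carrier ?E"
    have "g \<in> \<pi> ` carrier ?K" using g unfolding \<pi>_def carrier_FactGroup .
    then show "z \<otimes>\<^bsub>?E\<^esub> g = g \<otimes>\<^bsub>?E\<^esub> z" using z central by auto
  qed
  then obtain \<zeta> u k where \<zeta>: "\<zeta> \<in> PL_compact" "\<pi> \<zeta> \<otimes>\<^bsub>?E\<^esub> \<pi> \<zeta> = \<one>\<^bsub>?E\<^esub>" and u: "u \<in> Z_tau"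
    and h_eq: "\<pi> h = \<pi> \<zeta> \<otimes>\<^bsub>?E\<^esub> (\<pi> (?A u) \<otimes>\<^bsub>?E\<^esub> inv\<^bsub>?E\<^esub> \<pi> (?A 0)) \<otimes>\<^bsub>?E\<^esub> \<pi> (?A 0) [^]\<^bsub>?E\<^esub> (k :: int)" by blast
  have A0k: "\<pi> (?A 0) [^]\<^bsub>?E\<^esub> k = \<pi> (homothety 0 k)"
    using \<pi>.hom_int_pow[of "?A 0" k] homothety_PL[of 0 1] homothety_pow[of 0 k] by simp
  define R where "R = \<zeta> \<circ> (?A u \<circ> homothety 0 (- 1)) \<circ> homothety 0 k"
  have RPL: "R \<in> PL" unfolding R_def using u PL_compact_PL[OF \<zeta>(1)] by (intro PL_comp homothety_PL) auto
  have hPL: "h \<in> PL" by (rule PL_compact_PL[OF h])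
  have "\<pi> h = \<pi> R" unfolding h_eq A0k t_eq[OF u] R_def using u PL_compact_PL[OF \<zeta>(1)]
    by (simp only: \<pi>_comp PL_comp homothety_PL Z_tau_0)
  then have "h \<in> ?N #>\<^bsub>?K\<^esub> R" unfolding \<pi>_def
    by (intro K.repr_independenceD[OF N.subgroup_axioms]) (use hPL in simp_all)
  then obtain n where n: "n \<in> ?N" "h = n \<circ> R" unfolding r_coset_def by auto
  have "?N \<subseteq> PL_compact" by (rule K.derived_incl[OF subset_refl PL_compact_subgroup])
  then have nc: "n \<in> PL_compact" using n by blast
  obtain M1 where M1: "h \<in> PL_supp (- M1) M1" using h by (auto simp: PL_compact_def)
  obtain M2 where M2: "\<zeta> \<in> PL_supp (- M2) M2" using \<zeta> by (auto simp: PL_compact_def)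
  obtain M3 where M3: "n \<in> PL_supp (- M3) M3" using nc by (auto simp: PL_compact_def)
  define c where "c = u - tau * u"
  have tk: "tau powi k > 0" by (rule tau_powi_pos)
  \<comment> \<open>Far to the right \<open>h\<close> is the identity, while its normal form has the
    affine germ of slope \<open>tau powi k\<close> and constant \<open>c\<close>. Equality of the
    two germs kills \<open>k\<close> and \<open>u\<close>, leaving only the central factor of square
    one.\<close>
  have far: "x = tau powi k * x + c"
    if x: "0 \<le> x" "M1 \<le> x" "(\<bar>u\<bar> + \<bar>c\<bar> + \<bar>M2\<bar> + \<bar>M3\<bar>) / tau powi k \<le> x" for x
  proof -
    have "(\<bar>u\<bar> + \<bar>c\<bar> + \<bar>M2\<bar> + \<bar>M3\<bar>) \<le> tau powi k * x"
      using x(3) tk by (simp add: pos_divide_le_eq mult.commute)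
    then have b: "\<bar>u\<bar> \<le> tau powi k * x" "M2 \<le> tau powi k * x + c" "M3 \<le> tau powi k * x + c" by auto
    have "R x = \<zeta> ((?A u \<circ> homothety 0 (- 1)) (tau powi k * x))" using x(1) by (simp add: R_def homothety_ge)
    also have "\<dots> = tau powi k * x + c" unfolding t_far[OF b(1)] c_def[symmetric] using PL_suppD(3)[OF M2 b(2)] .
    finally have "h x = tau powi k * x + c" unfolding n(2) using PL_suppD(3)[OF M3 b(3)] by simp
    then show ?thesis using PL_suppD(3)[OF M1 x(2)] by simp
  qed
  define X where "X = max 0 (max M1 ((\<bar>u\<bar> + \<bar>c\<bar> + \<bar>M2\<bar> + \<bar>M3\<bar>) / tau powi k))"
  have "X = tau powi k * X + c" "X + 1 = tau powi k * (X + 1) + c" by (rule far; simp add: X_def le_max_iff_disj add_increasing2)+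
  then have "tau powi k = 1" by (simp add: algebra_simps)
  then have k: "k = 0" by (simp add: tau_powi_eq_1_iff)
  then have "c = 0" using \<open>X = tau powi k * X + c\<close> by simp
  then have "u * (1 - tau) = 0" by (simp add: c_def algebra_simps)
  then have u0: "u = 0" using tau_less_1 by simp
  have "\<pi> h = \<pi> \<zeta>"
    unfolding h_eq k u0 using \<pi>_carrier[OF homothety_PL[OF Z_tau_0]] \<pi>_carrier[OF PL_compact_PL[OF \<zeta>(1)]]
    by (simp only: E.r_inv E.r_one int_pow_0)
  then have "\<pi> (h \<circ> h) = \<one>\<^bsub>?E\<^esub>" using \<zeta>(2) \<pi>_comp[OF hPL hPL] by (simp only:)
  then show ?thesis by (rule one_N) (use hPL PL_comp in blast)
qed

section \<open>Confining the commutators to an interval\<close>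

text \<open>A product involves finitely many commutators, so one bound serves for all the
  supports.\<close>

lemma derived_PL_compact_supp:
  assumes "x \<in> derived (trans_group PL) PL_compact"
  shows "\<exists>M. x \<in> derived (trans_group PL) (PL_supp (- M) M)"
proof -
  interpret K: group "trans_group PL" by (rule PL_group)
  show ?thesis
  proof (rule K.derived_induct[OF PL_compact_subgroup assms])
    show "\<exists>M. \<one>\<^bsub>trans_group PL\<^esub> \<in> derived (trans_group PL) (PL_supp (- M) M)"
      unfolding derived_def by (blast intro: generate.one)
  next
    fix a b y assume "a \<in> PL_compact" "b \<in> PL_compact" "\<exists>M. y \<in> derived (trans_group PL) (PL_supp (- M) M)"
    then obtain M1 M2 M3 where M: "a \<in> PL_supp (- M1) M1" "b \<in> PL_supp (- M2) M2"
      "y \<in> derived (trans_group PL) (PL_supp (- M3) M3)" by (auto simp: PL_compact_def)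
    define M where "M = max M1 (max M2 M3)"
    have sub: "PL_supp (- M1) M1 \<subseteq> PL_supp (- M) M" "PL_supp (- M2) M2 \<subseteq> PL_supp (- M) M"
      "PL_supp (- M3) M3 \<subseteq> PL_supp (- M) M" by (rule PL_supp_mono; simp add: M_def)+
    have y': "y \<in> generate (trans_group PL) (derived_set (trans_group PL) (PL_supp (- M) M))"
      using K.mono_derived[OF sub(3)] M(3) unfolding derived_def by blast
    have "K.commutator a b \<otimes>\<^bsub>trans_group PL\<^esub> y \<in> derived (trans_group PL) (PL_supp (- M) M)"
      unfolding derived_def
    proof (rule generate.eng[OF _ y'])
      show "K.commutator a b \<in> generate (trans_group PL) (derived_set (trans_group PL) (PL_supp (- M) M))"
      by (rule generate.incl) (use M sub in blast)
    qed
    then show "\<exists>M. K.commutator a b \<otimes>\<^bsub>trans_group PL\<^esub> y \<in> derived (trans_group PL) (PL_supp (- M) M)" ..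
  qed
qed

text \<open>The commutators expressing \<open>k \<circ> k\<close> have supports in an unknown
  interval. Conjugation by a map \<open>\<sigma>\<close> that fixes the support of \<open>k\<close>
  pointwise leaves \<open>k \<circ> k\<close> unchanged but compresses that interval into
  \<open>[p, q]\<close>, with room left in \<open>[lo, hi]\<close> to displace it.\<close>

lemma PL_supp_square:
  assumes k: "k \<in> PL_supp v w" and Z: "v \<in> Z_tau" "w \<in> Z_tau" "lo \<in> Z_tau" "hi \<in> Z_tau"
    and lt: "lo < v" "v < w" "w < hi"
  shows "k \<circ> k \<in> comm_prods (trans_group (PL_supp lo hi)) 2"
proof -
  let ?K = "trans_group PL"
  interpret K: group ?K by (rule PL_group)
  have "k \<in> PL_compact" using PL_suppD[OF k] by (intro PL_compactI)
  then obtain M where M: "k \<circ> k \<in> derived ?K (PL_supp (- M) M)"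
    using derived_PL_compact_supp[OF PL_compact_square] by blast
  have kk: "k \<circ> k \<in> PL_supp v w" using subgroup.m_closed[OF PL_supp_subgroup k k] by simp
  obtain p where p: "p \<in> Z_tau" "lo < p" "p < v" using Z_tau_dense[OF lt(1)] .
  obtain q where q: "q \<in> Z_tau" "w < q" "q < hi" using Z_tau_dense[OF lt(3)] .
  obtain m :: int where m: "\<bar>M\<bar> + \<bar>v\<bar> + \<bar>w\<bar> < of_int m" using ex_less_of_int by blast
  have mZ: "- of_int m \<in> Z_tau" by auto
  \<comment> \<open>Outer pieces of \<open>\<sigma>\<close>: they send \<open>- m\<close> to
    \<open>p\<close> and \<open>m\<close> to \<open>q\<close>.\<close>
  have T: "(\<lambda>x. x + (p + of_int m)) \<in> PL" "(\<lambda>x. x + (q - of_int m)) \<in> PL"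
    using p q by (auto intro!: PL_translation)
  obtain s1 where s1: "s1 \<in> PL" "\<And>x. x \<le> - of_int m \<Longrightarrow> s1 x = x + (p + of_int m)" "\<And>x. v \<le> x \<Longrightarrow> s1 x = x"
  proof -
    have "- of_int m < v" using m by linarith
    moreover have "- of_int m + (p + of_int m) < v" using p by simp
    ultimately show ?thesis by (rule PL_join[OF T(1) PL_id(2) mZ Z(1)]) (rule that)
  qed
  obtain \<sigma> where \<sigma>: "\<sigma> \<in> PL" "\<And>x. x \<le> w \<Longrightarrow> \<sigma> x = s1 x" "\<And>x. of_int m \<le> x \<Longrightarrow> \<sigma> x = x + (q - of_int m)"
  proof -
    have "s1 w = w" "w < of_int m" using s1(3) lt m by auto
    then have "w < of_int m" "s1 w < of_int m + (q - of_int m)" using q by auto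
    then show ?thesis by (rule PL_join[OF s1(1) T(2) Z(2) Z_tau_of_int[of m]]) (rule that)
  qed
  have \<sigma>_fix: "\<sigma> x = x" if "v \<le> x" "x \<le> w" for x using that \<sigma>(2) s1(3) by simp
  have "(k \<circ> k) \<circ> \<sigma> = \<sigma> \<circ> (k \<circ> k)" using PL_supp_commute[OF kk \<sigma>(1) \<sigma>_fix] lt by simp
  then have conj_eq: "\<sigma> \<circ> (k \<circ> k) \<circ> inv_into UNIV \<sigma> = k \<circ> k"
  proof (intro ext)
    fix x
    have "(\<sigma> \<circ> (k \<circ> k)) (inv_into UNIV \<sigma> x) = ((k \<circ> k) \<circ> \<sigma>) (inv_into UNIV \<sigma> x)"
      using \<open>(k \<circ> k) \<circ> \<sigma> = \<sigma> \<circ> (k \<circ> k)\<close> by (simp only:)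
    then show "(\<sigma> \<circ> (k \<circ> k) \<circ> inv_into UNIV \<sigma>) x = (k \<circ> k) x"
      using PL_inv_simps(1)[OF \<sigma>(1)] by simp
  qed
  interpret c: group_hom ?K ?K "\<lambda>x. \<sigma> \<otimes>\<^bsub>?K\<^esub> x \<otimes>\<^bsub>?K\<^esub> inv\<^bsub>?K\<^esub> \<sigma>"
    using \<sigma>(1) by (intro K.conj_hom) simp
  let ?c = "\<lambda>x. \<sigma> \<otimes>\<^bsub>?K\<^esub> x \<otimes>\<^bsub>?K\<^esub> inv\<^bsub>?K\<^esub> \<sigma>"
  have "?c (k \<circ> k) \<in> derived ?K (?c ` PL_supp (- M) M)"
    using c.derived_img[of "PL_supp (- M) M"] M subgroup.subset[OF PL_supp_subgroup] by blast
  also have "?c (k \<circ> k) = k \<circ> k" using conj_eq \<sigma>(1) by (simp add: inv_PL)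
  finally have "k \<circ> k \<in> derived ?K (?c ` PL_supp (- M) M)" .
  moreover have "?c ` PL_supp (- M) M \<subseteq> PL_supp p q"
  proof
    fix f assume "f \<in> ?c ` PL_supp (- M) M"
    then obtain g where g: "g \<in> PL_supp (- M) M" "f = \<sigma> \<circ> g \<circ> inv_into UNIV \<sigma>" using \<sigma>(1) by (auto simp: inv_PL)
    have "\<sigma> (- of_int m) = p" "\<sigma> (of_int m) = q" using \<sigma>(2)[of "- of_int m"] \<sigma>(3) s1(2) m by auto
    moreover have "\<sigma> (- of_int m) \<le> \<sigma> (- M)" "\<sigma> M \<le> \<sigma> (of_int m)" using PL_le_iff[OF \<sigma>(1)] m by auto
    ultimately show "f \<in> PL_supp p q"
      using PL_conj_supp[OF \<sigma>(1) g(1)] PL_supp_mono[of p "\<sigma> (- M)" "\<sigma> M" q] g(2) by auto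
  qed
  ultimately have kder: "k \<circ> k \<in> derived ?K (PL_supp p q)" using K.mono_derived by blast
  let ?D = "PL_supp lo hi"
  have D: "trans_group ?D = ?K\<lparr>carrier := ?D\<rparr>" by (simp add: trans_group_def)
  have Dsub: "subgroup ?D ?K" by (rule PL_supp_subgroup)
  interpret D: group "trans_group ?D" unfolding D by (rule subgroup.subgroup_is_group[OF Dsub K.group_axioms])
  have PD: "PL_supp p q \<subseteq> ?D" "PL_supp q hi \<subseteq> ?D" by (rule PL_supp_mono; use p q lt in simp)+
  \<comment> \<open>The displacing map: it fixes \<open>lo\<close> and \<open>hi\<close> and takes
    \<open>p\<close> to \<open>q\<close>, so it carries \<open>[p, q]\<close> into
    \<open>[q, hi]\<close> and maps \<open>[q, hi]\<close> into itself.\<close>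
  have tr: "(\<lambda>x. x + (q - p)) \<in> PL" using p q by (auto intro!: PL_translation)
  obtain t1 where t1: "t1 \<in> PL" "\<And>x. x \<le> lo \<Longrightarrow> t1 x = x" "\<And>x. p \<le> x \<Longrightarrow> t1 x = x + (q - p)"
  proof -
    have "lo < p + (q - p)" using q lt by simp
    then show ?thesis by (rule PL_join[OF PL_id(2) tr Z(3) p(1) p(2)]) (rule that)
  qed
  obtain t where t: "t \<in> PL" "\<And>x. x \<le> p \<Longrightarrow> t x = t1 x" "\<And>x. hi \<le> x \<Longrightarrow> t x = x"
  proof -
    have "t1 p = q" using t1(3) by simp
    then have "p < hi" "t1 p < hi" using p q lt by auto
    then show ?thesis by (rule PL_join[OF t1(1) PL_id(2) p(1) Z(4)]) (rule that)
  qed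
  have tD: "t \<in> ?D" using t t1 p by (auto simp: PL_supp_def)
  have tp: "t p = q" "t hi = hi" using t t1 by auto
  have tq: "q \<le> t q" "t q \<le> hi" using PL_le_iff[OF t(1), of p q] PL_le_iff[OF t(1), of q hi] tp p q lt by auto
  have inv_t: "inv\<^bsub>trans_group ?D\<^esub> t = inv_into UNIV t"
    unfolding D using K.m_inv_consistent[OF Dsub tD] t(1) by (simp add: inv_PL)
  show ?thesis
  proof (rule D.derived_displaced[of "PL_supp p q" "PL_supp q hi" t])
    show "subgroup (PL_supp p q) (trans_group ?D)" "subgroup (PL_supp q hi) (trans_group ?D)"
      unfolding D using K.subgroup_incl[OF PL_supp_subgroup Dsub] PD by auto
    show "t \<in> carrier (trans_group ?D)" using tD by simp
    show "k \<circ> k \<in> derived (trans_group ?D) (PL_supp p q)"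
      unfolding D K.derived_consistent[OF PD(1) Dsub] by (rule kder)
    show "f \<otimes>\<^bsub>trans_group ?D\<^esub> g = g \<otimes>\<^bsub>trans_group ?D\<^esub> f" if f: "f \<in> PL_supp p q" and g: "g \<in> PL_supp q hi" for f g
    proof -
      have "f \<circ> g = g \<circ> f" 
        by (rule PL_supp_commute[OF f]) (use g PL_suppD[OF g] p q lt in auto)
      then show ?thesis by simp
    qed
    show "t \<otimes>\<^bsub>trans_group ?D\<^esub> f \<otimes>\<^bsub>trans_group ?D\<^esub> inv\<^bsub>trans_group ?D\<^esub> t \<in> PL_supp q hi" if "f \<in> PL_supp p q" for f
      using PL_conj_supp[OF t(1) that] PL_supp_mono[of q "t p" "t q" hi] tp tq by (auto simp: inv_t)
    show "t \<otimes>\<^bsub>trans_group ?D\<^esub> f \<otimes>\<^bsub>trans_group ?D\<^esub> inv\<^bsub>trans_group ?D\<^esub> t \<in> PL_supp q hi" if "f \<in> PL_supp q hi" for f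
      using PL_conj_supp[OF t(1) that] PL_supp_mono[of q "t q" "t hi" hi] tp tq by (auto simp: inv_t)
  qed
qed

section \<open>Periodic extension\<close>

definition periodize :: "real \<Rightarrow> (real \<Rightarrow> real) \<Rightarrow> real \<Rightarrow> real" where
  "periodize lo f x = f (x - of_int \<lfloor>x - lo\<rfloor>) + of_int \<lfloor>x - lo\<rfloor>"

lemma periodize_eq:
  assumes "lo + of_int n \<le> x" "x < lo + of_int n + 1"
  shows "periodize lo f x = f (x - of_int n) + of_int n"
proof -
  have "\<lfloor>x - lo\<rfloor> = n" using assms by (intro floor_unique) auto
  then show ?thesis by (simp add: periodize_def)
qed

lemma periodize_cell:
  fixes lo x :: real
  obtains n :: int where "lo + of_int n \<le> x" "x < lo + of_int n + 1"
proof
  show "lo + of_int \<lfloor>x - lo\<rfloor> \<le> x" "x < lo + of_int \<lfloor>x - lo\<rfloor> + 1" by linarith+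
qed

lemma periodize_add_1: "periodize lo f (x + 1) = periodize lo f x + 1"
proof -
  have "\<lfloor>x + 1 - lo\<rfloor> = \<lfloor>x - lo\<rfloor> + 1" by linarith
  then show ?thesis by (simp add: periodize_def)
qed

lemma periodize_base:
  assumes "f (lo + 1) = f lo + 1" "lo \<le> x" "x \<le> lo + 1" shows "periodize lo f x = f x"
proof (cases "x = lo + 1")
  case True
  then show ?thesis using assms(1) periodize_eq[of lo 1 x f] by simp
next
  case False
  then show ?thesis using assms periodize_eq[of lo 0 x f] by simp
qed

lemma periodize_PLZ:
  assumes f: "f \<in> PL" and lo: "lo \<in> Z_tau" and per: "f (lo + 1) = f lo + 1"
  shows "periodize lo f \<in> PLZ"
proof -
  let ?F = "periodize lo f"
  have range: "f lo + of_int n \<le> ?F x" "?F x < f lo + of_int n + 1"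
    if "lo + of_int n \<le> x" "x < lo + of_int n + 1" for n x
    using that PL_le_iff[OF f, of lo "x - of_int n"] PL_less_iff[OF f, of "x - of_int n" "lo + 1"]
    by (simp_all add: periodize_eq[OF that] per)
  have mono: "strict_mono ?F"
  proof (rule strict_monoI)
    fix x y :: real assume xy: "x < y"
    obtain n :: int where n: "lo + of_int n \<le> x" "x < lo + of_int n + 1" by (rule periodize_cell)
    obtain m :: int where m: "lo + of_int m \<le> y" "y < lo + of_int m + 1" by (rule periodize_cell)
    show "?F x < ?F y"
    proof (cases "n = m")
      case True
      then show ?thesis using xy PL_less_iff[OF f, of "x - of_int n" "y - of_int n"]
        periodize_eq[OF n, of f] periodize_eq[OF m, of f] by simp
    next
      case False
      have "of_int n < (of_int m + 1 :: real)" using n m xy by linarith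
      then have "n < m" using False by linarith
      then have "of_int n + 1 \<le> (of_int m :: real)" by linarith
      then show ?thesis using range[OF n] range[OF m] by linarith
    qed
  qed
  have surj: "surj ?F" unfolding surj_def
  proof
    fix y
    define n where "n = \<lfloor>y - f lo\<rfloor>"
    define x where "x = inv_into UNIV f (y - of_int n)"
    have fx: "f x = y - of_int n" unfolding x_def by (rule PL_inv_simps[OF f])
    have "f lo \<le> f x" "f x < f (lo + 1)" unfolding fx per n_def by linarith+
    then have "lo \<le> x" "x < lo + 1" using PL_le_iff[OF f] PL_less_iff[OF f] by auto
    then have "?F (x + of_int n) = y" using periodize_eq[of lo n "x + of_int n" f] fx by simp
    then show "\<exists>x. y = ?F x" by metis
  qed
  have int_iff: "x + of_int n \<in> Z_tau \<longleftrightarrow> x \<in> Z_tau" for x and n :: int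
    using Z_tau_add_iff[OF Z_tau_of_int[of n], of x] by (simp add: add.commute)
  have Z: "?F x \<in> Z_tau \<longleftrightarrow> x \<in> Z_tau" for x
    using int_iff[of _ "\<lfloor>x - lo\<rfloor>"] int_iff[of x "- \<lfloor>x - lo\<rfloor>"] PL_Z_tau[OF f] by (simp add: periodize_def)
  have "?F \<in> PL"
  proof (rule PL_I[OF mono surj Z])
    fix x
    obtain n :: int where n: "lo + of_int n \<le> x" "x < lo + of_int n + 1" by (rule periodize_cell)
    \<comment> \<open>Across the border of two cells the periodic extension is two neighbouring
      integer translates of \<open>f\<close> glued together; near \<open>x\<close> its germs are
      those of a map already known to be in \<open>PL\<close>.\<close>
    define sh where "sh = (\<lambda>n :: int. (\<lambda>x. x + of_int n) \<circ> (f \<circ> (\<lambda>x. x + of_int (- n))))"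
    have shPL: "sh n \<in> PL" for n
      unfolding sh_def using f by (intro PL_comp PL_translation) auto
    have sh: "sh n x = f (x - of_int n) + of_int n" for n x by (simp add: sh_def)
    define g where "g = glue (lo + of_int n) (sh (n - 1)) (sh n)"
    have agree: "sh (n - 1) (lo + of_int n) = sh n (lo + of_int n)" using per by (simp add: sh add.commute)
    have g: "g \<in> PL" unfolding g_def using lo agree by (intro PL_glue shPL) auto
    have Fg: "?F y = g y" if "lo + of_int n - 1 \<le> y" "y < lo + of_int n + 1" for y
    proof (cases "y < lo + of_int n")
      case True
      then show ?thesis using that periodize_eq[of lo "n - 1" y f] by (simp add: g_def sh)
    next
      case False
      then show ?thesis using that periodize_eq[of lo n y f] glue_ge[of "sh (n - 1)" "lo + of_int n" "sh n" y] agree by (simp add: g_def sh)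
    qed
    obtain k l :: int and e where e: "e > 0" "\<And>y. x \<le> y \<Longrightarrow> y \<le> x + e \<Longrightarrow> g y = g x + tau powi k * (y - x)"
      "\<And>y. x - e \<le> y \<Longrightarrow> y \<le> x \<Longrightarrow> g y = g x + tau powi l * (y - x)" "x \<in> Z_tau \<or> k = l"
      using PL_germ[OF g, of x] by metis
    define d where "d = min e (min 1 ((lo + of_int n + 1 - x) / 2))"
    have d: "d > 0" "d \<le> e" "d \<le> 1" using n e(1) by (auto simp: d_def min_le_iff_disj)
    have "d \<le> (lo + of_int n + 1 - x) / 2" unfolding d_def by (meson min.cobounded2 order_trans)
    then have "2 * d \<le> lo + of_int n + 1 - x" by simp
    then have d': "x + d < lo + of_int n + 1" using d(1) by linarith
    show "\<exists>k l :: int. \<exists>e>0. (\<forall>y\<in>{x..x+e}. ?F y = ?F x + tau powi k * (y - x)) \<and>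
        (\<forall>y\<in>{x-e..x}. ?F y = ?F x + tau powi l * (y - x)) \<and> (x \<in> Z_tau \<or> k = l)"
    proof (rule germI[of d _ _ k l])
      fix y assume y: "y \<in> {x..x+d}"
      have "?F y = g y" "?F x = g x" using y n d d' by (auto intro!: Fg)
      moreover have "g y = g x + tau powi k * (y - x)" using y d by (intro e(2)) auto
      ultimately show "?F y = ?F x + tau powi k * (y - x)" by (simp only:)
    next
      fix y assume y: "y \<in> {x-d..x}"
      have "?F y = g y" "?F x = g x" using y n d d' by (auto intro!: Fg)
      moreover have "g y = g x + tau powi l * (y - x)" using y d by (intro e(3)) auto
      ultimately show "?F y = ?F x + tau powi l * (y - x)" by (simp only:)
    qed (use d e(4) in auto)
  qed
  then show ?thesis by (simp add: PLZ_def periodize_add_1)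
qed

lemma PLZ_eq_periodize:
  assumes "h \<in> PLZ" "\<And>x. lo \<le> x \<Longrightarrow> x < lo + 1 \<Longrightarrow> h x = f x" shows "periodize lo f = h"
proof
  fix x
  obtain n :: int where n: "lo + of_int n \<le> x" "x < lo + of_int n + 1" by (rule periodize_cell)
  then have "periodize lo f x = h (x - of_int n) + of_int n" using assms(2) periodize_eq by simp
  then show "periodize lo f x = h x" using PLZ_add_int[OF assms(1), of "x - of_int n" n] by simp
qed

text \<open>Maps supported in one cell preserve it, so extension commutes with composition. This
  carries commutator bounds from an interval over to \<open>PLZ\<close>.\<close>

lemma periodize_hom:
  assumes lo: "lo \<in> Z_tau"
  shows "group_hom (trans_group (PL_supp lo (lo + 1))) (trans_group PLZ) (periodize lo)"
proof -
  let ?D = "PL_supp lo (lo + 1)"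
  have D: "trans_group ?D = trans_group PL\<lparr>carrier := ?D\<rparr>" by (simp add: trans_group_def)
  have grp: "group (trans_group ?D)"
    unfolding D by (rule subgroup.subgroup_is_group[OF PL_supp_subgroup PL_group])
  have base: "f (lo + 1) = f lo + 1" "f lo = lo" if "f \<in> ?D" for f
    using PL_suppD(2)[OF that, of lo] PL_suppD(3)[OF that, of "lo + 1"] by auto
  have "periodize lo (f \<circ> g) = periodize lo f \<circ> periodize lo g" if f: "f \<in> ?D" and g: "g \<in> ?D" for f g
  proof
    fix x
    obtain n :: int where n: "lo + of_int n \<le> x" "x < lo + of_int n + 1" by (rule periodize_cell)
    note gPL = PL_suppD(1)[OF g]
    have gx: "periodize lo g x = g (x - of_int n) + of_int n" by (rule periodize_eq[OF n])
    have "lo \<le> g (x - of_int n)" "g (x - of_int n) < lo + 1"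
      using PL_le_iff[OF gPL, of lo "x - of_int n"] PL_less_iff[OF gPL, of "x - of_int n" "lo + 1"] n base[OF g] by auto
    then have "periodize lo f (periodize lo g x) = f (g (x - of_int n)) + of_int n"
      using periodize_eq[of lo n "periodize lo g x" f] gx by simp
    then show "periodize lo (f \<circ> g) x = (periodize lo f \<circ> periodize lo g) x"
      using periodize_eq[OF n, of "f \<circ> g"] by simp
  qed
  moreover have "periodize lo f \<in> PLZ" if "f \<in> ?D" for f
    using periodize_PLZ[OF PL_suppD(1)[OF that] lo] base[OF that] by simp
  ultimately have "periodize lo \<in> hom (trans_group ?D) (trans_group PLZ)" by (intro homI) auto
  then show ?thesis using grp PLZ_group by (simp add: group_hom_def group_hom_axioms_def)
qed

section \<open>The upper bound\<close>

text \<open>Cutting the circle at a point \<open>lo\<close> inside the fixed arc turns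
  \<open>h\<close> into a map supported in \<open>[v, u + 1]\<close>, strictly inside
  \<open>[lo, lo + 1]\<close>; this margin is what displacement requires.\<close>

lemma PLZ_arc_square:
  assumes h: "h \<in> PLZ" and Z: "u \<in> Z_tau" "v \<in> Z_tau" and uv: "u < v" "v < u + 1"
    and id_arc: "\<And>x. u \<le> x \<Longrightarrow> x \<le> v \<Longrightarrow> h x = x"
  shows "h \<circ> h \<in> comm_prods (trans_group PLZ) 2"
proof -
  obtain lo where lo: "lo \<in> Z_tau" "u < lo" "lo < v" using Z_tau_dense[OF uv(1)] .
  have hPL: "h \<in> PL" by (rule PLZ_PL[OF h])
  have h1: "h (x + 1) = h x + 1" for x using h by (simp add: PLZ_def)
  have hlo: "h lo = lo" "h (lo + 1) = lo + 1" using id_arc[of lo] h1[of lo] lo by auto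
  define k where "k = glue lo id (glue (lo + 1) h id)"
  have lo1: "lo + 1 \<in> Z_tau" using lo by auto
  have "glue (lo + 1) h id \<in> PL" using hlo by (intro PL_glue hPL PL_id lo1) simp
  then have kPL: "k \<in> PL" unfolding k_def using hlo lo by (intro PL_glue[OF PL_id(1)]) auto
  have k_eq: "k x = h x" if "lo \<le> x" "x \<le> lo + 1" for x using that hlo by (auto simp: k_def glue_def)
  have "k \<in> PL_supp v (u + 1)"
  proof -
    have "k x = x" if "x \<le> v \<or> u + 1 \<le> x" for x
    proof (cases "lo \<le> x \<and> x \<le> lo + 1")
      case True
      then have "h x = x"
      proof (cases "x \<le> v")
        case True
        then show ?thesis using id_arc[of x] lo \<open>lo \<le> x \<and> x \<le> lo + 1\<close> by simp
      next
        case False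
        then have "h (x - 1) = x - 1" using that True lo by (intro id_arc) auto
        then show ?thesis using h1[of "x - 1"] by simp
      qed
      then show ?thesis using True k_eq by simp
    qed (auto simp: k_def glue_def)
    then show ?thesis using kPL by (simp add: PL_supp_def)
  qed
  moreover have "u + 1 \<in> Z_tau" using Z by auto
  ultimately have kk: "k \<circ> k \<in> comm_prods (trans_group (PL_supp lo (lo + 1))) 2"
    using lo Z uv lo1 by (intro PL_supp_square[of k v "u + 1"]) auto
  have hD: "k \<in> carrier (trans_group (PL_supp lo (lo + 1)))"
    using kPL hlo by (auto simp: PL_supp_def k_def glue_def)
  interpret group_hom "trans_group (PL_supp lo (lo + 1))" "trans_group PLZ" "periodize lo"
    by (rule periodize_hom[OF lo(1)])
  have "periodize lo (k \<circ> k) = h \<circ> h"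
    using hom_mult[OF hD hD] PLZ_eq_periodize[OF h, of lo k] k_eq by simp
  then show ?thesis using hom_comm_prods[OF group_hom_axioms kk] by simp
qed

lemma half_less_tau: "1/2 < tau"
proof -
  have "2 < sqrt 5" by (rule real_less_rsqrt) simp
  then show ?thesis by (simp add: tau_def)
qed

text \<open>\<open>h1\<close> copies \<open>Q\<close> near \<open>0\<close> and is the identity on
  an arc away from \<open>0\<close>; \<open>h2\<close> is the remaining factor, which is the
  identity near \<open>0\<close>. Each square costs 2 commutators, and one more pays for squaring
  the product.\<close>

lemma PLZ_fixing_0_square:
  assumes Q: "Q \<in> PLZ" and Q0: "Q 0 = 0"
  shows "Q \<circ> Q \<in> comm_prods (trans_group PLZ) 5"
proof -
  interpret G: group "trans_group PLZ" by (rule PLZ_group)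
  have QPL: "Q \<in> PL" by (rule PLZ_PL[OF Q])
  \<comment> \<open>An element of \<open>Z_tau\<close> strictly between \<open>0\<close> and
    \<open>1/2\<close>, so that the arc from \<open>p\<close> to \<open>1 - p\<close> is
    nondegenerate.\<close>
  define p where "p = 1 - tau"
  have pZ: "p \<in> Z_tau" "- p \<in> Z_tau" "1 - p \<in> Z_tau" by (auto simp: p_def)
  have p: "0 < p" "p < 1 - p" using tau_less_1 half_less_tau by (auto simp: p_def)
  define R where "R = inv_into UNIV Q"
  have R0: "R 0 = 0" unfolding R_def by (rule inv_fixed[OF QPL Q0])
  have RPL: "R \<in> PL" unfolding R_def by (rule PL_inv[OF QPL])
  have QR: "Q (R x) = x" for x unfolding R_def by (rule PL_inv_simps[OF QPL])
  have Rp: "0 < R p" "R (- p) < 0" using PL_less_iff[OF RPL, of 0 p] PL_less_iff[OF RPL, of "- p" 0] R0 p by auto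
  \<comment> \<open>So close to \<open>0\<close> that \<open>e\<close>, \<open>- e\<close> and their
    images under \<open>Q\<close> all lie within \<open>(- p, p)\<close>.\<close>
  obtain e where e: "e \<in> Z_tau" "0 < e" "e < min p (min (R p) (- R (- p)))"
    using Z_tau_dense[of 0 "min p (min (R p) (- R (- p)))"] p Rp by auto
  have eZ: "- e \<in> Z_tau" using e by auto
  have ep: "e < p" using e by simp
  have Qe: "Q e < p" "- p < Q (- e)"
    using e PL_less_iff[OF QPL, of e "R p"] PL_less_iff[OF QPL, of "R (- p)" "- e"] QR by auto
  obtain f1 where f1: "f1 \<in> PL" "\<And>x. x \<le> - p \<Longrightarrow> f1 x = x" "\<And>x. - e \<le> x \<Longrightarrow> f1 x = Q x"
  proof -
    have "- p < - e" using ep by simp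
    then show ?thesis using Qe(2) by (rule PL_join[OF PL_id(2) QPL pZ(2) eZ]) (rule that)
  qed
  obtain f where f: "f \<in> PL" "\<And>x. x \<le> e \<Longrightarrow> f x = f1 x" "\<And>x. p \<le> x \<Longrightarrow> f x = x"
  proof -
    have "f1 e < p" using f1(3)[of e] e Qe by simp
    with ep show ?thesis by (rule PL_join[OF f1(1) PL_id(2) e(1) pZ(1)]) (rule that)
  qed
  have f_low: "f x = x" if "x \<le> - p" for x using that f(2) f1(2) e p by simp
  have f_mid: "f x = Q x" if "- e \<le> x" "x \<le> e" for x using that f(2) f1(3) by simp
  have per: "f (- p + 1) = f (- p) + 1" using f(3)[of "- p + 1"] f_low[of "- p"] p by simp
  define h1 where "h1 = periodize (- p) f"
  have h1: "h1 \<in> PLZ" unfolding h1_def by (rule periodize_PLZ[OF f(1) pZ(2) per])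
  have h1_eq: "h1 x = f x" if "- p \<le> x" "x \<le> - p + 1" for x
    unfolding h1_def by (rule periodize_base[of f "- p", OF per that])
  define h2 where "h2 = inv_into UNIV h1 \<circ> Q"
  have h2: "h2 \<in> PLZ" unfolding h2_def by (intro PLZ_comp PLZ_inv h1 Q)
  have sq1: "h1 \<circ> h1 \<in> comm_prods (trans_group PLZ) 2"
  proof (rule PLZ_arc_square[OF h1 pZ(1) pZ(3)])
    show "h1 x = x" if "p \<le> x" "x \<le> 1 - p" for x using h1_eq[of x] f(3)[of x] that p by simp
  qed (use p in auto)
  have sq2: "h2 \<circ> h2 \<in> comm_prods (trans_group PLZ) 2"
  proof (rule PLZ_arc_square[OF h2 Z_tau_0 e(1)])
    fix x assume x: "0 \<le> x" "x \<le> e"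
    have "h1 x = Q x" using h1_eq[of x] f_mid[of x] x e p by simp
    then show "h2 x = x" using PL_inv_simps(2)[OF PLZ_PL[OF h1], of x] by (simp add: h2_def)
  qed (use e p in auto)
  have "Q = h1 \<circ> h2" unfolding h2_def using PL_inv_simps(1)[OF PLZ_PL[OF h1]] by auto
  then show ?thesis using G.comm_prods_square_mult[of h1 h2 2 2] h1 h2 sq1 sq2 by simp
qed

text \<open>Interpolation on the line with the extra node \<open>lo + 1\<close>, sent to
  \<open>y + 1\<close>, closes up to a periodic map.\<close>

lemma PLZ_interpolate:
  assumes "length xs = length ys" "sorted_wrt (<) (lo # xs)" "sorted_wrt (<) (y # ys)"
    "set (lo # xs) \<subseteq> Z_tau" "set (y # ys) \<subseteq> Z_tau" "\<forall>x\<in>set xs. x < lo + 1" "\<forall>z\<in>set ys. z < y + 1"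
  obtains f where "f \<in> PLZ" "map f (lo # xs) = y # ys"
proof -
  have "\<exists>f\<in>PL. map f ((lo # xs) @ [lo + 1]) = (y # ys) @ [y + 1]"
    using assms by (intro PL_interpolate_ex) (auto simp: sorted_wrt_append)
  then obtain f where f: "f \<in> PL" "map f (lo # xs) = y # ys" "f (lo + 1) = y + 1" by auto
  have per: "f (lo + 1) = f lo + 1" using f by simp
  have "periodize lo f x = f x" if "x \<in> set (lo # xs)" for x
    using that assms(2,6) by (intro periodize_base[of f lo, OF per]) (auto simp: less_imp_le)
  then have "map (periodize lo f) (lo # xs) = map f (lo # xs)" by (intro map_cong) auto
  moreover have "periodize lo f \<in> PLZ" using f per assms(4) by (intro periodize_PLZ) auto
  ultimately show ?thesis using f(2) by (intro that[of "periodize lo f"]) (simp_all only:)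
qed

text \<open>For \<open>aba\<^sup>-\<^sup>1b\<^sup>-\<^sup>1\<close> to move \<open>0\<close> by nearly \<open>2\<close>, both \<open>b\<^sup>-\<^sup>1\<close> and \<open>aba\<^sup>-\<^sup>1\<close> must gain nearly \<open>1\<close>:
  \<open>b\<close> has two fixed points on the circle, moves one arc down and the other up, and \<open>a\<close>
  stretches the second arc.\<close>
lemma commutator_moves_0:
  assumes d: "d \<in> Z_tau" "0 \<le> d" "d < 2"
  shows "\<exists>\<kappa>\<in>comm_prods (trans_group PLZ) 1. \<kappa> 0 = d"
proof (cases "d = 0")
  case True
  interpret G: group "trans_group PLZ" by (rule PLZ_group)
  have "G.commutator id id \<in> comm_prods (trans_group PLZ) 1"
    by (rule G.commutator_comm_prods) (use G.one_closed in simp_all)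
  moreover have "G.commutator id id = id" using G.inv_one by simp
  ultimately show ?thesis using True by (intro bexI[of _ id]) auto
next
  case False
  interpret G: group "trans_group PLZ" by (rule PLZ_group)
  \<comment> \<open>The bound \<open>d - 1 < w\<close> leaves room for \<open>p\<close> with
    \<open>p < w < d < p + 1\<close>, so the values prescribed for \<open>a\<close> fit into one
    period. Such a \<open>w\<close> below \<open>1\<close> exists because
    \<open>d < 2\<close>.\<close>
  obtain w where w: "w \<in> Z_tau" "max 0 (d - 1) < w" "w < min 1 d"
    using Z_tau_dense[of "max 0 (d - 1)" "min 1 d"] d False by auto
  obtain s0 where s0: "s0 \<in> Z_tau" "w - 1 < s0" "s0 < 0" using Z_tau_dense[of "w - 1" 0] w by auto
  obtain s1 where s1: "s1 \<in> Z_tau" "w < s1" "s1 < s0 + 1" using Z_tau_dense[of w "s0 + 1"] s0 by auto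
  obtain u where u: "u \<in> Z_tau" "s1 < u" "u < s0 + 1" using Z_tau_dense[OF s1(3)] .
  obtain v where v: "v \<in> Z_tau" "u < v" "v < s0 + 1" using Z_tau_dense[OF u(3)] .
  obtain p where p: "p \<in> Z_tau" "d - 1 < p" "p < w" using Z_tau_dense[of "d - 1" w] w by auto
  obtain p' where p': "p' \<in> Z_tau" "d < p'" "p' < p + 1" using Z_tau_dense[of d "p + 1"] p by auto
  have s01: "s0 + 1 \<in> Z_tau" using s0 by auto
  obtain b where b: "b \<in> PLZ" "map b [s0, w, s1, u] = [s0, 0, s1, v]"
    using PLZ_interpolate[of "[w, s1, u]" "[0, s1, v]" s0 s0] w s0 s1 u v by auto
  obtain a where a: "a \<in> PLZ" "map a [s1, u, v, s0 + 1] = [p, w, d, p']"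
    using PLZ_interpolate[of "[u, v, s0 + 1]" "[w, d, p']" s1 p] w s0 s1 u v p p' d s01 by auto
  let ?c = "a \<circ> b \<circ> inv_into UNIV a \<circ> inv_into UNIV b"
  have "?c = G.commutator a b" using a b by (simp add: inv_PLZ)
  then have "?c \<in> comm_prods (trans_group PLZ) 1" using G.commutator_comm_prods[of a b] a b by simp
  moreover have "?c 0 = d"
  \<comment> \<open>The orbit of \<open>0\<close> is \<open>0\<close>, \<open>w\<close>,
    \<open>u\<close>, \<open>v\<close>, \<open>d\<close> under the inverse of \<open>b\<close>, the
    inverse of \<open>a\<close>, then \<open>b\<close> and \<open>a\<close>.\<close>
  proof -
    have "inv_into UNIV b 0 = w" "inv_into UNIV a w = u"
      using a b PL_inv_simps(2)[OF PLZ_PL[OF b(1)], of w] PL_inv_simps(2)[OF PLZ_PL[OF a(1)], of u] by auto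
    then show ?thesis using a b by simp
  qed
  ultimately show ?thesis by blast
qed

text \<open>Once \<open>0\<close> has been taken to \<open>y'\<close>, the next commutator has to
  act at \<open>y'\<close>; conjugating by the translation by \<open>y'\<close> moves it
  there.\<close>

lemma comm_prods_move_0:
  assumes "y \<in> Z_tau" "0 \<le> y" "y < 2 * (real c + 1)"
  shows "\<exists>P\<in>comm_prods (trans_group PLZ) (Suc c). P 0 = y"
  using assms
proof (induction c arbitrary: y)
  case 0
  then show ?case using commutator_moves_0 by simp
next
  case (Suc c)
  interpret G: group "trans_group PLZ" by (rule PLZ_group)
  have "\<exists>y'\<in>Z_tau. 0 \<le> y' \<and> y' < 2 * (real c + 1) \<and> 0 \<le> y - y' \<and> y - y' < 2"
  proof (cases "y < 2 * (real c + 1)")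
    case True
    then show ?thesis using Suc.prems by (intro bexI[of _ y]) auto
  next
    case False
    \<comment> \<open>Density is needed here: \<open>2 * (real c + 1)\<close> itself is out of reach
      for \<open>Suc c\<close> factors, so \<open>y'\<close> must stay strictly below it.\<close>
    obtain y' where "y' \<in> Z_tau" "y - 2 < y'" "y' < 2 * (real c + 1)"
      using Z_tau_dense[of "y - 2" "2 * (real c + 1)"] Suc.prems by auto
    then show ?thesis using False by (intro bexI[of _ y']) auto
  qed
  then obtain y' where y': "y' \<in> Z_tau" "0 \<le> y'" "y' < 2 * (real c + 1)" "0 \<le> y - y'" "y - y' < 2" by blast
  obtain P where P: "P \<in> comm_prods (trans_group PLZ) (Suc c)" "P 0 = y'" using Suc.IH y' by blast
  obtain \<kappa> where \<kappa>: "\<kappa> \<in> comm_prods (trans_group PLZ) 1" "\<kappa> 0 = y - y'"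
    using commutator_moves_0[of "y - y'"] y' Suc.prems by auto
  define T where "T = (\<lambda>x. x + y')"
  have T: "T \<in> PLZ" unfolding T_def using y' by (intro PLZ_translation)
  have "T \<circ> \<kappa> \<circ> inv_into UNIV T \<in> comm_prods (trans_group PLZ) 1"
    using hom_comm_prods[OF G.conj_hom \<kappa>(1), of T] T by (simp add: inv_PLZ)
  then have "T \<circ> \<kappa> \<circ> inv_into UNIV T \<circ> P \<in> comm_prods (trans_group PLZ) (1 + Suc c)"
    by (rule G.comm_prods_mult[OF _ P(1), simplified trans_group_simps])
  moreover have "(T \<circ> \<kappa> \<circ> inv_into UNIV T \<circ> P) 0 = y"
  proof -
    have "inv_into UNIV T y' = 0" using PL_inv_simps(2)[OF PLZ_PL[OF T], of 0] by (simp add: T_def)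
    then show ?thesis using P \<kappa> by (simp add: T_def)
  qed
  ultimately show ?case by (metis plus_1_eq_Suc)
qed

text \<open>\<open>Q\<close> absorbs the difference between the translation by \<open>y\<close> and
  the product \<open>P\<close>, which agree at \<open>0\<close>. Squaring is what makes this error
  affordable.\<close>

lemma translation_comm_prods:
  assumes y: "y \<in> Z_tau" "0 \<le> y"
  shows "\<exists>n. (\<lambda>x. x + 2 * y) \<in> comm_prods (trans_group PLZ) n \<and> real n \<le> y + 8"
proof -
  interpret G: group "trans_group PLZ" by (rule PLZ_group)
  define c where "c = nat \<lfloor>y / 2\<rfloor>"
  have c: "real c \<le> y / 2" "y / 2 < real c + 1" using y unfolding c_def by linarith+
  then have "y < 2 * (real c + 1)" by simp
  then obtain P where P: "P \<in> comm_prods (trans_group PLZ) (Suc c)" "P 0 = y"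
    using comm_prods_move_0 y by blast
  have PZ: "P \<in> PLZ" using P G.comm_prods_carrier by auto
  define T where "T = (\<lambda>x. x + y)"
  have T: "T \<in> PLZ" unfolding T_def using y by (intro PLZ_translation)
  define Q where "Q = inv_into UNIV P \<circ> T"
  have Q: "Q \<in> PLZ" unfolding Q_def by (intro PLZ_comp PLZ_inv PZ T)
  have "Q 0 = 0" using P(2) PL_inv_simps(2)[OF PLZ_PL[OF PZ], of 0] by (simp add: Q_def T_def)
  then have QQ: "Q \<circ> Q \<in> comm_prods (trans_group PLZ) 5" by (rule PLZ_fixing_0_square[OF Q])
  have PP: "P \<circ> P \<in> comm_prods (trans_group PLZ) (Suc c + Suc c)"
    using G.comm_prods_mult[OF P(1) P(1)] by simp
  have sq: "(P \<circ> Q) \<circ> (P \<circ> Q) \<in> comm_prods (trans_group PLZ) (Suc c + Suc c + 5 + 1)"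
    by (rule G.comm_prods_square_mult[unfolded trans_group_simps, OF PZ Q PP QQ])
  have "P \<circ> Q = T" unfolding Q_def using PL_inv_simps(1)[OF PLZ_PL[OF PZ]] by auto
  have TT: "T \<circ> T = (\<lambda>x. x + 2 * y)" by (auto simp: T_def)
  \<comment> \<open>Twice \<open>Suc c\<close> for the square of \<open>P\<close>, 5 for the square
    of \<open>Q\<close>, and 1 for the commutator between them; moreover
    \<open>2 * c \<le> y\<close>.\<close>
  have "Suc c + Suc c + 5 + 1 = 2 * c + 8" by simp
  then have "(\<lambda>x. x + 2 * y) \<in> comm_prods (trans_group PLZ) (2 * c + 8)"
    using sq unfolding \<open>P \<circ> Q = T\<close> TT by (simp only:)
  then show ?thesis using c(1) by (intro exI[of _ "2 * c + 8"]) simp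
qed

section \<open>The lower bound\<close>

text \<open>If \<open>aba\<^sup>-\<^sup>1b\<^sup>-\<^sup>1\<close> moved every point by more than \<open>1\<close>, then \<open>(ab)\<^sup>n \<ge> (ba)\<^sup>n + n\<close>, although
  \<open>ab\<close> and \<open>ba\<close> are conjugate by \<open>a\<close>.\<close>
lemma commutator_displacement:
  assumes a: "a \<in> PLZ" and b: "b \<in> PLZ"
  shows "(a \<circ> b \<circ> inv_into UNIV a \<circ> inv_into UNIV b) w \<le> w + 2"
proof -
  let ?c = "a \<circ> b \<circ> inv_into UNIV a \<circ> inv_into UNIV b"
  have aPL: "a \<in> PL" and bPL: "b \<in> PL" using a b PLZ_PL by auto
  have cZ: "?c \<in> PLZ" using a b by (intro PLZ_comp PLZ_inv)
  have "\<exists>y. ?c y \<le> y + 1"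
  proof (rule ccontr)
    assume "\<not> ?thesis"
    then have big: "?c y > y + 1" for y by (simp add: not_le)
    have step: "a (b y) > b (a y) + 1" for y
      using big[of "b (a y)"] PL_inv_simps(2)[OF aPL] PL_inv_simps(2)[OF bPL] by simp
    have ge: "((a \<circ> b) ^^ n) y \<ge> ((b \<circ> a) ^^ n) y + real n" for n y
    proof (induction n)
      case (Suc n)
      have "((b \<circ> a) ^^ Suc n) y + real (Suc n) = b (a (((b \<circ> a) ^^ n) y)) + 1 + real n" by simp
      also have "\<dots> \<le> a (b (((b \<circ> a) ^^ n) y)) + real n" using step by (simp add: less_imp_le)
      also have "\<dots> = a (b (((b \<circ> a) ^^ n) y + real n))" using PLZ_add_nat[OF a] PLZ_add_nat[OF b] by simp
      also have "\<dots> \<le> a (b (((a \<circ> b) ^^ n) y))" unfolding PL_le_iff[OF aPL] PL_le_iff[OF bPL] by (rule Suc.IH)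
      also have "\<dots> = ((a \<circ> b) ^^ Suc n) y" by simp
      finally show ?case .
    qed simp
    have conj: "((a \<circ> b) ^^ n) (a y) = a (((b \<circ> a) ^^ n) y)" for n y by (induction n) auto
    obtain m :: nat where m: "\<bar>a 0\<bar> \<le> real m" using real_arch_simple by blast
    \<comment> \<open>At \<open>0\<close> the comparison gives
      \<open>W (a 0) + n \<le> a (W 0)\<close>, while \<open>a 0\<close> moves \<open>W\<close> back
      by at most \<open>m\<close> and \<open>a\<close> advances \<open>W 0\<close> by at most
      \<open>m + 1\<close>. So \<open>2 * m + 2\<close> is just too large.\<close>
    define n where "n = 2 * m + 2"
    define W where "W = ((b \<circ> a) ^^ n)"
    have WZ: "W \<in> PLZ"
    proof -
      have "((b \<circ> a) ^^ j) \<in> PLZ" for j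
      proof (induction j)
        case 0
        then show ?case using PLZ_translation[of 0] by (simp add: id_def)
      next
        case (Suc j)
        then show ?case unfolding funpow.simps by (intro PLZ_comp a b)
      qed
      then show ?thesis by (simp add: W_def)
    qed
    have "W (a 0) + real n \<le> a (W 0)" using ge[of n "a 0"] conj[of n 0] by (simp add: W_def)
    moreover have "W 0 \<le> W (a 0 + real m)" using m PL_le_iff[OF PLZ_PL[OF WZ]] by simp
    then have "W 0 - real m \<le> W (a 0)" using PLZ_add_nat[OF WZ] by simp
    moreover have "a (W 0) \<le> W 0 + real m + 1"
    proof -
      have "a (W 0) \<le> a (of_int \<lceil>W 0\<rceil>)" using PL_le_iff[OF aPL] by simp
      also have "\<dots> = a 0 + of_int \<lceil>W 0\<rceil>" using PLZ_add_int[OF a, of 0 "\<lceil>W 0\<rceil>"] by simp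
      also have "\<dots> \<le> real m + (W 0 + 1)" using m by linarith
      finally show ?thesis by simp
    qed
    ultimately show False by (simp add: n_def)
  qed
  then obtain y where y: "?c y \<le> y + 1" by blast
  \<comment> \<open>Some integer translate of \<open>y\<close> lies in \<open>[w, w + 1]\<close>;
    passing to it by monotonicity costs one more unit, whence the 2.\<close>
  define n where "n = \<lceil>w - y\<rceil>"
  have n: "w \<le> y + of_int n" "y + of_int n \<le> w + 1" unfolding n_def by linarith+
  have "?c w \<le> ?c (y + of_int n)" using n PL_le_iff[OF PLZ_PL[OF cZ]] by blast
  also have "\<dots> = ?c y + of_int n" by (rule PLZ_add_int[OF cZ])
  also have "\<dots> \<le> w + 2" using y n by linarith
  finally show ?thesis .
qed

lemma comm_prods_displacement:
  assumes "f \<in> comm_prods (trans_group PLZ) n" shows "f w \<le> w + 2 * real n"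
proof -
  have "foldr (mult (trans_group PLZ)) cs id w \<le> w + 2 * real (length cs)"
    if "set cs \<subseteq> derived_set (trans_group PLZ) (carrier (trans_group PLZ))" for cs
    using that
  proof (induction cs)
    case (Cons c cs)
    have "c \<in> derived_set (trans_group PLZ) (carrier (trans_group PLZ))"
      using Cons.prems list.set_intros(1)[of c cs] by blast
    then obtain a b where ab: "a \<in> PLZ" "b \<in> PLZ" and
      "c = a \<otimes>\<^bsub>trans_group PLZ\<^esub> b \<otimes>\<^bsub>trans_group PLZ\<^esub> inv\<^bsub>trans_group PLZ\<^esub> a \<otimes>\<^bsub>trans_group PLZ\<^esub> inv\<^bsub>trans_group PLZ\<^esub> b"
      unfolding trans_group_simps by blast
    then have "a \<in> PLZ" "b \<in> PLZ" "c = a \<circ> b \<circ> inv_into UNIV a \<circ> inv_into UNIV b"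
      by (simp_all add: inv_PLZ)
    then have "c x \<le> x + 2" for x using commutator_displacement by blast
    then have "c (foldr (mult (trans_group PLZ)) cs id w) \<le> foldr (mult (trans_group PLZ)) cs id w + 2" .
    moreover have "foldr (mult (trans_group PLZ)) cs id w \<le> w + 2 * real (length cs)"
      using Cons.prems by (intro Cons.IH) (meson set_subset_Cons subset_trans)
    moreover have "foldr (mult (trans_group PLZ)) (c # cs) id w = c (foldr (mult (trans_group PLZ)) cs id w)"
      by (subst foldr.simps, subst o_apply, subst trans_group_simps(2), subst o_apply, rule refl)
    moreover have "2 * real (length (c # cs)) = 2 * real (length cs) + 2" by simp
    ultimately show ?case by linarith
  qed simp
  then show ?thesis using assms unfolding comm_prods_def by auto
qed

section \<open>Stable commutator length of translations\<close>

lemma translation_pow: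
  "(\<lambda>x :: real. x + b) [^]\<^bsub>trans_group PLZ\<^esub> (n :: nat) = (\<lambda>x. x + real n * b)"
  by (induction n) (auto simp: nat_pow_def fun_eq_iff algebra_simps)

text \<open>Both bounds are \<open>n * b / 2\<close> up to a constant. Even powers are translations
  by twice an element of \<open>Z_tau\<close>; an odd power spends \<open>m\<close> further
  commutators on one extra copy of the translation, which lies in the derived subgroup.\<close>

lemma scl_derived_translation:
  assumes b: "b \<in> Z_tau" "0 \<le> b" and der: "(\<lambda>x. x + b) \<in> derived (trans_group PLZ) (carrier (trans_group PLZ))"
  shows "scl_derived (trans_group PLZ) (\<lambda>x. x + b) = b / 2"
proof -
  let ?G = "trans_group PLZ"
  interpret G: group ?G by (rule PLZ_group)
  let ?T = "\<lambda>n :: nat. (\<lambda>x :: real. x + real n * b)"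
  obtain m where m: "(\<lambda>x. x + b) \<in> comm_prods ?G m" using G.derived_comm_prods[OF der] by blast
  have nZ: "real j * b \<in> Z_tau" for j :: nat using b Z_tau_of_int[of "int j"] by auto
  have ex: "\<exists>c. ?T n \<in> comm_prods ?G c \<and> real c \<le> real n * b / 2 + (8 + real m)" for n
  proof (cases "even n")
    case True
    then obtain j where j: "n = 2 * j" by blast
    obtain c where "(\<lambda>x. x + 2 * (real j * b)) \<in> comm_prods ?G c" "real c \<le> real j * b + 8"
      using translation_comm_prods[OF nZ] b by auto
    then show ?thesis by (intro exI[of _ c]) (auto simp: j mult.assoc)
  next
    case False
    then obtain j where j: "n = 2 * j + 1" by (elim oddE)
    obtain c where c: "(\<lambda>x. x + 2 * (real j * b)) \<in> comm_prods ?G c" "real c \<le> real j * b + 8"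
      using translation_comm_prods[OF nZ] b by auto
    have "(\<lambda>x. x + b) \<otimes>\<^bsub>?G\<^esub> (\<lambda>x. x + 2 * (real j * b)) \<in> comm_prods ?G (m + c)"
      by (rule G.comm_prods_mult[OF m c(1)])
    moreover have "(\<lambda>x. x + b) \<otimes>\<^bsub>?G\<^esub> (\<lambda>x. x + 2 * (real j * b)) = ?T n"
      by (auto simp: j algebra_simps)
    ultimately have "?T n \<in> comm_prods ?G (m + c)" by (simp only:)
    moreover have "real j * b \<le> real n * b / 2" using b by (simp add: j algebra_simps)
    then have "real (m + c) \<le> real n * b / 2 + (8 + real m)" using c(2) by simp
    ultimately show ?thesis by blast
  qed
  have upper: "real (cl ?G (?T n)) \<le> real n * b / 2 + (8 + real m)" for n
    using ex[of n] cl_le[of "?T n" ?G] by (meson of_nat_mono order_trans)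
  have lower: "real n * b / 2 \<le> real (cl ?G (?T n))" for n
  proof -
    obtain c where "?T n \<in> comm_prods ?G c" using ex by blast
    then have "?T n \<in> comm_prods ?G (cl ?G (?T n))" by (rule comm_prods_cl)
    then show ?thesis using comm_prods_displacement[of "?T n" _ 0] by fastforce
  qed
  have "(\<lambda>n. real (cl ?G (?T n)) / real n) \<longlonglongrightarrow> b / 2"
  proof (rule tendsto_sandwich)
    show "\<forall>\<^sub>F n in sequentially. b / 2 \<le> real (cl ?G (?T n)) / real n"
      using eventually_gt_at_top[of 0]
    proof eventually_elim
      case (elim n)
      then show ?case using lower[of n] by (simp add: field_simps)
    qed
    show "\<forall>\<^sub>F n in sequentially. real (cl ?G (?T n)) / real n \<le> b / 2 + (8 + real m) / real n"
      using eventually_gt_at_top[of 0]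
    proof eventually_elim
      case (elim n)
      then show ?case using upper[of n] by (simp add: field_simps)
    qed
    have "(\<lambda>n. b / 2 + (8 + real m) / real n) \<longlonglongrightarrow> b / 2 + 0"
      by (intro tendsto_intros lim_const_over_n)
    then show "(\<lambda>n. b / 2 + (8 + real m) / real n) \<longlonglongrightarrow> b / 2" by simp
  qed simp
  then show ?thesis unfolding scl_derived_def translation_pow by (rule limI)
qed

lemma scl_translation:
  assumes b: "b \<in> Z_tau" "0 \<le> b"
  shows "(\<lambda>x. x + 2 * b) \<in> derived (trans_group PLZ) (carrier (trans_group PLZ))"
    and "scl (trans_group PLZ) (\<lambda>x. x + b) = ereal (b / 2)"
proof -
  let ?G = "trans_group PLZ"
  let ?D = "derived ?G (carrier ?G)"
  let ?P = "\<lambda>k :: nat. k \<ge> 1 \<and> (\<lambda>x. x + b) [^]\<^bsub>?G\<^esub> k \<in> ?D"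
  interpret G: group ?G by (rule PLZ_group)
  show "(\<lambda>x. x + 2 * b) \<in> ?D"
    using translation_comm_prods[OF b] G.comm_prods_derived by blast
  then have P2: "?P 2" by (simp add: translation_pow)
  \<comment> \<open>Whether the least exponent is 1 or 2 need not be decided: the
    \<open>k\<close>-th power is the translation by \<open>k * b\<close>, and dividing by
    \<open>k\<close> gives \<open>b / 2\<close> in either case.\<close>
  define k where "k = (LEAST k. ?P k)"
  have Pk: "?P k" unfolding k_def using P2 by (rule LeastI)
  have "scl_derived ?G ((\<lambda>x. x + b) [^]\<^bsub>?G\<^esub> k) = real k * b / 2"
    using Pk b Z_tau_of_int[of "int k"] unfolding translation_pow
    by (intro scl_derived_translation) auto
  then have "scl_derived ?G ((\<lambda>x. x + b) [^]\<^bsub>?G\<^esub> k) / real k = b / 2" using Pk by simp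
  moreover have "\<exists>k. ?P k" using P2 by blast
  ultimately show "scl ?G (\<lambda>x. x + b) = ereal (b / 2)"
    unfolding scl_def Let_def k_def by (simp only: if_True)
qed

theorem theorem6p10:
  fixes x :: real
  assumes "x \<in> (\<lambda>y. y / 2) ` Z_tau"
    and "x \<ge> 0"
  shows "(\<exists>g \<in> carrier (total_lift T_tau). scl (total_lift T_tau) g = ereal x) \<and>
         (x \<in> Z_tau \<longrightarrow>
            (\<exists>g \<in> derived (total_lift T_tau) (carrier (total_lift T_tau)).
               scl (total_lift T_tau) g = ereal x))"
proof -
  have "2 * x \<in> Z_tau" "0 \<le> 2 * x" using assms by auto
  note * = scl_translation[OF this]
  have "(\<lambda>y. y + 2 * x) \<in> carrier (total_lift T_tau)"
    using PLZ_translation[OF \<open>2 * x \<in> Z_tau\<close>] by (simp add: total_lift_T_tau)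
  \<comment> \<open>The same translation serves for both claims: for \<open>x\<close> in
    \<open>Z_tau\<close> it is a translation by twice an element of \<open>Z_tau\<close>.\<close>
  moreover have "(\<lambda>y. y + 2 * x) \<in> derived (total_lift T_tau) (carrier (total_lift T_tau))" if "x \<in> Z_tau"
    unfolding total_lift_T_tau by (rule scl_translation(1)[OF that assms(2)])
  moreover have "scl (total_lift T_tau) (\<lambda>y. y + 2 * x) = ereal x"
    unfolding total_lift_T_tau using *(2) by simp
  ultimately show ?thesis by blast
qed

end
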